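(* Let $D\in(0,\infty]$ and let $a,b$ be Borel measurable on $[0,D]$ with $a>0$ on $(0,D)$ and with $b/a$ and $e^{C}/a$ locally integrable on $[0,D]$, where $C(x)=\int_0^x \frac{b(u)}{a(u)}\,du$. Let $\lambda_0$ be the mixed (Neumann at $0$, Dirichlet at $D$) principal eigenvalue, and let $I$, $II$, $R$ and the function classes $\mathcal F_I,\mathcal F_{II},\mathcal H,\widetilde{\mathcal F}_I,\widetilde{\mathcal F}_{II},\widetilde{\mathcal H}$ be as defined in the context. Then the following variational formulas hold. (1) Single integral forms: $$\inf_{f\in\widetilde{\mathcal F}_I}\ \sup_{x\in(0,D)} I(f)(x)^{-1}=\lambda_0=\sup_{f\in\mathcal F_I}\ \inf_{x\in(0,D)} I(f)(x)^{-1}.$$ (2) Double integral forms: $$\inf_{f\in\widetilde{\mathcal F}_{II}}\ \sup_{x\in\mathrm{supp}(f)} II(f)(x)^{-1}=\lambda_0=\sup_{f\in\mathcal F_{II}}\ \inf_{x\in(0,D)} II(f)(x)^{-1}.$$ (3) If moreover $a,b\in\mathcal C[0,D]$, then additionally the differential form holds: $$\inf_{h\in\widetilde{\mathcal H}}\ \sup_{x\in(0,D)} R(h)(x)=\lambda_0=\sup_{h\in\mathcal H}\ \inf_{x\in(0,D)} R(h)(x).$$ Furthermore, the supremum on the right-hand side of each of the three formulas can be attained.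
   Context: Conventions. When $D=\infty$, $[0,D]$ is read as $[0,\infty)$. $\mathcal C[0,D]$ is the set of continuous functions on $[0,D]$ (on $[0,\infty)$ if $D=\infty$); $\mathcal C^k(0,D)$ is the set of functions with continuous derivatives of order $k$ on $(0,D)$. Convention $1/0=\infty$ (and $1/\infty=0$). Operator and measures. $L=a(x)\frac{d^2}{dx^2}+b(x)\frac{d}{dx}$, $\mu(dx)=\frac{e^{C(x)}}{a(x)}dx$, $\nu(dx)=e^{-C(x)}dx$, $\mu(f)=\int_0^D f\,d\mu$, $\nu(\alpha,\beta)=\int_\alpha^\beta d\nu$, and $D(f)=\int_0^D a\,f'^2\,d\mu$ (the functional $D(\cdot)$ is not to be confused with the endpoint $D$). Eigenvalue. Let $\mathcal C_K[0,D]=\{f\in\mathcal C^1(0,D)\cap\mathcal C[0,D]: f \text{ has compact support}\}$ and $$\lambda_0=\inf\{D(f):\mu(f^2)=1,\ f\in\mathcal C_K[0,D],\ f(D)=0 \text{ if } D<\infty\}.$$ Operators. With $\mathrm{supp}(f)=\{x: f(x)\neq0\}$, $$I(f)(x)=-\frac{e^{-C(x)}}{f'(x)}\int_0^x f\,d\mu,\qquad II(f)(x)=\frac1{f(x)}\int_{(x,D)\cap\mathrm{supp}(f)}\nu(ds)\int_0^s f\,d\mu\quad(x\in\mathrm{supp}(f)),$$ $$R(h)(x)=-(ah^2+bh+ah')(x).$$ Classes for lower estimates. $\mathcal F_I=\{f\in\mathcal C^1(0,D)\cap\mathcal C[0,D]: f|_{(0,D)}>0,\ f'|_{(0,D)}<0\}$;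 $\mathcal F_{II}=\{f\in\mathcal C[0,D]: f|_{(0,D)}>0\}$; $\mathcal H=\{h\in\mathcal C^1(0,D)\cap\mathcal C[0,D]: h(0)=0,\ h|_{(0,D)}<0 \text{ if } \nu(0,D)<\infty,\ \text{and } h|_{(0,D)}\le0 \text{ if }\nu(0,D)=\infty\}$. Classes for upper estimates. $\widetilde{\mathcal F}_I$: all $f$ for which there are $x_0,x_1\in[0,D)$, $x_0<x_1$, with $f\in\mathcal C^1(x_0,x_1)\cap\mathcal C[x_0,x_1]$, $f'|_{(x_0,x_1)}<0$ and $f=f(\cdot\vee x_0)\mathbf 1_{[0,x_1)}$. For such $f$, $I(f)(x)=\infty$ for $x\notin(x_0,x_1)$ by the convention $1/0=\infty$. $\widetilde{\mathcal F}_{II}$: all $f$ for which there is $x_0\in(0,D)$ with $f=f\mathbf 1_{[0,x_0)}$, $f\in\mathcal C[0,x_0]$ and $f>0$ on $(0,x_0)$. $\widetilde{\mathcal H}$: all $h$ for which there is $x_0\in(0,D)$ with $h\in\mathcal C^1(0,x_0)\cap\mathcal C[0,x_0]$, $h|_{(0,x_0)}<0$, $h|_{[x_0,D]}=0$, $h(0)=0$, and $\sup_{(0,x_0)}(ah^2+bh+ah')<0$. For such $h$, $R(h)$ is taken to be $0$ on $[x_0,D)$.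
   Formalization: In (3) the class H-tilde as written is empty, so h is required to tend to −∞ at x0 from the left instead of being continuous there; for D<∞ the supremum is not attained in H, so attainment is in H with limit −∞ at D also allowed (the formula over H itself is kept). *)

theory Defs
  imports "HOL-Analysis.Analysis"
begin

text \<open>
  The right endpoint \<open>D\<close> is an extended real. A function on \<open>[0,D]\<close> is a total function
  on the reals of which only the values on \<open>[0,D]\<close> matter.
\<close>

text \<open>\<open>[0,D]\<close>, which is \<open>[0,\<infinity>)\<close> for \<open>D = \<infinity>\<close>, and \<open>(0,D)\<close>.\<close>

definition cl_ivl :: "ereal \<Rightarrow> real set" where
  "cl_ivl D = {x. 0 \<le> x \<and> ereal x \<le> D}"

definition op_ivl :: "ereal \<Rightarrow> real set" where
  "op_ivl D = {x. 0 < x \<and> ereal x < D}"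

text \<open>To be used for open \<open>S\<close> only.\<close>

definition C1_on :: "real set \<Rightarrow> (real \<Rightarrow> real) \<Rightarrow> bool" where
  "C1_on S f \<longleftrightarrow> (\<forall>x\<in>S. f differentiable (at x)) \<and> continuous_on S (deriv f)"

definition supp :: "ereal \<Rightarrow> (real \<Rightarrow> real) \<Rightarrow> real set" where
  "supp D f = {x \<in> cl_ivl D. f x \<noteq> 0}"

definition locally_integrable :: "ereal \<Rightarrow> (real \<Rightarrow> real) \<Rightarrow> bool" where
  "locally_integrable D g \<longleftrightarrow>
     (\<forall>K. compact K \<and> K \<subseteq> cl_ivl D \<longrightarrow> set_integrable lborel K g)"


subsection \<open>Speed and scale measures, principal eigenvalue\<close>

definition Cfun :: "(real \<Rightarrow> real) \<Rightarrow> (real \<Rightarrow> real) \<Rightarrow> real \<Rightarrow> real" where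
  "Cfun a b x = (LINT u:{0..x}|lborel. b u / a u)"

text \<open>
  Both measures are carried by \<open>(0,D)\<close>; they have no atoms, so the endpoints do not matter.
\<close>

definition mu :: "(real \<Rightarrow> real) \<Rightarrow> (real \<Rightarrow> real) \<Rightarrow> ereal \<Rightarrow> real measure" where
  "mu a b D = density lborel (\<lambda>x. ennreal (exp (Cfun a b x) / a x) * indicator (op_ivl D) x)"

definition nu :: "(real \<Rightarrow> real) \<Rightarrow> (real \<Rightarrow> real) \<Rightarrow> ereal \<Rightarrow> real measure" where
  "nu a b D = density lborel (\<lambda>x. ennreal (exp (- Cfun a b x)) * indicator (op_ivl D) x)"

definition Dform :: "(real \<Rightarrow> real) \<Rightarrow> (real \<Rightarrow> real) \<Rightarrow> ereal \<Rightarrow> (real \<Rightarrow> real) \<Rightarrow> ennreal" where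
  "Dform a b D f = (\<integral>\<^sup>+x\<in>op_ivl D. ennreal (a x * (deriv f x)\<^sup>2) \<partial>mu a b D)"

definition C_K :: "ereal \<Rightarrow> (real \<Rightarrow> real) set" where
  "C_K D = {f. C1_on (op_ivl D) f \<and> continuous_on (cl_ivl D) f \<and> compact (closure (supp D f))}"

definition lambda0 :: "(real \<Rightarrow> real) \<Rightarrow> (real \<Rightarrow> real) \<Rightarrow> ereal \<Rightarrow> ereal" where
  "lambda0 a b D =
     (INF f \<in> {f \<in> C_K D. (\<integral>\<^sup>+x\<in>op_ivl D. ennreal ((f x)\<^sup>2) \<partial>mu a b D) = 1 \<and>
                        (\<forall>d. D = ereal d \<longrightarrow> f d = 0)}.
        enn2ereal (Dform a b D f))"


subsection \<open>Operators\<close>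

text \<open>
  The value \<open>\<infinity>\<close> is the convention \<open>1/0 = \<infinity>\<close>. For \<open>f\<close> in \<open>Ft_I\<close> below, with points \<open>x0 < x1\<close>,
  \<open>f\<close> is constant on \<open>[0,x0]\<close> and on \<open>[x1,D]\<close>, hence at every \<open>x\<close> in \<open>(0,D)\<close> outside
  \<open>(x0,x1)\<close> either \<open>f' x = 0\<close> or \<open>f\<close> is not differentiable (possible at \<open>x0\<close> and \<open>x1\<close> only):
  so \<open>I_op a b D f x = \<infinity>\<close> exactly outside \<open>(x0,x1)\<close>.
\<close>

definition I_op ::
  "(real \<Rightarrow> real) \<Rightarrow> (real \<Rightarrow> real) \<Rightarrow> ereal \<Rightarrow> (real \<Rightarrow> real) \<Rightarrow> real \<Rightarrow> ereal" where
  "I_op a b D f x =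
     (if f differentiable (at x) \<and> deriv f x \<noteq> 0
      then ereal (- (exp (- Cfun a b x) / deriv f x) * (LINT t:{0..x}|mu a b D. f t))
      else \<infinity>)"

text \<open>
  For \<open>s < D\<close> the inner integral is finite on the classes used; the outer one may be infinite.
\<close>

definition II_op ::
  "(real \<Rightarrow> real) \<Rightarrow> (real \<Rightarrow> real) \<Rightarrow> ereal \<Rightarrow> (real \<Rightarrow> real) \<Rightarrow> real \<Rightarrow> ereal" where
  "II_op a b D f x =
     enn2ereal (\<integral>\<^sup>+s\<in>{x<..} \<inter> op_ivl D \<inter> supp D f.
                  ennreal (LINT t:{0..s}|mu a b D. f t) \<partial>nu a b D) / ereal (f x)"

text \<open>
  The value \<open>0\<close> at points where \<open>h\<close> is not differentiable is only met for \<open>h\<close> in \<open>Ht\<close> below, at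
  \<open>x0\<close>: it makes \<open>R_op a b h\<close> vanish on the whole of \<open>[x0,D)\<close>.
\<close>

definition R_op :: "(real \<Rightarrow> real) \<Rightarrow> (real \<Rightarrow> real) \<Rightarrow> (real \<Rightarrow> real) \<Rightarrow> real \<Rightarrow> real" where
  "R_op a b h x =
     (if h differentiable (at x)
      then - (a x * (h x)\<^sup>2 + b x * h x + a x * deriv h x) else 0)"


subsection \<open>Classes for the lower estimates\<close>

definition F_I :: "ereal \<Rightarrow> (real \<Rightarrow> real) set" where
  "F_I D = {f. C1_on (op_ivl D) f \<and> continuous_on (cl_ivl D) f \<and>
               (\<forall>x\<in>op_ivl D. 0 < f x) \<and> (\<forall>x\<in>op_ivl D. deriv f x < 0)}"

definition F_II :: "ereal \<Rightarrow> (real \<Rightarrow> real) set" where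
  "F_II D = {f. continuous_on (cl_ivl D) f \<and> (\<forall>x\<in>op_ivl D. 0 < f x)}"

definition H_sign ::
  "(real \<Rightarrow> real) \<Rightarrow> (real \<Rightarrow> real) \<Rightarrow> ereal \<Rightarrow> (real \<Rightarrow> real) \<Rightarrow> bool" where
  "H_sign a b D h \<longleftrightarrow>
     (emeasure (nu a b D) (op_ivl D) < \<infinity> \<longrightarrow> (\<forall>x\<in>op_ivl D. h x < 0)) \<and>
     (emeasure (nu a b D) (op_ivl D) = \<infinity> \<longrightarrow> (\<forall>x\<in>op_ivl D. h x \<le> 0))"

definition H :: "(real \<Rightarrow> real) \<Rightarrow> (real \<Rightarrow> real) \<Rightarrow> ereal \<Rightarrow> (real \<Rightarrow> real) set" where
  "H a b D = {h. C1_on (op_ivl D) h \<and> continuous_on (cl_ivl D) h \<and> h 0 = 0 \<and> H_sign a b D h}"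

text \<open>
  As \<open>H\<close>, but if \<open>D < \<infinity>\<close> then continuity at \<open>D\<close> is understood in the extended reals: the limit at
  \<open>D\<close> may be \<open>- \<infinity>\<close>, the value \<open>h D\<close> is irrelevant. If \<open>D = \<infinity>\<close> the two classes coincide. If
  \<open>D < \<infinity>\<close> the supremum in the differential form is attained only in this larger class: the maximizer is
  \<open>f' / f\<close> for the eigenfunction \<open>f\<close>, and \<open>f\<close> vanishes at \<open>D\<close>.
\<close>

definition H_ext :: "(real \<Rightarrow> real) \<Rightarrow> (real \<Rightarrow> real) \<Rightarrow> ereal \<Rightarrow> (real \<Rightarrow> real) set" where
  "H_ext a b D =
     {h. C1_on (op_ivl D) h \<and> continuous_on (insert 0 (op_ivl D)) h \<and>
         (\<forall>d. D = ereal d \<longrightarrow> (\<exists>l::ereal. ((\<lambda>x. ereal (h x)) \<longlongrightarrow> l) (at_left d))) \<and>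
         h 0 = 0 \<and> H_sign a b D h}"


subsection \<open>Classes for the upper estimates\<close>

definition Ft_I :: "ereal \<Rightarrow> (real \<Rightarrow> real) set" where
  "Ft_I D = {f. \<exists>x0 x1. 0 \<le> x0 \<and> x0 < x1 \<and> ereal x1 < D \<and>
               C1_on {x0<..<x1} f \<and> continuous_on {x0..x1} f \<and>
               (\<forall>x\<in>{x0<..<x1}. deriv f x < 0) \<and>
               (\<forall>x\<in>cl_ivl D. f x = f (max x x0) * indicator {0..<x1} x)}"

definition Ft_II :: "ereal \<Rightarrow> (real \<Rightarrow> real) set" where
  "Ft_II D = {f. \<exists>x0\<in>op_ivl D.
               (\<forall>x\<in>cl_ivl D. f x = f x * indicator {0..<x0} x) \<and>
               continuous_on {0..x0} f \<and> (\<forall>x\<in>{0<..<x0}. 0 < f x)}"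

text \<open>
  The class is meant to contain the functions \<open>f' / f\<close> on \<open>(0,x0)\<close>, cut off at \<open>x0\<close>, with
  \<open>f > 0\<close> on \<open>[0,x0)\<close> and \<open>f x0 = 0\<close>. Accordingly continuity of \<open>h\<close> on \<open>[0,x0]\<close> before the
  cut-off is understood in the extended reals, with limit \<open>- \<infinity>\<close> at \<open>x0\<close>.

  The two readings with a finite limit at \<open>x0\<close> are not usable. If \<open>h\<close> itself, with \<open>h x0 = 0\<close>,
  has to be continuous on \<open>[0,x0]\<close>, no \<open>h\<close> satisfies the conditions (lemma \<open>Ht_continuous_empty\<close>
  below). If an arbitrary finite limit is allowed, then for \<open>a = 1\<close>, \<open>b = 0\<close>, \<open>D = 1\<close>
  and small \<open>\<epsilon> > 0\<close> the class contains \<open>- \<epsilon> x\<close> cut off at \<open>1/2\<close>, for which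
  \<open>sup R \<le> \<epsilon>\<close>, whereas the eigenvalue is \<open>\<pi>\<^sup>2 / 4\<close>.
\<close>

definition Ht :: "(real \<Rightarrow> real) \<Rightarrow> (real \<Rightarrow> real) \<Rightarrow> ereal \<Rightarrow> (real \<Rightarrow> real) set" where
  "Ht a b D = {h. \<exists>x0\<in>op_ivl D.
               C1_on {0<..<x0} h \<and> continuous_on {0..<x0} h \<and>
               filterlim h at_bot (at_left x0) \<and>
               (\<forall>x\<in>{0<..<x0}. h x < 0) \<and>
               (\<forall>x\<in>cl_ivl D. x0 \<le> x \<longrightarrow> h x = 0) \<and>
               h 0 = 0 \<and>
               (SUP x\<in>{0<..<x0}. ereal (a x * (h x)\<^sup>2 + b x * h x + a x * deriv h x)) < 0}"

lemma Ht_continuous_empty: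
  fixes a b h :: "real \<Rightarrow> real" and D :: ereal and x0 :: real
  assumes "\<forall>x\<in>op_ivl D. 0 < a x"
    and "locally_integrable D (\<lambda>x. b x / a x)"
    and "continuous_on (cl_ivl D) a" and "continuous_on (cl_ivl D) b"
    and "x0 \<in> op_ivl D"
    and "C1_on {0<..<x0} h" and "continuous_on {0..x0} h"
    and "h 0 = 0" and "h x0 = 0"
    and "(SUP x\<in>{0<..<x0}. ereal (a x * (h x)\<^sup>2 + b x * h x + a x * deriv h x)) < 0"
  shows False
proof -
  have x0: "0 < x0" "ereal x0 < D" using assms(5) by (auto simp: op_ivl_def)
  have inop: "x \<in> op_ivl D" if "x \<in> {0<..<x0}" for x
    using that x0 by (auto simp: op_ivl_def intro: less_trans[of "ereal x" "ereal x0" D])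
  have incl: "x \<in> cl_ivl D" if "x \<in> {0..x0}" for x
    using that x0 by (auto simp: cl_ivl_def intro: order.trans[of "ereal x" "ereal x0" D])
  let ?q = "\<lambda>x. b x / a x"
  have si: "set_integrable lborel {0..x0} ?q"
    using assms(2)[unfolded locally_integrable_def, rule_format, of "{0..x0}"] incl
    by (simp add: subset_iff)
  have hk: "?q integrable_on {0..x0}"
    using set_borel_integral_eq_integral(1)[OF si] .
  define P where "P x = integral {0..x} ?q" for x
  define g where "g x = exp (P x) * h x" for x
  have contP: "continuous_on {0..x0} P"
    unfolding P_def by (rule indefinite_integral_continuous_1[OF hk])
  have contg: "continuous_on {0..x0} g"
    unfolding g_def by (intro continuous_intros contP assms(7))
  have der: "\<exists>y. DERIV g x :> y \<and> y < 0" if x: "0 < x" "x < x0" for x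
  proof -
    have xin: "x \<in> {0<..<x0}" using x by auto
    have ax: "0 < a x" using assms(1) inop[OF xin] by blast
    have ca: "continuous_on {0..x0} a" "continuous_on {0..x0} b"
      using assms(3,4) incl by (meson continuous_on_subset subsetI)+
    have "isCont a x" "isCont b x"
      using continuous_on_interior[OF ca(1)] continuous_on_interior[OF ca(2)] xin
      by (auto simp: interior_atLeastAtMost_real)
    then have "isCont ?q x" using ax by (intro continuous_intros) auto
    then have cw: "continuous (at x within {0..x0}) ?q"
      by (rule continuous_at_imp_continuous_at_within)
    have "(P has_vector_derivative ?q x) (at x within {0..x0})"
      unfolding P_def
      using integral_has_vector_derivative_continuous_at[OF hk, of x "{}"] cw x by simp
    then have "(P has_vector_derivative ?q x) (at x)"
      using x by (simp add: at_within_Icc_at)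
    then have dP: "DERIV P x :> ?q x"
      by (simp add: has_real_derivative_iff_has_vector_derivative)
    have "h differentiable (at x)" using assms(6) xin by (auto simp: C1_on_def)
    then have dh: "DERIV h x :> deriv h x"
      by (metis DERIV_imp_deriv real_differentiable_def)
    have dg: "DERIV g x :> exp (P x) * ?q x * h x + exp (P x) * deriv h x"
      unfolding g_def by (auto intro!: derivative_eq_intros dP dh simp: algebra_simps)
    have "ereal (a x * (h x)\<^sup>2 + b x * h x + a x * deriv h x) < 0"
      using assms(10) SUP_upper[OF xin, of "\<lambda>x. ereal (a x * (h x)\<^sup>2 + b x * h x + a x * deriv h x)"]
      by (meson order_le_less_trans)
    then have "a x * (h x)\<^sup>2 + b x * h x + a x * deriv h x < 0" by simp
    moreover have "0 \<le> a x * (h x)\<^sup>2" using ax by simp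
    ultimately have "b x * h x + a x * deriv h x < 0" by linarith
    then have neg: "?q x * h x + deriv h x < 0"
      using ax by (simp add: field_simps)
    have "exp (P x) * ?q x * h x + exp (P x) * deriv h x
        = exp (P x) * (?q x * h x + deriv h x)" by (simp only: algebra_simps)
    also have "\<dots> < 0" using neg by (intro mult_pos_neg) auto
    finally show ?thesis using dg by blast
  qed
  have "g x0 < g 0"
    by (rule DERIV_neg_imp_decreasing_open[OF x0(1)]) (use der contg in auto)
  then show False using assms(8,9) by (simp add: g_def)
qed

end

theory Submission
  imports Defs
begin

text \<open>
  With \<open>p = exp (- C)\<close> and \<open>m = exp C / a\<close> an eigenfunction \<open>f\<close> with
  Neumann condition at \<open>0\<close> and \<open>f 0 = 1\<close> satisfies the Volterra equation
  \<open>f x = 1 - \<lambda> \<integral>\<^sub>0\<^sup>x p(s) \<integral>\<^sub>0\<^sup>s m f\<close>. Its Neumann series gives a solution \<open>sol \<lambda>\<close> for every \<open>\<lambda>\<close>,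
  continuous in \<open>\<lambda>\<close>. Let \<open>Lam\<close> be the supremum of the \<open>\<lambda> \<ge> 0\<close> for which \<open>sol \<lambda>\<close> is positive on
  \<open>(0,D)\<close>. Then \<open>sol Lam\<close> is positive on \<open>(0,D)\<close>, whereas \<open>sol \<lambda>\<close> has a first zero in \<open>(0,D)\<close> for
  \<open>\<lambda> > Lam\<close>. Every quantity in the theorem is equal to \<open>Lam\<close>.

  The main tool is a comparison principle for positive functions on an interval \<open>(0,z)\<close> (lemma
  \<open>comparison\<close>): if \<open>f x \<ge> \<alpha> \<integral>\<^sub>x\<^sup>z \<nu>(ds) \<integral>\<^sub>0\<^sup>s f d\<mu>\<close> and \<open>g x \<le> \<beta> \<integral>\<^sub>x\<^sup>z \<nu>(ds) \<integral>\<^sub>0\<^sup>s g d\<mu>\<close>, then \<open>\<alpha> \<le> \<beta>\<close>, as the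
  supremum of \<open>g / f\<close> shows. A test function for an upper estimate satisfies the second inequality
  with \<open>\<beta>\<close> the supremum in question, and is compared with \<open>sol Lam\<close>; a test function for a lower
  estimate satisfies the first one with \<open>\<alpha>\<close> the infimum in question, and is compared with \<open>sol \<lambda>\<close> for
  \<open>\<lambda> > Lam\<close> (lemmas \<open>Lam_le_of_subsolution\<close>, \<open>Lam_ge_of_supersolution\<close>). The conditions in terms of
  \<open>I\<close> integrate to those in terms of \<open>II\<close>, and the substitution \<open>f = exp (\<integral> h)\<close> turns conditions on
  \<open>R h\<close> into those on \<open>I f\<close> (lemma \<open>riccati_comparison\<close>).

  Conversely \<open>sol \<lambda>\<close> with \<open>\<lambda> > Lam\<close>, cut off at its first zero, shows that the infima are at most
  \<open>\<lambda>\<close>, and \<open>sol Lam\<close>, respectively its logarithmic derivative, attains the suprema. Two cases need care.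
  If \<open>Lam = 0\<close>, then \<open>sol Lam\<close> is constant and other maximizers are required. If \<open>D < \<infinity>\<close>, then
  the logarithmic derivative of \<open>sol Lam\<close> may be infinite at \<open>D\<close>, and those of \<open>sol \<lambda>\<close> with
  \<open>\<lambda> < Lam\<close> approximate it within the smaller class.

  That \<open>Lam\<close> is the infimum of the Rayleigh quotient has two halves. A weighted Cauchy--Schwarz
  inequality with weight \<open>- f'\<close> for \<open>f = sol Lam\<close>, followed by an exchange of integrals, gives
  \<open>D(g) \<ge> Lam \<mu>(g\<^sup>2)\<close> (lemma \<open>energy_ge_Lam\<close>). Smooth truncations of \<open>sol \<lambda>\<close> for \<open>\<lambda> > Lam\<close> have quotients
  arbitrarily close to \<open>\<lambda>\<close> (lemma \<open>test_function\<close>).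
\<close>

section \<open>Intervals and integrals\<close>

lemma op_ivl_subset_cl_ivl: "op_ivl D \<subseteq> cl_ivl D"
  by (auto simp: op_ivl_def cl_ivl_def)

lemma op_cl: "x \<in> op_ivl D \<Longrightarrow> x \<in> cl_ivl D"
  using op_ivl_subset_cl_ivl by auto

lemma atLeastAtMost_subset_cl_ivl: "x \<in> cl_ivl D \<Longrightarrow> {0..x} \<subseteq> cl_ivl D"
  by (auto simp: cl_ivl_def intro: order_trans[of "ereal _" "ereal x" D])

lemma cl_ivl_downward: "x \<in> cl_ivl D \<Longrightarrow> 0 \<le> y \<Longrightarrow> y \<le> x \<Longrightarrow> y \<in> cl_ivl D"
  using atLeastAtMost_subset_cl_ivl[of x D] by auto

lemma op_ivl_below: "x \<in> cl_ivl D \<Longrightarrow> 0 < y \<Longrightarrow> y < x \<Longrightarrow> y \<in> op_ivl D"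
  by (auto simp: cl_ivl_def op_ivl_def intro: less_le_trans[of "ereal y" "ereal x" D])

lemma op_ivl_real [simp]: "op_ivl (ereal d) = {0<..<d}"
  by (auto simp: op_ivl_def)

lemma cl_ivl_real [simp]: "cl_ivl (ereal d) = {0..d}"
  by (auto simp: cl_ivl_def)

lemma op_ivl_infinity [simp]: "op_ivl \<infinity> = {0<..}"
  by (auto simp: op_ivl_def)

lemma cl_ivl_infinity [simp]: "cl_ivl \<infinity> = {0..}"
  by (auto simp: cl_ivl_def)

lemma open_op_ivl [simp]: "open (op_ivl D)"
proof (cases D)
  case MInf then have "op_ivl D = {}" by (auto simp: op_ivl_def) then show ?thesis by simp
qed auto

lemma borel_op_ivl [measurable, simp]: "op_ivl D \<in> sets borel"
  by simp

lemma op_ivl_above: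
  assumes "x \<in> op_ivl D" obtains z where "z \<in> op_ivl D" "x < z"
proof -
  have "ereal x < D" using assms by (simp add: op_ivl_def)
  then obtain z where "ereal x < ereal z" "ereal z < D"
    using ereal_dense2 by blast
  with assms that show ?thesis by (auto simp: op_ivl_def)
qed

lemma op_ivl_nonempty: assumes "0 < D" obtains x where "x \<in> op_ivl D"
  using assms ereal_dense2[of 0 D] by (auto simp: op_ivl_def zero_ereal_def)

lemma cl_ivl_zero: "0 < D \<Longrightarrow> 0 \<in> cl_ivl D"
  by (simp add: cl_ivl_def zero_ereal_def[symmetric] less_imp_le)

lemma continuous_on_cl_ivl:
  fixes f :: "real \<Rightarrow> real"
  assumes "\<And>x. x \<in> cl_ivl D \<Longrightarrow> continuous_on {0..x} f"
  shows "continuous_on (cl_ivl D) f"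
proof (cases D)
  case (real d)
  show ?thesis
    using assms[of d] real by (cases "0 \<le> d") auto
next
  case PInf
  have "continuous (at x within {0..}) f" if "0 \<le> x" for x
  proof -
    have "at x within {0..} = at x within {0..x+1}"
      by (rule at_within_nhd[of x "{..<x+1}"]) auto
    moreover have "continuous (at x within {0..x+1}) f"
      using assms[of "x+1"] PInf that by (simp add: continuous_on_eq_continuous_within)
    ultimately show ?thesis by (simp add: continuous_within)
  qed
  then show ?thesis using PInf by (simp add: continuous_on_eq_continuous_within)
next
  case MInf then show ?thesis by (simp add: cl_ivl_def)
qed

lemma ennreal_indicator_measurable:
  fixes g :: "real \<Rightarrow> real"
  assumes "(\<lambda>x. indicator S x *\<^sub>R g x) \<in> borel_measurable borel"
  shows "(\<lambda>x. ennreal (g x) * indicator S x) \<in> borel_measurable lborel"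
proof -
  note measurable_compose[OF assms measurable_ennreal]
  also have "(\<lambda>x. ennreal (indicator S x *\<^sub>R g x)) = (\<lambda>x. ennreal (g x) * indicator S x)"
    by (auto simp: fun_eq_iff split: split_indicator)
  finally show ?thesis by (simp only: measurable_lborel2)
qed

lemmas ennreal_indicator_measurable_continuous =
  ennreal_indicator_measurable[OF borel_measurable_continuous_on_indicator]

lemma nn_integral_Ioo_eq_Icc:
  "(\<integral>\<^sup>+s. f s * indicator {x<..<z::real} s \<partial>lborel) = (\<integral>\<^sup>+s. f s * indicator {x..z} s \<partial>lborel)"
  by (rule nn_integral_cong_AE, rule AE_mp[OF AE_conjI[OF AE_lborel_singleton[of x] AE_lborel_singleton[of z]]])
    (auto split: split_indicator)

text \<open>
  Tonelli on the triangle \<open>x \<le> s\<close>. Both halves of the identification of the eigenvalue rest on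
  it: it turns an outer integral over the speed measure into an inner one, which for the
  eigenfunction is known from the equation.
\<close>

lemma nn_integral_triangle_swap:
  fixes v k :: "real \<Rightarrow> ennreal"
  assumes [measurable]: "v \<in> borel_measurable borel" "k \<in> borel_measurable borel"
  shows "(\<integral>\<^sup>+x. v x * (\<integral>\<^sup>+s. k s * indicator {x..} s \<partial>lborel) \<partial>lborel) =
    (\<integral>\<^sup>+s. k s * (\<integral>\<^sup>+x. v x * indicator {..s} x \<partial>lborel) \<partial>lborel)"
proof -
  have "(\<integral>\<^sup>+x. v x * (\<integral>\<^sup>+s. k s * indicator {x..} s \<partial>lborel) \<partial>lborel) =
      (\<integral>\<^sup>+x. (\<integral>\<^sup>+s. v x * (k s * (if x \<le> s then 1 else 0)) \<partial>lborel) \<partial>lborel)"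
    by (subst nn_integral_cmult[symmetric]) (auto intro!: nn_integral_cong split: split_indicator)
  also have "\<dots> = (\<integral>\<^sup>+s. (\<integral>\<^sup>+x. v x * (k s * (if x \<le> s then 1 else 0)) \<partial>lborel) \<partial>lborel)"
    by (rule lborel_pair.Fubini'[symmetric]) measurable
  also have "\<dots> = (\<integral>\<^sup>+s. k s * (\<integral>\<^sup>+x. v x * indicator {..s} x \<partial>lborel) \<partial>lborel)"
    by (subst nn_integral_cmult[symmetric]) (auto intro!: nn_integral_cong simp: mult_ac split: split_indicator)
  finally show ?thesis .
qed

text \<open>
  A function that is not integrable has integral \<open>0\<close>.
\<close>

lemma integral_nonneg_of_nonneg:
  fixes f :: "real \<Rightarrow> real"
  assumes "\<And>x. x \<in> S \<Longrightarrow> 0 \<le> f x"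
  shows "0 \<le> integral S f"
  using assms Henstock_Kurzweil_Integration.integral_nonneg[of f S] not_integrable_integral[of f S]
  by (cases "f integrable_on S") auto

section \<open>Integrals against speed and scale\<close>

text \<open>
  All but the differential form depends on \<open>a\<close> and \<open>b\<close> only through the density \<open>p\<close> of the
  scale measure \<open>\<nu>\<close> and the density \<open>m\<close> of the speed measure \<open>\<mu>\<close>: with \<open>p = exp (- C)\<close> and
  \<open>m = exp C / a\<close> the eigenvalue equation reads \<open>(f' / p)' = - \<lambda> m f\<close>. This is the vibrating
  string of Krein and Feller. The density \<open>m\<close> vanishes off \<open>(0,D)\<close>, so that integrals over closed
  intervals agree with those over open ones point by point.
\<close>

locale string =
  fixes D :: ereal and p m :: "real \<Rightarrow> real"
  assumes D_pos: "0 < D"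
    and p_cont: "continuous_on (cl_ivl D) p"
    and p_pos: "\<And>x. x \<in> cl_ivl D \<Longrightarrow> 0 < p x"
    and m_meas [measurable]: "m \<in> borel_measurable borel"
    and m_pos: "\<And>x. x \<in> op_ivl D \<Longrightarrow> 0 < m x"
    and m_outside: "\<And>x. x \<notin> op_ivl D \<Longrightarrow> m x = 0"
    and m_int: "\<And>x. x \<in> cl_ivl D \<Longrightarrow> m absolutely_integrable_on {0..x}"
begin

lemma m_nonneg: "0 \<le> m x"
  using m_pos m_outside by (cases "x \<in> op_ivl D") (auto simp: less_imp_le)

text \<open>
  \<open>J f s\<close> is \<open>\<integral>\<^sub>0\<^sup>s f d\<mu>\<close>, and \<open>dbl f x z\<close> is \<open>\<integral>\<^sub>x\<^sup>z \<nu>(ds) \<integral>\<^sub>0\<^sup>s f d\<mu>\<close>, for \<open>z = D\<close> the numerator of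
  the double integral operator. Gauge integrals are used because for continuous \<open>f\<close> the integrand \<open>p * J f\<close> is continuous,
  which gives direct access to the fundamental theorem of calculus although \<open>m\<close> is merely measurable.
\<close>

definition J :: "(real \<Rightarrow> real) \<Rightarrow> real \<Rightarrow> real" where
  "J f s = integral {0..s} (\<lambda>t. m t * f t)"

definition dbl :: "(real \<Rightarrow> real) \<Rightarrow> real \<Rightarrow> real \<Rightarrow> real" where
  "dbl f x z = integral {x..z} (\<lambda>s. p s * J f s)"

lemma speed_mult_absolutely_integrable:
  assumes x: "x \<in> cl_ivl D" and f: "continuous_on {0..x} f"
  shows "(\<lambda>t. m t * f t) absolutely_integrable_on {0..x}"
proof -
  have "(\<lambda>t. f t * m t) absolutely_integrable_on {0..x}"
  proof (rule absolutely_integrable_bounded_measurable_product_real)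
    show "f \<in> borel_measurable (lebesgue_on {0..x})"
      by (rule continuous_imp_measurable_on_sets_lebesgue[OF f]) auto
    show "bounded (f ` {0..x})"
      by (intro compact_imp_bounded compact_continuous_image f) auto
  qed (use m_int x in auto)
  then show ?thesis by (simp add: mult.commute)
qed

lemma speed_mult_integrable:
  assumes "x \<in> cl_ivl D" "continuous_on {0..x} f"
  shows "(\<lambda>t. m t * f t) integrable_on {0..x}"
  using speed_mult_absolutely_integrable[OF assms] by (simp add: absolutely_integrable_on_def)

lemma speed_mult_integrable_below:
  assumes "x \<in> cl_ivl D" "continuous_on {0..x} f" "s \<le> x"
  shows "(\<lambda>t. m t * f t) integrable_on {0..s}"
  by (rule integrable_on_subinterval[OF speed_mult_integrable[OF assms(1,2)]]) (use assms in auto)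

lemma J_cont:
  assumes "x \<in> cl_ivl D" "continuous_on {0..x} f"
  shows "continuous_on {0..x} (J f)"
  unfolding J_def by (rule indefinite_integral_continuous_1[OF speed_mult_integrable[OF assms]])

lemma J_zero [simp]: "J f 0 = 0"
  by (simp add: J_def)

lemma J_nonneg:
  assumes "\<And>t. t \<in> {0<..<s} \<Longrightarrow> 0 \<le> f t" "s \<in> cl_ivl D" 
  shows "0 \<le> J f s"
proof -
  have "integral {0..s} (\<lambda>t. m t * f t) = integral {0<..<s} (\<lambda>t. m t * f t)"
    using integral_open_interval[of 0 s "\<lambda>t. m t * f t"] by simp
  also have "\<dots> \<ge> 0"
    by (rule integral_nonneg_of_nonneg)  (use assms m_nonneg in auto)
  finally show ?thesis by (simp add: J_def)
qed

lemma J_cong: "(\<And>t. t \<in> {0..s} \<Longrightarrow> f t = g t) \<Longrightarrow> J f s = J g s"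
  unfolding J_def by (rule integral_cong) auto

lemma J_mono:
  assumes "x \<in> cl_ivl D" "continuous_on {0..x} f" "continuous_on {0..x} g" "s \<le> x"
    and "\<And>t. t \<in> {0..s} \<Longrightarrow> f t \<le> g t"
  shows "J f s \<le> J g s"
  unfolding J_def
  by (rule integral_le) (use assms speed_mult_integrable_below m_nonneg in \<open>auto intro: mult_left_mono\<close>)

lemma J_cmult: "J (\<lambda>t. c * f t) s = c * J f s"
  unfolding J_def by (simp add: mult.left_commute[of "m _" c] )

lemma J_add:
  assumes "x \<in> cl_ivl D" "continuous_on {0..x} f" "continuous_on {0..x} g" "s \<le> x"
  shows "J (\<lambda>t. f t + g t) s = J f s + J g s"
  unfolding J_def distrib_left
  by (rule Henstock_Kurzweil_Integration.integral_add) (use assms speed_mult_integrable_below in auto)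

lemma J_diff:
  assumes "x \<in> cl_ivl D" "continuous_on {0..x} f" "continuous_on {0..x} g" "s \<le> x"
  shows "J (\<lambda>t. f t - g t) s = J f s - J g s"
  unfolding J_def right_diff_distrib
  by (rule Henstock_Kurzweil_Integration.integral_diff) (use assms speed_mult_integrable_below in auto)

lemma J_incr:
  assumes "x \<in> cl_ivl D" "continuous_on {0..x} f" "s \<le> x" "0 \<le> s" "\<And>t. t \<in> {0<..<x} \<Longrightarrow> 0 \<le> f t"
  shows "J f s \<le> J f x"
proof -
  have "J f s + integral {s..x} (\<lambda>t. m t * f t) = J f x"
    unfolding J_def using assms speed_mult_integrable by (intro Henstock_Kurzweil_Integration.integral_combine) auto
  moreover have "integral {s..x} (\<lambda>t. m t * f t) = integral {s<..<x} (\<lambda>t. m t * f t)"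
    using integral_open_interval[of s x "\<lambda>t. m t * f t"] by simp
  moreover have "integral {s<..<x} (\<lambda>t. m t * f t) \<ge> 0"
    by (rule integral_nonneg_of_nonneg) (use assms m_nonneg in auto)
  ultimately show ?thesis by simp
qed

lemma J_nn_integral:
  assumes "x \<in> cl_ivl D" "continuous_on {0..x} f" "\<And>t. t \<in> {0..x} \<Longrightarrow> 0 \<le> f t"
  shows "(\<integral>\<^sup>+t. ennreal (m t * f t) * indicator {0..x} t \<partial>lborel) = ennreal (J f x)"
  using assms speed_mult_integrable m_nonneg unfolding J_def
  by (intro nn_integral_has_integral_lebesgue') (auto intro: integrable_integral)

text \<open>
  If the integral vanished, then \<open>m f\<close> would vanish almost everywhere on \<open>(0,x)\<close>, where it is
  positive.
\<close>

lemma J_pos: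
  assumes x: "x \<in> cl_ivl D" "0 < x" and f: "continuous_on {0..x} f"
    and pos: "\<And>t. t \<in> {0<..<x} \<Longrightarrow> 0 < f t"
  shows "0 < J f x"
proof (rule ccontr)
  assume "\<not> 0 < J f x"
  moreover have f0: "0 \<le> f t" if "t \<in> {0..x}" for t
  proof -
    have "- f t \<le> 0"
      by (rule continuous_le_on_closure[where S="{0<..<x}" and f="\<lambda>t. - f t"])
        (use x f pos that in \<open>auto intro!: continuous_intros less_imp_le\<close>)
    then show ?thesis by simp
  qed
  ultimately have "(\<integral>\<^sup>+t. ennreal (m t * f t) * indicator {0..x} t \<partial>lborel) = 0"
    using J_nn_integral[OF x(1) f] by (simp add: ennreal_neg)
  moreover have "(\<integral>\<^sup>+t. ennreal (m t * f t) * indicator {0..x} t \<partial>lborel) =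
      (\<integral>\<^sup>+t. ennreal (m t * (indicator {0..x} t *\<^sub>R f t)) \<partial>lborel)"
    by (rule nn_integral_cong) (simp split: split_indicator)
  ultimately have "(\<integral>\<^sup>+t. ennreal (m t * (indicator {0..x} t *\<^sub>R f t)) \<partial>lborel) = 0"
    by simp
  moreover have [measurable]: "(\<lambda>t. indicator {0..x} t *\<^sub>R f t) \<in> borel_measurable borel"
    by (rule borel_measurable_continuous_on_indicator) (use f in auto)
  ultimately have "AE t in lborel. ennreal (m t * (indicator {0..x} t *\<^sub>R f t)) = 0"
    by (subst (asm) nn_integral_0_iff_AE) auto
  then have "AE t in lborel. t \<notin> {0<..<x}"
  proof eventually_elim
    case (elim t)
    show ?case
    proof
      assume t: "t \<in> {0<..<x}"
      then have "0 < m t * f t" using m_pos op_ivl_below[OF x(1)] pos by auto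
      with elim t show False by (simp add: ennreal_eq_0_iff)
    qed
  qed
  then have "{0<..<x} \<in> null_sets lborel" by (subst AE_iff_null_sets) auto
  with x show False by (simp add: null_sets_def)
qed

lemma pJ_cont:
  assumes "x \<in> cl_ivl D" "continuous_on {0..x} f"
  shows "continuous_on {0..x} (\<lambda>s. p s * J f s)"
  by (intro continuous_intros J_cont assms continuous_on_subset[OF p_cont] 
      atLeastAtMost_subset_cl_ivl)

lemma pJ_int:
  assumes "z \<in> cl_ivl D" "continuous_on {0..z} f" "0 \<le> x" "y \<le> z"
  shows "(\<lambda>s. p s * J f s) integrable_on {x..y}"
  by (rule integrable_on_subinterval[OF integrable_continuous_interval[OF pJ_cont[OF assms(1,2)]]])
    (use assms in auto)

lemma dbl_self [simp]: "dbl f x x = 0"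
  by (simp add: dbl_def)

lemma dbl_combine:
  assumes "z \<in> cl_ivl D" "continuous_on {0..z} f" "0 \<le> x" "x \<le> y" "y \<le> z"
  shows "dbl f x y + dbl f y z = dbl f x z"
  unfolding dbl_def
  by (rule Henstock_Kurzweil_Integration.integral_combine) (use assms pJ_int in auto)

lemma dbl_nonneg:
  assumes "z \<in> cl_ivl D" "\<And>t. t \<in> {0<..<z} \<Longrightarrow> 0 \<le> f t" "0 \<le> x"
  shows "0 \<le> dbl f x z"
  unfolding dbl_def
proof (rule integral_nonneg_of_nonneg)
  fix s assume s: "s \<in> {x..z}"
  then have "s \<in> cl_ivl D" using cl_ivl_downward assms by auto
  moreover from this have "0 \<le> J f s" using assms s by (intro J_nonneg) auto
  ultimately show "0 \<le> p s * J f s" using p_pos by (auto intro: mult_nonneg_nonneg less_imp_le)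
qed

lemma dbl_mono:
  assumes "z \<in> cl_ivl D" "continuous_on {0..z} f" "continuous_on {0..z} g" "0 \<le> x"
    and "\<And>t. t \<in> {0..z} \<Longrightarrow> f t \<le> g t"
  shows "dbl f x z \<le> dbl g x z"
  unfolding dbl_def
proof (rule integral_le)
  fix s assume s: "s \<in> {x..z}"
  then have "s \<in> cl_ivl D" using cl_ivl_downward assms by auto
  moreover have "J f s \<le> J g s" using assms s by (intro J_mono[of z]) auto
  ultimately show "p s * J f s \<le> p s * J g s" using p_pos by (auto intro: mult_left_mono less_imp_le)
qed (use assms pJ_int in auto)

lemma dbl_cmult: "dbl (\<lambda>t. c * f t) x z = c * dbl f x z"
  unfolding dbl_def J_cmult by (simp add: mult.left_commute[of "p _" c])

lemma dbl_add:
  assumes "z \<in> cl_ivl D" "continuous_on {0..z} f" "continuous_on {0..z} g" "0 \<le> x"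
  shows "dbl (\<lambda>t. f t + g t) x z = dbl f x z + dbl g x z"
proof -
  have "dbl (\<lambda>t. f t + g t) x z = integral {x..z} (\<lambda>s. p s * J f s + p s * J g s)"
    unfolding dbl_def using assms by (intro integral_cong) (auto simp: J_add[of z] distrib_left)
  also have "\<dots> = dbl f x z + dbl g x z"
    unfolding dbl_def by (rule Henstock_Kurzweil_Integration.integral_add) (use assms pJ_int in auto)
  finally show ?thesis .
qed

lemma dbl_cong:
  assumes "0 \<le> x" "\<And>t. t \<in> {0..<z} \<Longrightarrow> f t = g t"
  shows "dbl f x z = dbl g x z"
  unfolding dbl_def
  by (rule integral_spike[of "{z}"]) (use assms in \<open>auto intro!: J_cong[symmetric]\<close>)

lemma dbl_cont_upper:
  assumes "z \<in> cl_ivl D" "continuous_on {0..z} f" 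
  shows "continuous_on {0..z} (\<lambda>x. dbl f 0 x)"
  unfolding dbl_def by (rule indefinite_integral_continuous_1) (use assms pJ_int in auto)

lemma dbl_deriv_upper:
  assumes "z \<in> cl_ivl D" "continuous_on {0..z} f" "0 < x" "x < z"
  shows "((\<lambda>x. dbl f 0 x) has_real_derivative p x * J f x) (at x)"
  using integral_has_real_derivative[OF pJ_cont[OF assms(1,2)], of x] assms
  unfolding dbl_def by (simp add: at_within_Icc_at)

lemma dbl_cont_lower:
  assumes "z \<in> cl_ivl D" "continuous_on {0..z} f" 
  shows "continuous_on {0..z} (\<lambda>x. dbl f x z)"
  unfolding dbl_def by (rule indefinite_integral_continuous_1') (use assms pJ_int in auto)

lemma dbl_deriv_lower:
  assumes "z \<in> cl_ivl D" "continuous_on {0..z} f" "0 < x" "x < z"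
  shows "((\<lambda>x. dbl f x z) has_real_derivative - (p x * J f x)) (at x)"
  using integral_has_real_derivative'[OF pJ_cont[OF assms(1,2)], of x] assms
  unfolding dbl_def by (simp add: at_within_Icc_at)

definition scl :: "real \<Rightarrow> real \<Rightarrow> real" where
  "scl x z = integral {x..z} p"

lemma scl_pos:
  assumes "z \<in> cl_ivl D" "0 \<le> x" "x < z"
  shows "0 < scl x z"
proof -
  have c: "continuous_on {x..z} p"
    by (rule continuous_on_subset[OF p_cont]) (use assms cl_ivl_downward in auto)
  have "0 \<le> scl x z" unfolding scl_def
    by (rule integral_nonneg_of_nonneg) (use assms cl_ivl_downward p_pos in \<open>auto intro: less_imp_le\<close>)
  moreover have "scl x z \<noteq> 0"
  proof
    assume "scl x z = 0"
    then have "\<forall>y\<in>{x..z}. p y = 0"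
      unfolding scl_def
      by (subst (asm) integral_eq_0_iff) (use c assms cl_ivl_downward p_pos in \<open>auto intro: less_imp_le\<close>)
    moreover have "p z \<noteq> 0" using p_pos[OF assms(1)] by simp
    ultimately show False using assms by auto
  qed
  ultimately show ?thesis by simp
qed

lemma p_int:
  assumes "z \<in> cl_ivl D" "0 \<le> x" shows "p integrable_on {x..z}"
  by (rule integrable_continuous_interval, rule continuous_on_subset[OF p_cont])
    (use assms cl_ivl_downward in auto)

lemma scl_anti:
  assumes "z \<in> cl_ivl D" "0 \<le> x" "x \<le> y" "y \<le> z"
  shows "scl y z \<le> scl x z"
proof -
  have "scl x y + scl y z = scl x z"
    unfolding scl_def
    by (rule Henstock_Kurzweil_Integration.integral_combine) (use assms p_int in auto)
  moreover have "0 \<le> scl x y"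
    using scl_pos[of y x] assms cl_ivl_downward[of z D y] by (cases "x = y") (auto simp: scl_def)
  ultimately show ?thesis by simp
qed

text \<open>
  For \<open>f \<ge> 0\<close> the inner integral is increasing, hence \<open>dbl f x z\<close> lies between two multiples of
  the scale \<open>\<nu>(x,z)\<close>. All functions that are comparable with their double integral therefore
  vanish at \<open>z\<close> to the same order.
\<close>

lemma dbl_ge:
  assumes "z \<in> cl_ivl D" "continuous_on {0..z} f" "0 \<le> y" "y \<le> x" "x \<le> z"
    "\<And>t. t \<in> {0<..<z} \<Longrightarrow> 0 \<le> f t"
  shows "J f y * scl x z \<le> dbl f x z"
proof -
  have "integral {x..z} (\<lambda>s. J f y * p s) \<le> dbl f x z"
    unfolding dbl_def
  proof (rule integral_le)
    fix s assume s: "s \<in> {x..z}"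
    then have sc: "s \<in> cl_ivl D" using cl_ivl_downward assms by auto
    have "J f y \<le> J f s" using assms s sc by (intro J_incr) (auto intro: continuous_on_subset)
    then show "J f y * p s \<le> p s * J f s" using p_pos[OF sc] by (simp add: mult.commute)
  qed (use assms pJ_int integrable_cmul[OF p_int[of z x]] in auto)
  then show ?thesis by (simp add: scl_def)
qed

lemma dbl_le:
  assumes "z \<in> cl_ivl D" "continuous_on {0..z} f" "0 \<le> x" "x \<le> z"
    "\<And>t. t \<in> {0<..<z} \<Longrightarrow> 0 \<le> f t"
  shows "dbl f x z \<le> J f z * scl x z"
proof -
  have "dbl f x z \<le> integral {x..z} (\<lambda>s. J f z * p s)"
    unfolding dbl_def
  proof (rule integral_le)
    fix s assume s: "s \<in> {x..z}"
    then have sc: "s \<in> cl_ivl D" using cl_ivl_downward assms by auto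
    have "J f s \<le> J f z" using assms s sc by (intro J_incr) (auto intro: continuous_on_subset)
    then show "p s * J f s \<le> J f z * p s" using p_pos[OF sc] by (simp add: mult.commute)
  qed (use assms pJ_int integrable_cmul[OF p_int[of z x]] in auto)
  then show ?thesis by (simp add: scl_def)
qed

end

section \<open>The comparison principle\<close>

lemma first_zero:
  fixes f :: "real \<Rightarrow> real"
  assumes c: "continuous_on {0..x} f" and f0: "0 < f 0" and fx: "f x \<le> 0" and x: "0 \<le> x"
  obtains z where "0 < z" "z \<le> x" "f z = 0" "\<And>t. t \<in> {0..<z} \<Longrightarrow> 0 < f t"
proof -
  let ?S = "{0..x} \<inter> f -` {..0}"
  have "compact ?S"
    by (rule compact_Int_closed[of "{0..x}" ?S, simplified])
       (use continuous_closed_preimage[OF c] in auto)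
  moreover have "x \<in> ?S" using fx x by simp
  ultimately obtain z where z: "z \<in> ?S" and inf: "\<And>t. t \<in> ?S \<Longrightarrow> z \<le> t"
    using compact_attains_inf[of ?S] by blast
  have pos: "0 < f t" if "t \<in> {0..<z}" for t
  proof (rule ccontr)
    assume "\<not> 0 < f t"
    with that z have "t \<in> ?S" by auto
    from inf[OF this] that show False by auto
  qed
  have "0 < z" using z f0 by (cases "z = 0") auto
  obtain t where t: "0 \<le> t" "t \<le> z" "f t = 0"
    using IVT2'[of f z 0 0] z f0 continuous_on_subset[OF c, of "{0..z}"] by auto
  then have "z \<le> t" using inf[of t] z by auto
  with t have "f z = 0" by simp
  with z \<open>0 < z\<close> pos show ?thesis using that by auto
qed

context string
begin

text \<open>
  The maximum principle behind all the estimates. Let \<open>M\<close> be the supremum of \<open>g / f\<close> on \<open>(0,x1)\<close>.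
  From \<open>g \<le> M f\<close> it follows that \<open>g \<le> \<beta> dbl g \<le> \<beta> M dbl f \<le> (\<beta> / \<alpha>) M f\<close>, that is \<open>M \<le> (\<beta> / \<alpha>) M\<close>,
  and \<open>M > 0\<close> is finite. Finiteness is the delicate point when \<open>f x1 = g x1 = 0\<close>; it holds because
  \<open>f\<close> is bounded below, and \<open>g\<close> above, by a multiple of \<open>\<nu>(x,x1)\<close>. This makes the lemma applicable
  also at \<open>x1 = D\<close>, where both eigenfunctions may vanish.
\<close>

lemma comparison:
  assumes x1: "x1 \<in> cl_ivl D" "0 < x1"
    and f: "continuous_on {0..x1} f" "\<And>x. x \<in> {0<..<x1} \<Longrightarrow> 0 < f x"
    and g: "continuous_on {0..x1} g" "\<And>x. x \<in> {0<..<x1} \<Longrightarrow> 0 < g x"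
    and \<alpha>: "0 < \<alpha>"
    and fe: "\<And>x. x \<in> {0<..<x1} \<Longrightarrow> \<alpha> * dbl f x x1 \<le> f x"
    and ge: "\<And>x. x \<in> {0<..<x1} \<Longrightarrow> g x \<le> \<beta> * dbl g x x1"
  shows "\<alpha> \<le> \<beta>"
proof -
  \<comment> \<open>Any interior point would do: left of \<open>y\<close> the scale of \<open>(y,x1)\<close> replaces that of \<open>(x,x1)\<close>.\<close>
  define y where "y = x1 / 2"
  have y: "0 < y" "y < x1" "y \<in> cl_ivl D"
    using x1 cl_ivl_downward[of x1 D y] by (auto simp: y_def)
  have f0: "\<And>t. t \<in> {0<..<x1} \<Longrightarrow> 0 \<le> f t" and g0: "\<And>t. t \<in> {0<..<x1} \<Longrightarrow> 0 \<le> g t"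
    using f(2) g(2) by (auto intro: less_imp_le)
  have "0 < \<beta> * dbl g y x1" using ge[of y] g(2)[of y] y by auto
  moreover have "0 \<le> dbl g y x1" using dbl_nonneg[OF x1(1) g0] y by auto
  ultimately have \<beta>: "0 < \<beta>" by (simp add: zero_less_mult_iff)
  have Jf: "0 < J f y"
    using y f by (intro J_pos) (auto intro: continuous_on_subset)
  define s where "s = scl y x1"
  have s: "0 < s" unfolding s_def using scl_pos x1 y by auto
  define G where "G = \<beta> * J g x1 * scl 0 x1"
  have gG: "g x \<le> \<beta> * J g x1 * scl x x1" if x: "x \<in> {0<..<x1}" for x
  proof -
    have "dbl g x x1 \<le> J g x1 * scl x x1" using dbl_le[OF x1(1) g(1) _ _ g0] x by auto
    from mult_left_mono[OF this less_imp_le[OF \<beta>]] ge[OF x] show ?thesis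
      unfolding mult.assoc by (rule order_trans[rotated])
  qed
  have Jg: "0 \<le> J g x1" using J_nonneg[OF g0 x1(1)] by auto
  have ff: "\<alpha> * (J f y * scl (max x y) x1) \<le> f x" if x: "x \<in> {0<..<x1}" for x
  proof -
    have "J f y * scl (max x y) x1 \<le> dbl f (max x y) x1"
      using dbl_ge[OF x1(1) f(1), of y "max x y"] f0 x y by auto
    also have "\<dots> \<le> dbl f x x1"
    proof -
      have "dbl f x (max x y) + dbl f (max x y) x1 = dbl f x x1"
        using dbl_combine[OF x1(1) f(1)] x y by auto
      moreover have "0 \<le> dbl f x (max x y)"
        using x y f0 cl_ivl_downward[OF x1(1), of "max x y"] by (intro dbl_nonneg) auto
      ultimately show ?thesis by simp
    qed
    finally have "\<alpha> * (J f y * scl (max x y) x1) \<le> \<alpha> * dbl f x x1" using \<alpha> by simp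
    then show ?thesis using fe[OF x] by simp
  qed
  define q where "q x = g x / f x" for x
  define B where "B = \<beta> * J g x1 / (\<alpha> * J f y) * (scl 0 x1 / s)"
  have gs: "scl x x1 \<le> scl 0 x1 / s * scl (max x y) x1" if x: "x \<in> {0<..<x1}" for x
  proof (cases "x \<le> y")
    case True
    then have "scl (max x y) x1 = s" by (simp add: s_def max_def)
    then show ?thesis using scl_anti[OF x1(1), of 0 x] x s by auto
  next
    case False
    have "1 \<le> scl 0 x1 / s" using scl_anti[OF x1(1), of 0 y] y s by (simp add: s_def)
    moreover have "0 < scl x x1" using scl_pos[OF x1(1)] x by auto
    ultimately have "1 * scl x x1 \<le> scl 0 x1 / s * scl x x1" by (intro mult_right_mono) auto
    then show ?thesis using False by (simp add: max_def)
  qed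
  have qB: "q x \<le> B" if x: "x \<in> {0<..<x1}" for x
  proof -
    have "g x \<le> \<beta> * J g x1 * (scl 0 x1 / s * scl (max x y) x1)"
      using gG[OF x] gs[OF x] \<beta> Jg mult_left_mono[OF gs[OF x], of "\<beta> * J g x1"] by simp
    also have "\<dots> = B * (\<alpha> * (J f y * scl (max x y) x1))"
      using \<alpha> Jf by (simp add: B_def)
    also have "\<dots> \<le> B * f x"
      using ff[OF x] \<beta> Jg \<alpha> Jf s scl_pos[OF x1(1), of 0] x1
      by (intro mult_left_mono) (auto simp: B_def)
    finally show ?thesis using f(2)[OF x] by (simp add: q_def divide_le_eq)
  qed
  define M where "M = Sup (q ` {0<..<x1})"
  have bdd: "bdd_above (q ` {0<..<x1})" using qB by (auto intro!: bdd_aboveI[where M=B])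
  have qM: "q x \<le> M" if "x \<in> {0<..<x1}" for x
    unfolding M_def using that bdd by (intro cSup_upper) auto
  have gM: "g x \<le> M * f x" if "x \<in> {0<..<x1}" for x
    using qM[OF that] f(2)[OF that] by (simp add: q_def divide_le_eq)
  \<comment> \<open>The monotonicity of the integral asks for the inequality at the endpoints, too.\<close>
  have gM': "g x \<le> M * f x" if "x \<in> {0..x1}" for x
  proof -
    have "g x - M * f x \<le> 0"
      by (rule continuous_le_on_closure[where S="{0<..<x1}" and f="\<lambda>x. g x - M * f x"])
        (use x1 f g that gM in \<open>auto intro!: continuous_intros\<close>)
    then show ?thesis by simp
  qed
  have Mpos: "0 < M" using qM[of y] f(2)[of y] g(2)[of y] y
    by (auto simp: q_def intro: less_le_trans[OF divide_pos_pos])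
  have "M \<le> \<beta> / \<alpha> * M"
  proof -
    have "q x \<le> \<beta> / \<alpha> * M" if x: "x \<in> {0<..<x1}" for x
    proof -
      have "dbl g x x1 \<le> dbl (\<lambda>t. M * f t) x x1"
        using x1 x f g gM' by (intro dbl_mono continuous_intros) auto
      also have "\<dots> = M * dbl f x x1" by (rule dbl_cmult)
      also have "\<dots> \<le> M * (f x / \<alpha>)"
        using fe[OF x] \<alpha> Mpos by (intro mult_left_mono) (auto simp: field_simps)
      finally have "\<beta> * dbl g x x1 \<le> \<beta> * (M * (f x / \<alpha>))"
        by (rule mult_left_mono) (use \<beta> in simp)
      then have "g x \<le> \<beta> / \<alpha> * M * f x" using ge[OF x] by simp
      then show ?thesis using f(2)[OF x] by (simp add: q_def divide_le_eq)
    qed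
    then show ?thesis unfolding M_def using y by (intro cSup_least) auto
  qed
  then have "1 * M \<le> \<beta> / \<alpha> * M" by simp
  then have "1 \<le> \<beta> / \<alpha>" by (rule mult_right_le_imp_le[OF _ Mpos])
  with \<alpha> show ?thesis by simp
qed

section \<open>The solutions of the eigenvalue equation\<close>

text \<open>
  The terms of the Neumann series for \<open>f = 1 - \<lambda> dbl f 0\<close>, without their factors \<open>(- \<lambda>) ^ n\<close>.
\<close>

primrec picard :: "nat \<Rightarrow> real \<Rightarrow> real" where
  "picard 0 = (\<lambda>x. 1)"
| "picard (Suc n) = (\<lambda>x. dbl (picard n) 0 x)"

lemma picard_cont: "x \<in> cl_ivl D \<Longrightarrow> continuous_on {0..x} (picard n)"
  by (induction n) (auto intro: dbl_cont_upper)

lemma picard_nonneg: "x \<in> cl_ivl D \<Longrightarrow> 0 \<le> picard n x"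
proof (induction n arbitrary: x)
  case (Suc n)
  then show ?case 
    using dbl_nonneg[OF Suc.prems, of "picard n" 0] cl_ivl_downward[OF Suc.prems] by auto
qed auto

text \<open>
  The usual bound for a Volterra equation. With \<open>B\<close> a bound for \<open>p\<close> on \<open>[0,X]\<close>, one step multiplies
  by at most \<open>K = B \<mu>(0,X)\<close> and integrates over \<open>[0,x]\<close>, because \<open>(K t)\<^sup>n \<le> (K s)\<^sup>n\<close> inside \<open>J\<close>.
\<close>

lemma picard_bound:
  assumes X: "X \<in> cl_ivl D"
  obtains K where "0 \<le> K" "\<And>n x. x \<in> {0..X} \<Longrightarrow> picard n x \<le> (K * x) ^ n / fact n"
proof -
  have X0: "0 \<le> X" using X by (simp add: cl_ivl_def)
  have "compact (p ` {0..X})"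
    by (intro compact_continuous_image continuous_on_subset[OF p_cont] atLeastAtMost_subset_cl_ivl X) auto
  then have "bdd_above (p ` {0..X})"
    by (intro bounded_imp_bdd_above compact_imp_bounded)
  then obtain B where "\<forall>y\<in>p ` {0..X}. y \<le> B" unfolding bdd_above_def by blast
  then have B: "\<And>s. s \<in> {0..X} \<Longrightarrow> p s \<le> B" by auto
  have "0 < p 0" using p_pos cl_ivl_zero D_pos by auto
  then have B0: "0 < B" using B[of 0] X0 by auto
  define K where "K = B * J (\<lambda>_. 1) X"
  have J1: "0 \<le> J (\<lambda>_. 1) X" by (rule J_nonneg) (use X in auto)
  have K: "0 \<le> K" using B0 J1 by (simp add: K_def)
  have "picard n x \<le> (K * x) ^ n / fact n" if "x \<in> {0..X}" for n x
    using that
  proof (induction n arbitrary: x)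
    case (Suc n)
    have xc: "x \<in> cl_ivl D" using Suc.prems X cl_ivl_downward by auto
    have hi: "((\<lambda>s. K * ((K * s) ^ n / fact n)) has_integral
        (K * x) ^ Suc n / fact (Suc n) - (K * 0) ^ Suc n / fact (Suc n)) {0..x}"
    proof (rule fundamental_theorem_of_calculus)
      fix s assume "s \<in> {0..x}"
      have "((\<lambda>s. (K * s) ^ Suc n / fact (Suc n)) has_real_derivative 
         (real (Suc n) * (K * s) ^ n * K) / fact (Suc n)) (at s within {0..x})"
        by (rule derivative_eq_intros refl | simp)+
      also have "(real (Suc n) * (K * s) ^ n * K) / fact (Suc n) = K * ((K * s) ^ n / fact n)"
        by (simp add: field_simps del: of_nat_Suc)
      finally show "((\<lambda>s. (K * s) ^ Suc n / fact (Suc n)) has_vector_derivative K * ((K * s) ^ n / fact n)) (at s within {0..x})"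
        by (simp add: has_real_derivative_iff_has_vector_derivative)
    qed (use Suc.prems in auto)
    have "picard (Suc n) x \<le> integral {0..x} (\<lambda>s. K * ((K * s) ^ n / fact n))"
      unfolding picard.simps dbl_def
    proof (rule integral_le)
      fix s assume s: "s \<in> {0..x}"
      then have sX: "s \<in> {0..X}" using Suc.prems by auto
      then have sc: "s \<in> cl_ivl D" using X cl_ivl_downward by auto
      have "J (picard n) s \<le> J (\<lambda>t. (K * s) ^ n / fact n * 1) s"
      proof (rule J_mono[OF sc picard_cont[OF sc]])
        fix t assume t: "t \<in> {0..s}"
        then have "picard n t \<le> (K * t) ^ n / fact n" using Suc.IH[of t] sX by auto
        also have "\<dots> \<le> (K * s) ^ n / fact n"
          using t K by (intro divide_right_mono power_mono mult_left_mono) auto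
        finally show "picard n t \<le> (K * s) ^ n / fact n * 1" by simp
      qed auto
      also have "\<dots> = (K * s) ^ n / fact n * J (\<lambda>_. 1) s" by (rule J_cmult)
      also have "\<dots> \<le> (K * s) ^ n / fact n * J (\<lambda>_. 1) X"
        using K sX X by (intro mult_left_mono J_incr) auto
      finally have "p s * J (picard n) s \<le> B * ((K * s) ^ n / fact n * J (\<lambda>_. 1) X)"
        using B[OF sX] B0 J_nonneg[of s "picard n"] sc picard_nonneg cl_ivl_downward[OF sc] by (intro mult_mono) auto
      also have "\<dots> = K * ((K * s) ^ n / fact n)" by (simp add: K_def)
      finally show "p s * J (picard n) s \<le> K * ((K * s) ^ n / fact n)" .
    qed (use hi pJ_int[OF xc picard_cont[OF xc]] in auto)
    also have "\<dots> = (K * x) ^ Suc n / fact (Suc n)" using integral_unique[OF hi] by simp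
    finally show ?case .
  qed auto
  with K that show ?thesis by blast
qed

text \<open>
  The solution of the eigenvalue equation with value \<open>1\<close> and vanishing derivative (with respect to
  the scale) at \<open>0\<close>. Its form as a power series in \<open>\<lambda>\<close> gives at once that it depends continuously
  on \<open>\<lambda>\<close>.
\<close>

definition sol :: "real \<Rightarrow> real \<Rightarrow> real" where
  "sol lam x = (\<Sum>n. picard n x * (- lam) ^ n)"

lemma picard_term_bound:
  assumes "0 \<le> K" "0 \<le> x" "x \<le> X" "0 \<le> picard n x" "picard n x \<le> (K * x) ^ n / fact n"
  shows "norm (picard n x * z ^ n) \<le> inverse (fact n) * (K * X * \<bar>z\<bar>) ^ n"
proof -
  have "norm (picard n x * z ^ n) = picard n x * \<bar>z\<bar> ^ n"
    using assms by (simp add: abs_mult power_abs)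
  also have "\<dots> \<le> (K * x) ^ n / fact n * \<bar>z\<bar> ^ n" using assms by (intro mult_right_mono) auto
  also have "\<dots> \<le> (K * X) ^ n / fact n * \<bar>z\<bar> ^ n"
    using assms by (intro mult_right_mono divide_right_mono power_mono mult_left_mono) auto
  also have "\<dots> = inverse (fact n) * (K * X * \<bar>z\<bar>) ^ n" by (simp add: power_mult_distrib field_simps)
  finally show ?thesis .
qed

lemma picard_summable:
  assumes X: "X \<in> cl_ivl D" shows "summable (\<lambda>n. picard n X * z ^ n)"
proof -
  obtain K where K: "0 \<le> K" "\<And>n x. x \<in> {0..X} \<Longrightarrow> picard n x \<le> (K * x) ^ n / fact n"
    using picard_bound[OF X] by blast
  have "0 \<le> X" using X by (simp add: cl_ivl_def)
  then show ?thesis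
    using K X picard_nonneg[OF X] by (intro summable_comparison_test'[OF summable_exp[of "K * X * \<bar>z\<bar>"]] picard_term_bound) auto
qed

lemma sol_uniform_limit:
  assumes X: "X \<in> cl_ivl D"
  shows "uniform_limit {0..X} (\<lambda>N x. \<Sum>n<N. picard n x * (- lam) ^ n) (sol lam) sequentially"
proof -
  obtain K where K: "0 \<le> K" "\<And>n x. x \<in> {0..X} \<Longrightarrow> picard n x \<le> (K * x) ^ n / fact n"
    using picard_bound[OF X] by blast
  have "uniform_limit {0..X} (\<lambda>N x. \<Sum>n<N. picard n x * (- lam) ^ n) (\<lambda>x. \<Sum>n. picard n x * (- lam) ^ n) sequentially"
    using K picard_nonneg cl_ivl_downward[OF X]
    by (intro Weierstrass_m_test[OF _ summable_exp[of "K * X * \<bar>-lam\<bar>"]] picard_term_bound) auto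
  then show ?thesis by (simp add: sol_def[abs_def])
qed

lemma sol_cont:
  assumes X: "X \<in> cl_ivl D" shows "continuous_on {0..X} (sol lam)"
  by (rule uniform_limit_theorem[OF _ sol_uniform_limit[OF X]])
    (auto intro!: always_eventually continuous_intros picard_cont X)

lemma sol_cont_cl: "continuous_on (cl_ivl D) (sol lam)"
  by (rule continuous_on_cl_ivl) (rule sol_cont)

text \<open>
  A uniform error \<open>e\<close> in \<open>f\<close> changes \<open>dbl f 0 x\<close> by at most \<open>e\<close> times \<open>dbl 1 0 x\<close>.
\<close>

lemma dbl_uniform_limit:
  assumes x: "x \<in> cl_ivl D" and F: "\<And>n. continuous_on {0..x} (F n)" and f: "continuous_on {0..x} f"
    and lim: "uniform_limit {0..x} F f sequentially"
  shows "(\<lambda>n. dbl (F n) 0 x) \<longlonglongrightarrow> dbl f 0 x"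
proof (rule LIMSEQ_I)
  fix r :: real assume r: "0 < r"
  define c where "c = dbl (\<lambda>_. 1) 0 x"
  have c: "0 \<le> c" unfolding c_def by (rule dbl_nonneg[OF x]) auto
  define e where "e = r / (c + 1)"
  have e: "0 < e" using r c by (simp add: e_def)
  have ec: "e * c < r" using r c by (simp add: e_def field_simps)
  have "\<forall>\<^sub>F n in sequentially. \<forall>t\<in>{0..x}. dist (F n t) (f t) < e"
    using lim e by (simp add: uniform_limit_iff)
  then obtain N where N: "\<And>n t. n \<ge> N \<Longrightarrow> t \<in> {0..x} \<Longrightarrow> dist (F n t) (f t) < e"
    unfolding eventually_sequentially by blast
  show "\<exists>N. \<forall>n\<ge>N. norm (dbl (F n) 0 x - dbl f 0 x) < r"
  proof (intro exI allI impI)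
    fix n assume n: "N \<le> n"
    have cc: "dbl (\<lambda>t. e * 1) 0 x = e * c" unfolding c_def by (rule dbl_cmult)
    have *: "\<bar>F n t - f t\<bar> < e" if "t \<in> {0..x}" for t using N[OF n that] by (simp add: dist_real_def)
    have "dbl (F n) 0 x \<le> dbl (\<lambda>t. f t + e * 1) 0 x"
      by (rule dbl_mono[OF x F]) (use f * in \<open>force intro!: continuous_intros simp: abs_less_iff\<close>)+
    moreover have "dbl f 0 x \<le> dbl (\<lambda>t. F n t + e * 1) 0 x"
      by (rule dbl_mono[OF x f]) (use F * in \<open>force intro!: continuous_intros simp: abs_less_iff\<close>)+
    moreover have "dbl (\<lambda>t. f t + e * 1) 0 x = dbl f 0 x + e * c"
      unfolding cc[symmetric] by (rule dbl_add[OF x f]) auto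
    moreover have "dbl (\<lambda>t. F n t + e * 1) 0 x = dbl (F n) 0 x + e * c"
      unfolding cc[symmetric] by (rule dbl_add[OF x F]) auto
    ultimately show "norm (dbl (F n) 0 x - dbl f 0 x) < r" using ec by (simp add: abs_less_iff)
  qed
qed

lemma partial_sum_eq:
  assumes x: "x \<in> cl_ivl D"
  shows "(\<Sum>n<Suc N. picard n x * c ^ n) = 1 + c * dbl (\<lambda>t. \<Sum>n<N. picard n t * c ^ n) 0 x"
proof (induction N)
  case 0
  have "dbl (\<lambda>t. 0) 0 x = 0" using dbl_cmult[of 0 "\<lambda>t. 0" 0 x] by simp
  then show ?case by simp
next
  case (Suc N)
  have "dbl (\<lambda>t. (\<Sum>n<N. picard n t * c ^ n) + c ^ N * picard N t) 0 x =
    dbl (\<lambda>t. \<Sum>n<N. picard n t * c ^ n) 0 x + c ^ N * dbl (picard N) 0 x"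
    unfolding dbl_cmult[symmetric]
    by (rule dbl_add[OF x]) (auto intro!: continuous_intros picard_cont x)
  then have "dbl (\<lambda>t. \<Sum>n<Suc N. picard n t * c ^ n) 0 x =
     dbl (\<lambda>t. \<Sum>n<N. picard n t * c ^ n) 0 x + c ^ N * picard (Suc N) x"
    by (simp add: mult.commute)
  moreover have "(\<Sum>n<Suc (Suc N). picard n x * c ^ n) = (\<Sum>n<Suc N. picard n x * c ^ n) + picard (Suc N) x * c ^ Suc N"
    by (rule sum.lessThan_Suc)
  ultimately show ?case using Suc by (simp add: algebra_simps del: picard.simps)
qed

lemma sol_eq:
  assumes x: "x \<in> cl_ivl D"
  shows "sol lam x = 1 - lam * dbl (sol lam) 0 x"
proof -
  have x0: "0 \<le> x" using x by (simp add: cl_ivl_def)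
  have "(\<lambda>N. dbl (\<lambda>t. \<Sum>n<N. picard n t * (- lam) ^ n) 0 x) \<longlonglongrightarrow> dbl (sol lam) 0 x"
    by (rule dbl_uniform_limit[OF x _ sol_cont[OF x] sol_uniform_limit[OF x]])
      (auto intro!: continuous_intros picard_cont x)
  then have "(\<lambda>N. \<Sum>n<Suc N. picard n x * (- lam) ^ n) \<longlonglongrightarrow> 1 + (- lam) * dbl (sol lam) 0 x"
    unfolding partial_sum_eq[OF x] by (intro tendsto_intros)
  moreover have "(\<lambda>N. \<Sum>n<N. picard n x * (- lam) ^ n) \<longlonglongrightarrow> sol lam x"
    using sol_uniform_limit[OF x, of lam] x0 by (intro tendsto_uniform_limitI) auto
  then have "(\<lambda>N. \<Sum>n<Suc N. picard n x * (- lam) ^ n) \<longlonglongrightarrow> sol lam x"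
    by (rule LIMSEQ_Suc)
  ultimately show ?thesis using LIMSEQ_unique by fastforce
qed

lemma sol_isCont: "x \<in> cl_ivl D \<Longrightarrow> isCont (\<lambda>lam. sol lam x) lam"
proof -
  assume x: "x \<in> cl_ivl D"
  have "isCont (\<lambda>z. \<Sum>n. picard n x * z ^ n) (- lam)"
    by (rule isCont_powser_converges_everywhere) (rule picard_summable[OF x])
  then have "isCont ((\<lambda>z. \<Sum>n. picard n x * z ^ n) \<circ> uminus) lam"
    by (intro continuous_at_compose) auto
  then show ?thesis by (simp add: sol_def o_def)
qed

lemma sol_at_0 [simp]: "sol lam 0 = 1"
  using sol_eq[OF cl_ivl_zero[OF D_pos], of lam] by simp

lemma sol_0 [simp]: "x \<in> cl_ivl D \<Longrightarrow> sol 0 x = 1"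
  using sol_eq[of x 0] by simp

lemma sol_diff:
  assumes "z \<in> cl_ivl D" "0 \<le> x" "x \<le> z"
  shows "sol lam x - sol lam z = lam * dbl (sol lam) x z"
proof -
  have "dbl (sol lam) 0 x + dbl (sol lam) x z = dbl (sol lam) 0 z"
    using dbl_combine[OF assms(1) sol_cont[OF assms(1)], of 0 x lam] assms by auto
  then have "lam * dbl (sol lam) 0 x + lam * dbl (sol lam) x z = lam * dbl (sol lam) 0 z"
    by (metis distrib_left)
  then show ?thesis
    using sol_eq[OF assms(1), of lam] sol_eq[OF cl_ivl_downward[OF assms], of lam] by linarith
qed

lemma sol_deriv:
  assumes x: "x \<in> op_ivl D"
  shows "(sol lam has_real_derivative - (lam * (p x * J (sol lam) x))) (at x)"
proof -
  obtain z where z: "z \<in> op_ivl D" "x < z" using op_ivl_above[OF x] .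
  have zc: "z \<in> cl_ivl D" using z op_ivl_subset_cl_ivl by auto
  have "((\<lambda>x. 1 - lam * dbl (sol lam) 0 x) has_real_derivative 0 - lam * (p x * J (sol lam) x)) (at x)"
    by (intro derivative_intros DERIV_cmult dbl_deriv_upper[OF zc sol_cont[OF zc]]) (use x z in \<open>auto simp: op_ivl_def\<close>)
  then have "(sol lam has_real_derivative 0 - lam * (p x * J (sol lam) x)) (at x)"
    by (rule has_field_derivative_transform_within_open[OF _ open_op_ivl x])
      (metis sol_eq op_cl)
  then show ?thesis by simp
qed

lemma sol_first_zero:
  assumes x: "x \<in> cl_ivl D" "sol lam x \<le> 0"
  obtains z where "0 < z" "z \<le> x" "z \<in> cl_ivl D" "sol lam z = 0" "\<And>t. t \<in> {0..<z} \<Longrightarrow> 0 < sol lam t"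
proof -
  have "0 \<le> x" using x by (simp add: cl_ivl_def)
  then obtain z where "0 < z" "z \<le> x" "sol lam z = 0" "\<And>t. t \<in> {0..<z} \<Longrightarrow> 0 < sol lam t"
    using first_zero[OF sol_cont[OF x(1)] _ x(2)] by auto
  then show ?thesis using that cl_ivl_downward[OF x(1), of z] by auto
qed

section \<open>The critical parameter\<close>

text \<open>
  The critical parameter: up to \<open>Lam\<close> the solution stays positive on \<open>(0,D)\<close>, beyond \<open>Lam\<close> it has
  a zero there. All extremal values of the theorem are shown to be equal to it.
\<close>

definition Lam :: real where
  "Lam = Sup {lam. 0 \<le> lam \<and> (\<forall>x\<in>op_ivl D. 0 < sol lam x)}"

lemma zero_in_positive_parameters: "0 \<in> {lam. 0 \<le> lam \<and> (\<forall>x\<in>op_ivl D. 0 < sol lam x)}"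
  using op_cl by auto

lemma sol_decr:
  assumes z: "z \<in> cl_ivl D" "0 \<le> x" "x \<le> z" and lam: "0 \<le> lam" and nn: "\<And>t. t \<in> {0<..<z} \<Longrightarrow> 0 \<le> sol lam t"
  shows "sol lam z \<le> sol lam x"
proof -
  have "0 \<le> lam * dbl (sol lam) x z" using dbl_nonneg[OF z(1) nn z(2)] lam by simp
  then show ?thesis using sol_diff[OF z, of lam] by linarith
qed

text \<open>
  Since \<open>sol \<lambda>\<close> is decreasing as long as it is positive, it drops between \<open>y\<close> and \<open>z\<close> by at least
  \<open>\<lambda> sol \<lambda> y \<mu>(0,y) \<nu>(y,z)\<close>. This cannot exceed \<open>sol \<lambda> y\<close>.
\<close>

lemma bdd_positive_parameters: "bdd_above {lam. 0 \<le> lam \<and> (\<forall>x\<in>op_ivl D. 0 < sol lam x)}"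
proof -
  obtain y where y: "y \<in> op_ivl D" using op_ivl_nonempty[OF D_pos] .
  obtain z where z: "z \<in> op_ivl D" "y < z" using op_ivl_above[OF y] .
  have y0: "0 < y" using y by (simp add: op_ivl_def)
  define c where "c = J (\<lambda>_. 1) y * scl y z"
  have c: "0 < c" unfolding c_def using y y0 z op_cl by (intro mult_pos_pos J_pos scl_pos) auto
  have "lam \<le> 1 / c" if lam: "0 \<le> lam" "\<forall>x\<in>op_ivl D. 0 < sol lam x" for lam
  proof -
    have pos: "0 \<le> sol lam t" if "t \<in> {0<..<z}" for t
      using lam op_ivl_below[of z D t] that z op_cl by (auto intro: less_imp_le)
    have sy: "0 < sol lam y" using lam y by auto
    have "sol lam y * J (\<lambda>_. 1) y = J (\<lambda>_. sol lam y * 1) y" by (rule J_cmult[symmetric])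
    also have "\<dots> \<le> J (sol lam) y"
    proof (rule J_mono[OF op_cl[OF y]])
      fix t assume t: "t \<in> {0..y}"
      then show "sol lam y * 1 \<le> sol lam t"
        using sol_decr[OF op_cl[OF y], of t lam] lam pos z by auto
    qed (use sol_cont op_cl y in auto)
    finally have "sol lam y * c \<le> J (sol lam) y * scl y z"
      unfolding c_def mult.assoc[symmetric]
      by (rule mult_right_mono) (use scl_pos[of z y] z op_cl y0 in auto)
    also have "\<dots> \<le> dbl (sol lam) y z"
      using dbl_ge[OF op_cl[OF z(1)] sol_cont[OF op_cl[OF z(1)]], of y y lam] y0 z pos by auto
    finally have "lam * (sol lam y * c) \<le> lam * dbl (sol lam) y z" using lam by (intro mult_left_mono) auto
    also have "\<dots> = sol lam y - sol lam z"
      using sol_diff[OF op_cl[OF z(1)], of y lam] y0 z by auto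
    also have "\<dots> \<le> sol lam y" using lam z by auto
    finally have "sol lam y * (lam * c) \<le> sol lam y * 1" by (simp add: mult.left_commute)
    then have "lam * c \<le> 1" using sy by (subst (asm) mult_le_cancel_left_pos) auto
    then show ?thesis using c by (simp add: field_simps)
  qed
  then show ?thesis by (auto intro!: bdd_aboveI)
qed

lemma Lam_nonneg: "0 \<le> Lam"
  unfolding Lam_def by (rule cSup_upper[OF zero_in_positive_parameters bdd_positive_parameters])

text \<open>
  The critical parameter itself still has a positive solution: by continuity in \<open>\<lambda>\<close> the solution is
  nonnegative, and at a first zero it would be strictly decreasing, hence negative right after it.
\<close>

lemma sol_Lam_pos:
  assumes x: "x \<in> op_ivl D" shows "0 < sol Lam x"
proof -
  let ?P = "{lam. 0 \<le> lam \<and> (\<forall>x\<in>op_ivl D. 0 < sol lam x)}"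
  have "Lam \<in> closure ?P"
    unfolding Lam_def by (rule closure_contains_Sup[OF _ bdd_positive_parameters]) (use zero_in_positive_parameters in blast)
  then obtain l where l: "\<And>n. l n \<in> ?P" "l \<longlonglongrightarrow> Lam"
    unfolding closure_sequential by blast
  have nn: "0 \<le> sol Lam t" if t: "t \<in> op_ivl D" for t
  proof (rule LIMSEQ_le_const)
    show "(\<lambda>n. sol (l n) t) \<longlonglongrightarrow> sol Lam t"
      using isCont_tendsto_compose[OF sol_isCont[OF op_cl[OF t]] l(2)] .
    show "\<exists>N. \<forall>n\<ge>N. 0 \<le> sol (l n) t" using l(1) t by (auto intro!: less_imp_le)
  qed
  show ?thesis
  proof (rule ccontr)
    assume "\<not> 0 < sol Lam x"
    then obtain z where z: "0 < z" "z \<le> x" "z \<in> cl_ivl D" "sol Lam z = 0" "\<And>t. t \<in> {0..<z} \<Longrightarrow> 0 < sol Lam t"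
      using sol_first_zero[OF op_cl[OF x], of Lam] by auto
    have zo: "z \<in> op_ivl D" using z x by (auto simp: op_ivl_def intro: le_less_trans[of "ereal z" "ereal x" D])
    obtain w where w: "w \<in> op_ivl D" "z < w" using op_ivl_above[OF zo] .
    have "Lam \<noteq> 0" using z(3,4) by auto
    then have L: "0 < Lam" using Lam_nonneg by simp
    have "0 < J (sol Lam) z" using z by (intro J_pos sol_cont) auto
    then have "0 < J (sol Lam) z * scl z w" using scl_pos[of w z] w op_cl z by auto
    also have "\<dots> \<le> dbl (sol Lam) z w"
      using dbl_ge[OF op_cl[OF w(1)] sol_cont[OF op_cl[OF w(1)]], of z z Lam] z w nn op_ivl_below[OF op_cl[OF w(1)]] by auto
    finally have "0 < sol Lam z - sol Lam w"
      using sol_diff[OF op_cl[OF w(1)], of z Lam] z w L by auto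
    then show False using z(4) nn[OF w(1)] by simp
  qed
qed

lemma sol_above_Lam:
  assumes "Lam < lam"
  obtains z where "z \<in> op_ivl D" "sol lam z = 0" "\<And>t. t \<in> {0..<z} \<Longrightarrow> 0 < sol lam t"
proof -
  have "lam \<notin> {lam. 0 \<le> lam \<and> (\<forall>x\<in>op_ivl D. 0 < sol lam x)}"
    using cSup_upper[OF _ bdd_positive_parameters, of lam] assms unfolding Lam_def by auto
  then obtain x where x: "x \<in> op_ivl D" "sol lam x \<le> 0" using assms Lam_nonneg by force
  then obtain z where z: "0 < z" "z \<le> x" "sol lam z = 0" "\<And>t. t \<in> {0..<z} \<Longrightarrow> 0 < sol lam t"
    using sol_first_zero[OF op_cl[OF x(1)], of lam] by auto
  moreover have zo: "z \<in> op_ivl D" using z x by (auto simp: op_ivl_def intro: le_less_trans[of "ereal z" "ereal x" D])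
  ultimately show ?thesis using that by blast
qed

lemma sol_supersolution:
  assumes x1: "x1 \<in> cl_ivl D" "0 < x1" and x: "x \<in> {0<..<x1}"
  shows "Lam * dbl (sol Lam) x x1 \<le> sol Lam x"
proof -
  have "0 \<le> sol Lam x1"
  proof -
    have "- sol Lam x1 \<le> 0"
      by (rule continuous_le_on_closure[where S="{0<..<x1}" and f="\<lambda>x. - sol Lam x"])
       (use x1 sol_Lam_pos op_ivl_below[OF x1(1)] in \<open>auto intro!: continuous_intros sol_cont less_imp_le\<close>)
    then show ?thesis by simp
  qed
  then show ?thesis using sol_diff[OF x1(1), of x Lam] x by auto
qed

text \<open>
  Upper estimates: \<open>g\<close> is compared with the eigenfunction \<open>sol Lam\<close>.
\<close>

lemma Lam_le_of_subsolution:
  assumes x1: "x1 \<in> op_ivl D"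
    and g: "continuous_on {0..x1} g" "\<And>x. x \<in> {0<..<x1} \<Longrightarrow> 0 < g x"
    and ge: "\<And>x. x \<in> {0<..<x1} \<Longrightarrow> g x \<le> lam * dbl g x x1"
  shows "Lam \<le> lam"
proof (cases "Lam = 0")
  case False
  then have L: "0 < Lam" using Lam_nonneg by simp
  have x0: "0 < x1" using x1 by (simp add: op_ivl_def)
  show ?thesis
    by (rule comparison[OF op_cl[OF x1] x0 sol_cont[OF op_cl[OF x1]] _ g L sol_supersolution[OF op_cl[OF x1] x0] ge])
      (use op_ivl_below[OF op_cl[OF x1]] sol_Lam_pos in auto)
next
  case True
  define y where "y = x1 / 2"
  have y: "y \<in> {0<..<x1}" using x1 by (auto simp: y_def op_ivl_def)
  have "0 < lam * dbl g y x1" using ge[OF y] g(2)[OF y] by simp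
  moreover have "0 \<le> dbl g y x1" using dbl_nonneg[OF op_cl[OF x1], of g y] g(2) y by (auto intro: less_imp_le)
  ultimately show ?thesis using True by (simp add: zero_less_mult_iff)
qed

text \<open>
  Lower estimates: were \<open>lam > Lam\<close>, then for \<open>l\<close> strictly between them \<open>sol l\<close> would have a zero
  \<open>z\<close> in \<open>(0,D)\<close>, and comparison of \<open>f\<close> with \<open>sol l\<close> on \<open>(0,z)\<close> would give \<open>lam \<le> l\<close>.
\<close>

lemma Lam_ge_of_supersolution:
  assumes f: "continuous_on (insert 0 (op_ivl D)) f" "\<And>x. x \<in> op_ivl D \<Longrightarrow> 0 < f x"
    and fe: "\<And>x z. x \<in> op_ivl D \<Longrightarrow> z \<in> op_ivl D \<Longrightarrow> x < z \<Longrightarrow> lam * dbl f x z \<le> f x"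
  shows "lam \<le> Lam"
proof (rule ccontr)
  assume "\<not> lam \<le> Lam"
  then obtain l where l: "Lam < l" "l < lam" using dense[of Lam lam] by auto
  obtain z where z: "z \<in> op_ivl D" "sol l z = 0" "\<And>t. t \<in> {0..<z} \<Longrightarrow> 0 < sol l t"
    using sol_above_Lam[OF l(1)] by blast
  have z0: "0 < z" using z by (simp add: op_ivl_def)
  have zc: "z \<in> cl_ivl D" using z op_cl by auto
  have "lam \<le> l"
  proof (rule comparison[OF zc z0 _ _ sol_cont[OF zc]])
    show "continuous_on {0..z} f" 
      by (rule continuous_on_subset[OF f(1)])
        (use z in \<open>auto simp: op_ivl_def intro: le_less_trans[of "ereal _" "ereal z" D]\<close>)
    show "0 < lam" using l Lam_nonneg by simp
    fix x assume x: "x \<in> {0<..<z}"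
    then have xo: "x \<in> op_ivl D" using op_ivl_below[OF zc] by auto
    show "0 < f x" by (rule f(2)[OF xo])
    show "0 < sol l x" using x z by auto
    show "lam * dbl f x z \<le> f x" by (rule fe) (use x xo z in auto)
    show "sol l x \<le> l * dbl (sol l) x z" using sol_diff[OF zc, of x l] x z by auto
  qed
  with l show False by simp
qed

text \<open>
  For \<open>D < \<infinity>\<close> this includes the endpoint \<open>D\<close>, where \<open>sol Lam\<close> itself vanishes in general. It
  provides the approximate maximizers of the differential form that are finite at \<open>D\<close>.
\<close>

lemma sol_pos_below_Lam:
  assumes "x \<in> cl_ivl D" "0 < Lam" "lam < Lam"
  shows "0 < sol lam x"
proof (rule ccontr)
  assume "\<not> 0 < sol lam x"
  then obtain z where z: "0 < z" "z \<le> x" "z \<in> cl_ivl D" "sol lam z = 0" "\<And>t. t \<in> {0..<z} \<Longrightarrow> 0 < sol lam t"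
    using sol_first_zero[OF assms(1), of lam] by auto
  have "Lam \<le> lam"
  proof (rule comparison[OF z(3,1) sol_cont[OF z(3)] _ sol_cont[OF z(3)] _ assms(2) sol_supersolution[OF z(3,1)]])
    fix x assume x: "x \<in> {0<..<z}"
    show "0 < sol Lam x" using sol_Lam_pos op_ivl_below[OF z(3)] x by auto
    show "0 < sol lam x" using x z by auto
    show "sol lam x \<le> lam * dbl (sol lam) x z" using sol_diff[OF z(3), of x lam] x z by auto
  qed auto
  with assms show False by simp
qed

text \<open>
  For \<open>D < \<infinity>\<close> the quantity \<open>c = dbl 1 0 d\<close> is finite, and \<open>sol \<lambda> \<ge> 1 - \<lambda> c > 0\<close> for small \<open>\<lambda>\<close>.
\<close>

lemma Lam_pos_if_finite:
  assumes D: "D = ereal d"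
  shows "0 < Lam"
proof -
  have d0: "0 < d" using D_pos D by (simp add: zero_ereal_def)
  have dc: "d \<in> cl_ivl D" using D d0 by simp
  define c where "c = dbl (\<lambda>_. 1) 0 d"
  have c: "0 \<le> c" unfolding c_def by (rule dbl_nonneg[OF dc]) auto
  define lam where "lam = 1 / (2 * (c + 1))"
  have lam: "0 < lam" using c by (simp add: lam_def)
  have lc: "lam * c < 1" using c by (simp add: lam_def field_simps)
  have "0 < sol lam x" if x: "x \<in> cl_ivl D" for x
  proof (rule ccontr)
    assume "\<not> 0 < sol lam x"
    then obtain z where z: "0 < z" "z \<le> x" "z \<in> cl_ivl D" "sol lam z = 0" "\<And>t. t \<in> {0..<z} \<Longrightarrow> 0 < sol lam t"
      using sol_first_zero[OF x, of lam] by auto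
    have zd: "z \<le> d" using z(3) D by simp
    have pos: "0 \<le> sol lam t" if "t \<in> {0..z}" for t
      using z that by (cases "t = z") (auto intro: less_imp_le)
    have "dbl (sol lam) 0 z \<le> dbl (\<lambda>_. 1) 0 z"
    proof (rule dbl_mono[OF z(3) sol_cont[OF z(3)]])
      fix t assume t: "t \<in> {0..z}"
      show "sol lam t \<le> 1" using sol_decr[of t 0 lam] t lam pos cl_ivl_downward[OF z(3), of t] by auto
    qed auto
    also have "\<dots> \<le> c"
      using dbl_combine[OF dc, of "\<lambda>_. 1" 0 z] dbl_nonneg[OF dc, of "\<lambda>_. 1" z] z zd by (auto simp: c_def)
    finally have "lam * dbl (sol lam) 0 z \<le> lam * c" using lam by simp
    then show False using sol_eq[OF z(3), of lam] z(4) lc by simp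
  qed
  then have "lam \<le> Lam"
    unfolding Lam_def using lam op_cl by (intro cSup_upper[OF _ bdd_positive_parameters]) auto
  with lam show ?thesis by simp
qed

end

lemma increment_Cauchy_Schwarz:
  fixes g g' w :: "real \<Rightarrow> real"
  assumes xz: "x \<le> z" and dg: "\<And>s. s \<in> {x..z} \<Longrightarrow> (g has_real_derivative g' s) (at s)"
    and gc: "continuous_on {x..z} g'" and wc: "continuous_on {x..z} w"
    and w: "\<And>s. s \<in> {x..z} \<Longrightarrow> 0 < w s"
  shows "ennreal ((g x - g z)\<^sup>2) \<le>
    (\<integral>\<^sup>+s. ennreal ((g' s)\<^sup>2 / w s) * indicator {x..z} s \<partial>lborel) * ennreal (integral {x..z} w)"
proof -
  define A where "A s = indicator {x..z} s *\<^sub>R (\<bar>g' s\<bar> / sqrt (w s))" for s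
  define B where "B s = indicator {x..z} s *\<^sub>R sqrt (w s)" for s
  have [measurable]: "A \<in> borel_measurable borel"
    unfolding A_def using w
    by (intro borel_measurable_continuous_on_indicator continuous_intros gc wc) (auto simp: less_le)
  have [measurable]: "B \<in> borel_measurable borel"
    unfolding B_def by (intro borel_measurable_continuous_on_indicator continuous_intros wc) simp
  have "(\<integral>\<^sup>+s. ennreal (A s) * ennreal (B s) \<partial>lborel) = (\<integral>\<^sup>+s. ennreal \<bar>g' s\<bar> * indicator {x..z} s \<partial>lborel)"
    using w by (intro nn_integral_cong)
      (fastforce simp: A_def B_def ennreal_mult'[symmetric] split: split_indicator)
  also have "\<dots> = ennreal (integral {x..z} (\<lambda>s. \<bar>g' s\<bar>))"
    by (rule nn_integral_has_integral_lebesgue')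
      (auto intro!: integrable_integral integrable_continuous_interval continuous_intros gc)
  finally have AB: "(\<integral>\<^sup>+s. ennreal (A s) * ennreal (B s) \<partial>lborel) = ennreal (integral {x..z} (\<lambda>s. \<bar>g' s\<bar>))" .
  have AA: "(\<integral>\<^sup>+s. (ennreal (A s))\<^sup>2 \<partial>lborel) = (\<integral>\<^sup>+s. ennreal ((g' s)\<^sup>2 / w s) * indicator {x..z} s \<partial>lborel)"
    using w by (intro nn_integral_cong)
      (auto simp: A_def ennreal_power less_imp_le power_divide split: split_indicator)
  have "(\<integral>\<^sup>+s. (ennreal (B s))\<^sup>2 \<partial>lborel) = (\<integral>\<^sup>+s. ennreal (w s) * indicator {x..z} s \<partial>lborel)"
    using w by (intro nn_integral_cong)
      (auto simp: B_def ennreal_power less_imp_le split: split_indicator)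
  also have "\<dots> = ennreal (integral {x..z} w)"
    using w by (intro nn_integral_has_integral_lebesgue' integrable_integral integrable_continuous_interval wc)
      (auto intro: less_imp_le)
  finally have BB: "(\<integral>\<^sup>+s. (ennreal (B s))\<^sup>2 \<partial>lborel) = ennreal (integral {x..z} w)" .
  have "(g' has_integral g z - g x) {x..z}"
  proof (rule fundamental_theorem_of_calculus[OF xz])
    fix s assume "s \<in> {x..z}"
    then show "(g has_vector_derivative g' s) (at s within {x..z})"
      using dg[of s] by (simp add: has_real_derivative_iff_has_vector_derivative has_vector_derivative_at_within)
  qed
  then have "g z - g x = integral {x..z} g'" by (simp add: integral_unique)
  also have "norm \<dots> \<le> integral {x..z} (\<lambda>s. \<bar>g' s\<bar>)"
    by (rule integral_norm_bound_integral)
      (auto intro!: integrable_continuous_interval continuous_intros gc)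
  finally have "\<bar>g x - g z\<bar> \<le> integral {x..z} (\<lambda>s. \<bar>g' s\<bar>)" by (simp add: abs_minus_commute)
  then have "(g x - g z)\<^sup>2 \<le> (integral {x..z} (\<lambda>s. \<bar>g' s\<bar>))\<^sup>2"
    by (metis abs_ge_zero power2_abs power_mono)
  then have "ennreal ((g x - g z)\<^sup>2) \<le> (\<integral>\<^sup>+s. ennreal (A s) * ennreal (B s) \<partial>lborel)\<^sup>2"
    unfolding AB by (simp add: ennreal_power ennreal_leI integral_nonneg_of_nonneg)
  also have "\<dots> \<le> (\<integral>\<^sup>+s. (ennreal (A s))\<^sup>2 \<partial>lborel) * (\<integral>\<^sup>+s. (ennreal (B s))\<^sup>2 \<partial>lborel)"
    by (rule Cauchy_Schwarz_nn_integral) auto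
  finally show ?thesis unfolding AA BB .
qed

section \<open>The Rayleigh quotient\<close>

lemma DERIV_positive_part_squared:
  "((\<lambda>t. (max 0 t)\<^sup>2) has_real_derivative 2 * max 0 t) (at (t::real))"
proof -
  consider "t < 0" | "t > 0" | "t = 0" by linarith
  then show ?thesis
  proof cases
    case 1
    have "((\<lambda>t::real. 0) has_real_derivative 0) (at t)" by simp
    then have "((\<lambda>t. (max 0 t)\<^sup>2) has_real_derivative 0) (at t)"
      by (rule has_field_derivative_transform_within_open[where S="{..<0}"]) (use 1 in auto)
    with 1 show ?thesis by simp
  next
    case 2
    have "((\<lambda>t::real. t\<^sup>2) has_real_derivative 2 * t) (at t)"
      by (auto intro!: derivative_eq_intros)
    then have "((\<lambda>t. (max 0 t)\<^sup>2) has_real_derivative 2 * t) (at t)"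
      by (rule has_field_derivative_transform_within_open[where S="{0<..}"]) (use 2 in auto)
    with 2 show ?thesis by simp
  next
    case 3
    have "((\<lambda>h::real. (max 0 h)\<^sup>2 / h) \<longlongrightarrow> 0) (at 0)"
    proof (rule Lim_null_comparison)
      show "\<forall>\<^sub>F h in at 0. norm ((max 0 h)\<^sup>2 / h) \<le> \<bar>h::real\<bar>"
        by (rule always_eventually) (auto simp: power2_eq_square max_def)
      show "((\<lambda>h::real. \<bar>h\<bar>) \<longlongrightarrow> 0) (at 0)" by (rule tendsto_eq_intros refl | simp)+
    qed
    with 3 show ?thesis by (simp add: DERIV_def)
  qed
qed

context string
begin

abbreviation mass_sq :: "(real \<Rightarrow> real) \<Rightarrow> ennreal" where
  "mass_sq g \<equiv> (\<integral>\<^sup>+x. ennreal (m x * (g x)\<^sup>2) * indicator (op_ivl D) x \<partial>lborel)"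

abbreviation energy :: "(real \<Rightarrow> real) \<Rightarrow> ennreal" where
  "energy v \<equiv> (\<integral>\<^sup>+x. ennreal ((v x)\<^sup>2 / p x) * indicator (op_ivl D) x \<partial>lborel)"

text \<open>
  Let \<open>f = sol Lam\<close>, so that \<open>- f' = Lam p J f\<close>. For \<open>x < z\<close> the Cauchy--Schwarz inequality gives
  \<open>(g x - g z)\<^sup>2 \<le> (\<integral>\<^sub>x\<^sup>z g'\<^sup>2 / (- f')) (\<integral>\<^sub>x\<^sup>z - f') \<le> f x (\<integral>\<^sub>x\<^sup>z g'\<^sup>2 / (- f'))\<close>. Letting \<open>z\<close> tend to \<open>D\<close> along \<open>Z\<close>,
  integrating over \<open>\<mu>\<close> and exchanging the integrals, the factor \<open>\<integral>\<^sub>0\<^sup>s f d\<mu> = J f s\<close> appears and cancels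
  against \<open>- f' = Lam p J f\<close>. What remains is \<open>g'\<^sup>2 / (Lam p)\<close>. This argument, in contrast to one
  by integration by parts, needs no product rule for functions that are only absolutely continuous.
\<close>

lemma energy_ge_Lam:
  fixes g g' :: "real \<Rightarrow> real" and Z :: "nat \<Rightarrow> real"
  assumes g: "continuous_on (cl_ivl D) g"
    and dg: "\<And>x. x \<in> op_ivl D \<Longrightarrow> (g has_real_derivative g' x) (at x)"
    and g'c: "continuous_on (op_ivl D) g'"
    and Z: "\<And>n. Z n \<in> op_ivl D" "\<And>x. x \<in> op_ivl D \<Longrightarrow> \<forall>\<^sub>F n in sequentially. x < Z n"
    and gZ: "(\<lambda>n. g (Z n)) \<longlonglongrightarrow> 0"
  shows "ennreal Lam * mass_sq g
     \<le> energy g'"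
proof (cases "Lam = 0")
  case False
  then have L: "0 < Lam" using Lam_nonneg by simp
  define f where "f = sol Lam"
  have fpos: "0 < f x" if "x \<in> op_ivl D" for x using sol_Lam_pos[OF that] by (simp add: f_def)
  have fc: "continuous_on {0..x} f" if "x \<in> cl_ivl D" for x using sol_cont[OF that] by (simp add: f_def)
  have fcl: "continuous_on (cl_ivl D) f" by (simp add: f_def sol_cont_cl)
  have Jpos: "0 < J f s" if "s \<in> op_ivl D" for s
    using that op_cl fc fpos op_ivl_below[of s D] by (intro J_pos) (auto simp: op_ivl_def)
  have Jc: "continuous_on (op_ivl D) (J f)"
    by (rule continuous_on_subset[OF continuous_on_cl_ivl op_ivl_subset_cl_ivl]) (rule J_cont[OF _ fc])
  have pc: "continuous_on (op_ivl D) p" by (rule continuous_on_subset[OF p_cont op_ivl_subset_cl_ivl])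
  have ppos: "0 < p x" if "x \<in> op_ivl D" for x using p_pos op_cl that by auto
  \<comment> \<open>\<open>k = g'\<^sup>2 / (- f')\<close>\<close>
  define k where "k s = (g' s)\<^sup>2 / (p s * (Lam * J f s))" for s
  have knn: "0 \<le> k s" if "s \<in> op_ivl D" for s
    using L Jpos[OF that] ppos[OF that] by (auto simp: k_def)
  have step1: "ennreal ((g x - g z)\<^sup>2) \<le> ennreal (f x) * (\<integral>\<^sup>+s. ennreal (k s) * indicator {x..z} s \<partial>lborel)"
    if x: "x \<in> op_ivl D" and z: "z \<in> op_ivl D" "x < z" for x z
  proof -
    have x0: "0 < x" using x by (simp add: op_ivl_def)
    have zc: "z \<in> cl_ivl D" using z op_cl by auto
    have sub: "{x..z} \<subseteq> op_ivl D"
      using x0 z by (auto simp: op_ivl_def intro: le_less_trans[of "ereal _" "ereal z" D])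
    let ?w = "\<lambda>s. p s * (Lam * J f s)"
    have incr: "ennreal ((g x - g z)\<^sup>2) \<le>
        (\<integral>\<^sup>+s. ennreal ((g' s)\<^sup>2 / ?w s) * indicator {x..z} s \<partial>lborel) * ennreal (integral {x..z} ?w)"
    proof (rule increment_Cauchy_Schwarz)
      show "continuous_on {x..z} ?w"
        by (intro continuous_intros continuous_on_subset[OF pc sub] continuous_on_subset[OF Jc sub])
      show "0 < ?w s" if "s \<in> {x..z}" for s
      proof -
        have "s \<in> op_ivl D" using sub that by auto
        then show ?thesis by (intro mult_pos_pos L Jpos ppos)
      qed
    qed (use z sub dg continuous_on_subset[OF g'c sub] in auto)
    have "integral {x..z} ?w = Lam * dbl f x z" by (simp only: dbl_def mult.left_commute[of "p _" Lam] integral_mult_right)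
    also have "Lam * dbl f x z = f x - f z"
      unfolding f_def using sol_diff[OF zc, of x Lam] x0 z by auto
    also have "\<dots> \<le> f x" using fpos[OF z(1)] by simp
    finally have "ennreal (integral {x..z} ?w) \<le> ennreal (f x)" by (rule ennreal_leI)
    from order_trans[OF incr mult_left_mono[OF this]] show ?thesis
      by (simp add: k_def[abs_def] mult.commute[of _ "ennreal (f x)"])
  qed
  define kk where "kk s = indicator (op_ivl D) s *\<^sub>R k s" for s
  define mf where "mf x = m x * (indicator (op_ivl D) x *\<^sub>R f x)" for x
  let ?T = "\<lambda>x. \<integral>\<^sup>+s. ennreal (kk s) * indicator {x..} s \<partial>lborel"
  let ?S = "\<lambda>s. \<integral>\<^sup>+x. ennreal (mf x) * indicator {..s} x \<partial>lborel"
  have kc: "continuous_on (op_ivl D) k"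
    unfolding k_def using L Jpos ppos by (intro continuous_intros g'c pc Jc) (auto simp: less_le)
  have [measurable]: "kk \<in> borel_measurable borel"
    unfolding kk_def by (rule borel_measurable_continuous_on_indicator[OF _ kc]) simp
  have [measurable]: "(\<lambda>x. indicator (op_ivl D) x *\<^sub>R f x) \<in> borel_measurable borel"
    by (rule borel_measurable_continuous_on_indicator)
      (auto intro: continuous_on_subset[OF fcl op_ivl_subset_cl_ivl])
  have [measurable]: "mf \<in> borel_measurable borel"
    unfolding mf_def by measurable
  have step2: "ennreal ((g x)\<^sup>2) \<le> ennreal (f x) * ?T x"
    if x: "x \<in> op_ivl D" for x
  proof (rule LIMSEQ_le_const2)
    show "(\<lambda>n. ennreal ((g x - g (Z n))\<^sup>2)) \<longlonglongrightarrow> ennreal ((g x)\<^sup>2)"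
      using gZ by (intro tendsto_ennrealI) (auto intro!: tendsto_eq_intros)
    obtain N where N: "\<And>n. n \<ge> N \<Longrightarrow> x < Z n"
      using Z(2)[OF x] unfolding eventually_sequentially by blast
    have "ennreal ((g x - g (Z n))\<^sup>2) \<le> ennreal (f x) * ?T x" if "N \<le> n" for n
    proof -
      have "ennreal ((g x - g (Z n))\<^sup>2) \<le> ennreal (f x) * (\<integral>\<^sup>+s. ennreal (k s) * indicator {x..Z n} s \<partial>lborel)"
        by (rule step1[OF x Z(1) N[OF that]])
      also have "\<dots> \<le> ennreal (f x) * ?T x"
      proof (intro mult_left_mono nn_integral_mono)
        fix s
        have "s \<in> op_ivl D" if "s \<in> {x..Z n}"
          using x Z(1)[of n] that by (auto simp: op_ivl_def intro: le_less_trans[of "ereal s" "ereal (Z n)" D])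
        then show "ennreal (k s) * indicator {x..Z n} s \<le> ennreal (kk s) * indicator {x..} s"
          by (auto simp: kk_def split: split_indicator)
      qed simp
      finally show ?thesis .
    qed
    then show "\<exists>N. \<forall>n\<ge>N. ennreal ((g x - g (Z n))\<^sup>2) \<le> ennreal (f x) * ?T x"
      by blast
  qed
  have "mass_sq g \<le> (\<integral>\<^sup>+x. ennreal (mf x) * ?T x \<partial>lborel)"
  proof (rule nn_integral_mono)
    fix x
    show "ennreal (m x * (g x)\<^sup>2) * indicator (op_ivl D) x \<le> ennreal (mf x) * ?T x"
    proof (cases "x \<in> op_ivl D")
      case True
      have "ennreal (m x * (g x)\<^sup>2) = ennreal (m x) * ennreal ((g x)\<^sup>2)"
        using m_nonneg by (simp add: ennreal_mult')
      also have "\<dots> \<le> ennreal (m x) * (ennreal (f x) * ?T x)"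
        by (intro mult_left_mono step2 True) simp
      finally show ?thesis using True m_nonneg by (simp add: mf_def ennreal_mult' mult.assoc)
    qed simp
  qed
  also have "\<dots> = (\<integral>\<^sup>+s. ennreal (kk s) * ?S s \<partial>lborel)"
    by (rule nn_integral_triangle_swap) measurable
  also have "\<dots> = (\<integral>\<^sup>+s. ennreal (1 / Lam) * (ennreal ((g' s)\<^sup>2 / p s) * indicator (op_ivl D) s) \<partial>lborel)"
  proof (rule nn_integral_cong)
    fix s
    show "ennreal (kk s) * ?S s =
        ennreal (1 / Lam) * (ennreal ((g' s)\<^sup>2 / p s) * indicator (op_ivl D) s)"
    proof (cases "s \<in> op_ivl D")
      case True
      have "?S s =
         (\<integral>\<^sup>+x. ennreal (m x * f x) * indicator {0..s} x \<partial>lborel)"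
        using m_outside True by (intro nn_integral_cong)
          (auto simp: mf_def op_ivl_def split: split_indicator)
      also have "\<dots> = ennreal (J f s)"
      proof (rule J_nn_integral[OF op_cl[OF True] fc[OF op_cl[OF True]]])
        fix t assume t: "t \<in> {0..s}"
        show "0 \<le> f t"
          using fpos[of t] fpos[OF True] op_ivl_below[OF op_cl[OF True], of t] t
          by (cases "t = 0"; cases "t = s") (auto simp: f_def)
      qed
      finally have "ennreal (kk s) * ?S s = ennreal (1 / Lam) * ennreal ((g' s)\<^sup>2 / p s)"
        using True L Jpos[OF True] ppos[OF True] knn[OF True]
        by (simp add: kk_def k_def ennreal_mult'[symmetric])
      then show ?thesis using True by simp
    qed (simp add: kk_def)
  qed
  also have "\<dots> = ennreal (1 / Lam) * energy g'"
  proof (rule nn_integral_cmult)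
    show "(\<lambda>s. ennreal ((g' s)\<^sup>2 / p s) * indicator (op_ivl D) s) \<in> borel_measurable lborel"
      by (rule ennreal_indicator_measurable_continuous)
       (use g'c pc ppos in \<open>auto intro!: continuous_intros simp: less_le\<close>)
  qed
  finally have "ennreal Lam * mass_sq g
    \<le> ennreal Lam * (ennreal (1 / Lam) * energy g')"
    by (rule mult_left_mono) simp
  also have "\<dots> = energy g'"
    using L by (simp add: mult.assoc[symmetric] ennreal_mult'[symmetric])
  finally show ?thesis .
qed simp

text \<open>
  Integration by parts for the eigenfunction on \<open>(0,z)\<close>, again in the form of Tonelli's theorem:
  \<open>\<integral> f'\<^sup>2 / p = \<integral> (- f') \<lambda> J f = \<lambda> \<integral> f(x) (f x - f z) \<mu>(dx)\<close>.
\<close>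

lemma sol_energy:
  assumes z: "z \<in> op_ivl D" and lam: "0 < lam" and fz: "sol lam z = 0"
    and pos: "\<And>t. t \<in> {0..<z} \<Longrightarrow> 0 < sol lam t"
  shows "(\<integral>\<^sup>+s. ennreal ((lam * (p s * J (sol lam) s))\<^sup>2 / p s) * indicator {0<..<z} s \<partial>lborel)
    = ennreal (lam * J (\<lambda>t. (sol lam t)\<^sup>2) z)"
proof -
  define f where "f = sol lam"
  have zc: "z \<in> cl_ivl D" and z0: "0 < z" using z op_cl by (auto simp: op_ivl_def)
  have fc: "continuous_on {0..z} f" using sol_cont[OF zc] by (simp add: f_def)
  have fnn: "0 \<le> f t" if "t \<in> {0..z}" for t
    using pos[of t] fz that by (cases "t = z") (auto simp: f_def less_imp_le)
  have sc: "s \<in> cl_ivl D" if "s \<in> {0..z}" for s using cl_ivl_downward[OF zc] that by auto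
  have Jnn: "0 \<le> J f s" if "s \<in> {0..z}" for s
    using fnn that sc by (intro J_nonneg) auto
  define r where "r s = indicator {0..z} s *\<^sub>R (p s * J f s)" for s
  define mf where "mf x = m x * (indicator {0..z} x *\<^sub>R f x)" for x
  have [measurable]: "r \<in> borel_measurable borel"
    unfolding r_def by (rule borel_measurable_continuous_on_indicator[OF _ pJ_cont[OF zc fc]]) simp
  have [measurable]: "(\<lambda>x. indicator {0..z} x *\<^sub>R f x) \<in> borel_measurable borel"
    by (rule borel_measurable_continuous_on_indicator[OF _ fc]) simp
  have [measurable]: "mf \<in> borel_measurable borel"
    unfolding mf_def by measurable
  have rnn: "0 \<le> r s" for s
    using Jnn[of s] p_pos[OF sc, of s] by (auto simp: r_def split: split_indicator)
  have "(\<integral>\<^sup>+s. ennreal ((lam * (p s * J (sol lam) s))\<^sup>2 / p s) * indicator {0<..<z} s \<partial>lborel)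
    = (\<integral>\<^sup>+s. ennreal ((lam * (p s * J f s))\<^sup>2 / p s) * indicator {0..z} s \<partial>lborel)"
    unfolding f_def by (rule nn_integral_Ioo_eq_Icc)
  also have "\<dots> = (\<integral>\<^sup>+s. ennreal (lam\<^sup>2 * r s) * (\<integral>\<^sup>+x. ennreal (mf x) * indicator {..s} x \<partial>lborel) \<partial>lborel)"
  proof (rule nn_integral_cong)
    fix s
    show "ennreal ((lam * (p s * J f s))\<^sup>2 / p s) * indicator {0..z} s
       = ennreal (lam\<^sup>2 * r s) * (\<integral>\<^sup>+x. ennreal (mf x) * indicator {..s} x \<partial>lborel)"
    proof (cases "s \<in> {0..z}")
      case True
      have "(\<integral>\<^sup>+x. ennreal (mf x) * indicator {..s} x \<partial>lborel) = (\<integral>\<^sup>+x. ennreal (m x * f x) * indicator {0..s} x \<partial>lborel)"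
        using True by (intro nn_integral_cong) (auto simp: mf_def split: split_indicator)
      also have "\<dots> = ennreal (J f s)"
        using fnn True by (intro J_nn_integral[OF sc[OF True]] continuous_on_subset[OF fc]) auto
      finally show ?thesis
        using True Jnn[OF True] rnn[of s] p_pos[OF sc[OF True]] 
        by (simp add: ennreal_mult'[symmetric] r_def power2_eq_square mult_ac)
    qed (simp add: r_def)
  qed
  also have "\<dots> = (\<integral>\<^sup>+x. ennreal (mf x) * (\<integral>\<^sup>+s. ennreal (lam\<^sup>2 * r s) * indicator {x..} s \<partial>lborel) \<partial>lborel)"
    by (rule nn_integral_triangle_swap[symmetric]) measurable
  also have "\<dots> = (\<integral>\<^sup>+x. ennreal lam * (ennreal (m x * (f x)\<^sup>2) * indicator {0..z} x) \<partial>lborel)"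
  proof (rule nn_integral_cong)
    fix x
    show "ennreal (mf x) * (\<integral>\<^sup>+s. ennreal (lam\<^sup>2 * r s) * indicator {x..} s \<partial>lborel)
       = ennreal lam * (ennreal (m x * (f x)\<^sup>2) * indicator {0..z} x)"
    proof (cases "x \<in> {0..z}")
      case True
      have "(\<integral>\<^sup>+s. ennreal (lam\<^sup>2 * r s) * indicator {x..} s \<partial>lborel)
        = (\<integral>\<^sup>+s. ennreal (lam\<^sup>2 * (p s * J f s)) * indicator {x..z} s \<partial>lborel)"
        using True by (intro nn_integral_cong) (auto simp: r_def split: split_indicator)
      also have "\<dots> = ennreal (lam\<^sup>2 * dbl f x z)"
        unfolding dbl_def
      proof (rule nn_integral_has_integral_lebesgue')
        show "((\<lambda>s. lam\<^sup>2 * (p s * J f s)) has_integral lam\<^sup>2 * integral {x..z} (\<lambda>s. p s * J f s)) {x..z}"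
          by (intro has_integral_mult_right integrable_integral pJ_int[OF zc fc]) (use True in auto)
        fix s assume "s \<in> {x..z}"
        then show "0 \<le> lam\<^sup>2 * (p s * J f s)" using rnn[of s] True by (simp add: r_def)
      qed
      also have "lam\<^sup>2 * dbl f x z = lam * f x"
        using sol_diff[OF zc, of x lam] fz True by (simp add: f_def power2_eq_square)
      finally show ?thesis using True lam fnn[OF True] m_nonneg[of x]
        by (simp add: mf_def ennreal_mult'[symmetric] power2_eq_square mult_ac)
    qed (simp add: mf_def)
  qed
  also have "\<dots> = ennreal lam * (\<integral>\<^sup>+x. (ennreal (m x * (f x)\<^sup>2) * indicator {0..z} x) \<partial>lborel)"
  proof (rule nn_integral_cmult)
    have "(\<lambda>x. ennreal (m x * (f x)\<^sup>2) * indicator {0..z} x) = (\<lambda>x. ennreal (m x * (indicator {0..z} x *\<^sub>R f x)\<^sup>2) * indicator {0..z} x)"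
      by (auto simp: fun_eq_iff split: split_indicator)
    also have "\<dots> \<in> borel_measurable lborel" by measurable
    finally show "(\<lambda>x. ennreal (m x * (f x)\<^sup>2) * indicator {0..z} x) \<in> borel_measurable lborel" .
  qed
  also have "(\<integral>\<^sup>+x. (ennreal (m x * (f x)\<^sup>2) * indicator {0..z} x) \<partial>lborel) = ennreal (J (\<lambda>t. (f t)\<^sup>2) z)"
    by (rule J_nn_integral[OF zc]) (auto intro!: continuous_intros fc)
  finally show ?thesis using lam by (simp add: ennreal_mult' f_def)
qed

text \<open>
  For \<open>lam\<close> between \<open>Lam\<close> and \<open>lam'\<close> the solution \<open>f = sol lam\<close> has a first zero \<open>z\<close>, and by
  the energy identity the function \<open>f\<close>, extended by \<open>0\<close> beyond \<open>z\<close>, has Rayleigh quotient \<open>lam\<close>, but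
  it is not differentiable at \<open>z\<close>. It is replaced by \<open>\<phi> \<circ> f\<close> with \<open>\<phi> t = (t - d)\<^sub>+\<^sup>2 / t\<close>. This is
  continuously differentiable with \<open>0 \<le> \<phi>' \<le> 1\<close>, hence does not increase the energy, and from
  \<open>\<phi> t \<ge> t - 2 d\<close> the loss of mass is at most \<open>4 d \<integral> f d\<mu>\<close>.
\<close>

lemma test_function:
  assumes "Lam < lam'"
  obtains g z where "z \<in> op_ivl D" "C1_on (op_ivl D) g" "continuous_on (cl_ivl D) g"
    "\<And>x. z \<le> x \<Longrightarrow> g x = 0" "0 < J (\<lambda>t. (g t)\<^sup>2) z"
    "mass_sq g = ennreal (J (\<lambda>t. (g t)\<^sup>2) z)"
    "energy (deriv g) \<le> ennreal (lam' * J (\<lambda>t. (g t)\<^sup>2) z)"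
proof -
  obtain lam where l: "Lam < lam" "lam < lam'" using dense[OF assms] by blast
  then have lam: "0 < lam" using Lam_nonneg by simp
  obtain z where z: "z \<in> op_ivl D" and fz: "sol lam z = 0" and pos: "\<And>t. t \<in> {0..<z} \<Longrightarrow> 0 < sol lam t"
    using sol_above_Lam[OF l(1)] by blast
  define f where "f = sol lam"
  have zc: "z \<in> cl_ivl D" and z0: "0 < z" using z op_cl by (auto simp: op_ivl_def)
  have fc: "continuous_on {0..z} f" using sol_cont[OF zc] by (simp add: f_def)
  have fpos: "0 < f t" if "t \<in> {0..<z}" for t using pos that by (simp add: f_def)
  have fnn: "0 \<le> f t" if "t \<in> {0..z}" for t
    using pos[of t] fz that by (cases "t = z") (auto simp: f_def less_imp_le)
  define a1 where "a1 = J f z"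
  define a2 where "a2 = J (\<lambda>t. (f t)\<^sup>2) z"
  have a1: "0 < a1" unfolding a1_def by (rule J_pos[OF zc z0 fc]) (use fpos in auto)
  have a2: "0 < a2" unfolding a2_def
  proof (rule J_pos[OF zc z0])
    show "0 < (f t)\<^sup>2" if "t \<in> {0<..<z}" for t
      using fpos[of t] that by auto
  qed (intro continuous_intros fc)
  \<comment> \<open>Chosen so that the loss of mass \<open>4 d a1\<close> raises the bound for the quotient from \<open>lam\<close> to \<open>lam'\<close>.\<close>
  define d where "d = a2 * (lam' - lam) / (4 * lam' * a1)"
  have d: "0 < d" using a1 a2 l lam by (simp add: d_def)
  have dl: "lam' * (a2 - 4 * d * a1) = lam * a2"
    using a1 l lam by (simp add: d_def field_simps)
  define r where "r x = max 0 (f (max 0 (min x z)) - d)" for x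
  \<comment> \<open>The denominator is \<open>f x\<close> wherever \<open>r x \<noteq> 0\<close>; bounding it below by \<open>d\<close> and truncating the
    argument to \<open>[0,z]\<close> keeps \<open>g\<close> continuous everywhere.\<close>
  define g where "g x = (r x)\<^sup>2 / max (f (max 0 (min x z))) d" for x
  define G where "G x = (if x < z then (2 * r x * f x - (r x)\<^sup>2) / (f x)\<^sup>2 * - (lam * (p x * J f x)) else 0)" for x
  have fmc: "continuous_on S (\<lambda>x. f (max 0 (min x z)))" for S
    by (rule continuous_on_compose2[OF fc]) (use z0 in \<open>auto intro!: continuous_intros\<close>)
  have gc: "continuous_on S g" for S
    unfolding g_def r_def using d
    by (intro continuous_intros fmc) (auto simp: max_def)
  have g0: "g x = 0" if "z \<le> x" for x
    using that fz d z0 by (simp add: g_def r_def f_def)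
  have r_le: "r x \<le> f x" if "x \<in> {0..<z}" for x
    using that fpos[of x] d by (auto simp: r_def)
  have geq: "g x = (r x)\<^sup>2 / f x" if "x \<in> {0..<z}" for x
    using that d fpos[of x] by (cases "f x \<le> d") (auto simp: g_def r_def max_def)
  \<comment> \<open>Right of \<open>y\<close> the function \<open>g\<close> vanishes, so that nothing happens at \<open>z\<close>.\<close>
  obtain y where y: "0 < y" "y < z" "\<And>x. x \<in> {y..z} \<Longrightarrow> f x < d"
  proof -
    have "continuous (at z within {0..z}) f" using fc z0 by (auto simp: continuous_on_eq_continuous_within)
    then obtain e where e: "0 < e" "\<And>x. x \<in> {0..z} \<Longrightarrow> dist x z < e \<Longrightarrow> dist (f x) (f z) < d"
      using d unfolding continuous_within_eps_delta by blast
    define y where "y = max (z/2) (z - e/2)"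
    have "f x < d" if "x \<in> {y..z}" for x
    proof -
      have "dist (f x) (f z) < d" using that e z0 by (intro e(2)) (auto simp: y_def dist_real_def)
      then show ?thesis using fz by (simp add: dist_real_def f_def)
    qed
    then show ?thesis using that[of y] e z0 by (auto simp: y_def)
  qed
  have rz: "r x = 0" if "y \<le> x" for x
  proof -
    have "max 0 (min x z) \<in> {y..z}" using y that by auto
    then show ?thesis using y(3)[of "max 0 (min x z)"] by (simp add: r_def)
  qed
  have gz: "g x = 0" if "y \<le> x" for x using rz[OF that] by (simp add: g_def)
  have Gz: "G x = 0" if "y \<le> x" for x using rz[OF that] by (simp add: G_def)
  have dG: "(g has_real_derivative G x) (at x)" if x: "x \<in> op_ivl D" for x
  proof (cases "x < z")
    case True
    have xp: "0 < f x" using fpos[of x] x True by (auto simp: op_ivl_def)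
    have df: "(f has_real_derivative - (lam * (p x * J f x))) (at x)"
      unfolding f_def by (rule sol_deriv[OF x])
    have rx: "r x = max 0 (f x - d)" using x True by (simp add: r_def op_ivl_def)
    have "((\<lambda>x. f x - d) has_real_derivative - (lam * (p x * J f x)) - 0) (at x)"
      by (intro derivative_intros df)
    from DERIV_chain[OF DERIV_positive_part_squared this]
    have dr: "((\<lambda>x. (max 0 (f x - d))\<^sup>2) has_real_derivative 2 * r x * - (lam * (p x * J f x))) (at x)"
      using rx by (simp add: o_def)
    have "((\<lambda>x. (max 0 (f x - d))\<^sup>2 / f x) has_real_derivative G x) (at x)"
      using DERIV_divide[OF dr df] xp True
      by (simp add: G_def rx power2_eq_square algebra_simps)
    then show ?thesis
      by (rule has_field_derivative_transform_within_open[where S="{0<..<z}"])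
        (use x True geq in \<open>auto simp: op_ivl_def r_def\<close>)
  next
    case False
    have "((\<lambda>x. 0) has_real_derivative G x) (at x)" using False by (simp add: G_def)
    then show ?thesis
      by (rule has_field_derivative_transform_within_open[where S="{y<..}"])
        (use False y gz in auto)
  qed
  have Gc: "continuous_on (op_ivl D) G"
  proof -
    have "continuous_on {0<..<z} (\<lambda>x. (2 * r x * f x - (r x)\<^sup>2) / (f x)\<^sup>2 * - (lam * (p x * J f x)))"
      unfolding r_def using fpos
      by (intro continuous_intros fmc continuous_on_subset[OF fc] continuous_on_subset[OF J_cont[OF zc fc]]
           continuous_on_subset[OF p_cont])
        (auto simp: less_le intro: cl_ivl_downward[OF zc] dest: fpos)
    then have "continuous_on {0<..<z} G"
      by (rule continuous_on_eq) (simp add: G_def)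
    moreover have "continuous_on (op_ivl D \<inter> {y<..}) G"
      by (rule continuous_on_eq[of _ "\<lambda>x. 0"]) (auto simp: Gz)
    moreover have "op_ivl D = {0<..<z} \<union> (op_ivl D \<inter> {y<..})"
      using y op_ivl_below[OF zc] by (auto simp: op_ivl_def)
    ultimately show ?thesis
      using continuous_on_open_Un[of "{0<..<z}" "op_ivl D \<inter> {y<..}" G]
        open_Int[OF open_op_ivl open_greaterThan, of D y] by auto
  qed
  have dg: "deriv g x = G x" if "x \<in> op_ivl D" for x by (rule DERIV_imp_deriv[OF dG[OF that]])
  have C1: "C1_on (op_ivl D) g"
    unfolding C1_on_def
  proof (intro conjI ballI)
    show "g differentiable at x" if "x \<in> op_ivl D" for x
      using dG[OF that] by (auto simp: real_differentiable_def)
    show "continuous_on (op_ivl D) (deriv g)"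
      by (rule continuous_on_eq[OF Gc]) (simp add: dg)
  qed
  have low: "(f x)\<^sup>2 - 4 * d * f x \<le> (g x)\<^sup>2" if x: "x \<in> {0..z}" for x
  proof (cases "f x \<le> 2 * d")
    case True
    have "f x * f x \<le> f x * (4 * d)"
      by (rule mult_left_mono) (use True d fnn[OF x] in auto)
    then have "(f x)\<^sup>2 - 4 * d * f x \<le> 0" by (simp add: power2_eq_square mult_ac)
    then show ?thesis using zero_le_power2[of "g x"] by linarith
  next
    case False
    then have xz: "x \<in> {0..<z}" using x fz d by (cases "x = z") (auto simp: f_def)
    have fx: "0 < f x" using False d by linarith
    have "g x = (f x - d)\<^sup>2 / f x" using geq[OF xz] xz False d by (simp add: r_def)
    also have "\<dots> = f x - 2 * d + d\<^sup>2 / f x" using fx by (simp add: field_simps power2_eq_square)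
    finally have "f x - 2 * d \<le> g x" using fx by simp
    then have "(f x - 2 * d)\<^sup>2 \<le> (g x)\<^sup>2" using False by (intro power_mono) auto
    moreover have "(f x - 2 * d)\<^sup>2 = (f x)\<^sup>2 - 4 * d * f x + 4 * d\<^sup>2" by (simp add: power2_eq_square algebra_simps)
    ultimately show ?thesis using zero_le_power2[of d] by linarith
  qed
  have "lam * a2 = lam' * (a2 - 4 * d * a1)" using dl by simp
  also have "a2 - 4 * d * a1 = J (\<lambda>x. (f x)\<^sup>2 - (4 * d) * f x) z"
  proof -
    have "J (\<lambda>x. (f x)\<^sup>2 - (4 * d) * f x) z = J (\<lambda>x. (f x)\<^sup>2) z - J (\<lambda>x. (4 * d) * f x) z"
      by (rule J_diff[OF zc]) (intro continuous_intros fc order_refl)+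
    then show ?thesis unfolding J_cmult by (simp add: a1_def a2_def)
  qed
  also have "lam' * \<dots> \<le> lam' * J (\<lambda>x. (g x)\<^sup>2) z"
    by (intro mult_left_mono J_mono[OF zc] continuous_intros fc gc order_refl low) (use lam l in auto)
  finally have key: "lam * a2 \<le> lam' * J (\<lambda>x. (g x)\<^sup>2) z" .
  have "0 < lam * a2" using lam a2 by simp
  then have Qpos: "0 < J (\<lambda>x. (g x)\<^sup>2) z" using key l lam by (smt (verit) zero_less_mult_pos)
  have Q: "mass_sq g = ennreal (J (\<lambda>t. (g t)\<^sup>2) z)"
  proof -
    have "mass_sq g = 
       (\<integral>\<^sup>+x. ennreal (m x * (g x)\<^sup>2) * indicator {0..z} x \<partial>lborel)"
      using g0 m_outside by (intro nn_integral_cong) (auto simp: op_ivl_def split: split_indicator)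
    also have "\<dots> = ennreal (J (\<lambda>t. (g t)\<^sup>2) z)"
      by (rule J_nn_integral[OF zc]) (auto intro!: continuous_intros gc)
    finally show ?thesis .
  qed
  have "energy (deriv g) \<le>
    (\<integral>\<^sup>+s. ennreal ((lam * (p s * J f s))\<^sup>2 / p s) * indicator {0<..<z} s \<partial>lborel)"
  proof (rule nn_integral_mono)
    fix x
    have "0 < x" if "x \<in> op_ivl D" using that by (simp add: op_ivl_def)
    then consider "x \<notin> op_ivl D" | "x \<in> op_ivl D" "z \<le> x" | "x \<in> op_ivl D" "0 < x" "x < z"
      by (meson not_le)
    then show "ennreal ((deriv g x)\<^sup>2 / p x) * indicator (op_ivl D) x \<le> ennreal ((lam * (p x * J f x))\<^sup>2 / p x) * indicator {0<..<z} x"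
    proof cases
      case 3
      define q where "q = (2 * r x * f x - (r x)\<^sup>2) / (f x)\<^sup>2"
      have fx: "0 < f x" using fpos 3 by simp
      have r0: "0 \<le> r x" by (simp add: r_def)
      have rf: "r x \<le> f x" using r_le 3 by simp
      have "0 \<le> r x * (2 * f x - r x)" using r0 rf by (intro mult_nonneg_nonneg) auto
      then have q0: "0 \<le> q" using fx by (simp add: q_def power2_eq_square algebra_simps)
      have "0 \<le> (f x - r x)\<^sup>2" by simp
      then have q1: "q \<le> 1" using fx by (simp add: q_def power2_eq_square algebra_simps divide_le_eq)
      have "deriv g x = q * - (lam * (p x * J f x))" using dg 3 by (simp add: G_def q_def)
      then have "(deriv g x)\<^sup>2 = q\<^sup>2 * (lam * (p x * J f x))\<^sup>2" by (simp add: power_mult_distrib)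
      also have "\<dots> \<le> 1 * (lam * (p x * J f x))\<^sup>2"
        using q0 q1 by (intro mult_right_mono) (auto simp: power_le_one)
      finally show ?thesis using 3 p_pos[OF op_cl[of x]] by (auto intro!: ennreal_leI divide_right_mono)
    qed (auto simp: dg G_def)
  qed
  also have "\<dots> = ennreal (lam * a2)"
    unfolding a2_def f_def by (rule sol_energy[OF z lam fz pos])
  also have "\<dots> \<le> ennreal (lam' * J (\<lambda>t. (g t)\<^sup>2) z)" by (rule ennreal_leI[OF key])
  finally have "energy (deriv g)
     \<le> ennreal (lam' * J (\<lambda>t. (g t)\<^sup>2) z)" .
  then show thesis by (intro that[OF z C1 gc g0 Qpos Q])
qed

end

section \<open>Comparison under pointwise conditions on the derivative\<close>

lemma atLeastAtMost_subset_insert_op_ivl: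
  assumes "z \<in> op_ivl D" shows "{0..z} \<subseteq> insert 0 (op_ivl D)"
proof
  fix y assume "y \<in> {0..z}"
  then show "y \<in> insert 0 (op_ivl D)"
    using assms op_ivl_below[of z D y] op_ivl_subset_cl_ivl[of D] by (cases "y = 0"; cases "y = z") auto
qed

context string
begin

text \<open>
  The single integral condition integrates to the double integral one: \<open>g x - lam * dbl g x x1\<close> is
  nondecreasing on \<open>[x0,x1]\<close> and vanishes at \<open>x1\<close>; on \<open>[0,x0]\<close> the left-hand side \<open>g\<close> is constant while
  the double integral only grows to the left.
\<close>

lemma Lam_le_of_deriv:
  assumes x: "0 \<le> x0" "x0 < x1" "x1 \<in> op_ivl D"
    and g: "continuous_on {0..x1} g" "\<And>x. x \<in> {0<..<x1} \<Longrightarrow> 0 < g x" "g x1 = 0"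
    and const: "\<And>x. x \<in> {0..x0} \<Longrightarrow> g x = g x0"
    and dg: "\<And>x. x \<in> {x0<..<x1} \<Longrightarrow> (g has_real_derivative g' x) (at x)"
    and le: "\<And>x. x \<in> {x0<..<x1} \<Longrightarrow> - g' x \<le> lam * (p x * J g x)"
    and lam: "0 \<le> lam"
  shows "Lam \<le> lam"
proof (rule Lam_le_of_subsolution[OF x(3) g(1,2)])
  have x1c: "x1 \<in> cl_ivl D" using x op_cl by auto
  have main: "g x \<le> lam * dbl g x x1" if x': "x \<in> {x0..x1}" for x
  proof (cases "x = x1")
    case False
    let ?\<psi> = "\<lambda>x. g x - lam * dbl g x x1"
    have "?\<psi> x \<le> ?\<psi> x1"
    proof (rule DERIV_nonneg_imp_increasing_open[where f="?\<psi>" and a=x and b=x1])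
      show "x \<le> x1" using x' by simp
      show "continuous_on {x..x1} ?\<psi>"
        by (intro continuous_intros continuous_on_subset[OF g(1)] continuous_on_subset[OF dbl_cont_lower[OF x1c g(1)]])
          (use x x' in auto)
      fix y assume y: "x < y" "y < x1"
      have "(?\<psi> has_real_derivative g' y - lam * - (p y * J g y)) (at y)"
        by (intro DERIV_diff DERIV_cmult dg dbl_deriv_lower[OF x1c g(1)]) (use x x' y in auto)
      moreover have "0 \<le> g' y - lam * - (p y * J g y)" using le[of y] x' y by auto
      ultimately show "\<exists>d. (?\<psi> has_real_derivative d) (at y) \<and> 0 \<le> d" by blast
    qed
    then show ?thesis using g(3) by simp
  qed (use g in simp)
  fix x assume x': "x \<in> {0<..<x1}"
  show "g x \<le> lam * dbl g x x1"
  proof (cases "x0 \<le> x")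
    case True then show ?thesis using main[of x] x' by auto
  next
    case False
    have x0c: "x0 \<in> cl_ivl D" using cl_ivl_downward[OF x1c] x by auto
    have "0 \<le> g t" if "t \<in> {0<..<x0}" for t using g(2)[of t] that x by auto
    then have "dbl g x0 x1 \<le> dbl g x x1"
      using dbl_combine[OF x1c g(1), of x x0] dbl_nonneg[OF x0c, of g x] False x' x by auto
    then have "lam * dbl g x0 x1 \<le> lam * dbl g x x1" using lam by (rule mult_left_mono)
    then show ?thesis using main[of x0] const[of x] x x' False by auto
  qed
qed

lemma Lam_ge_of_deriv:
  assumes f: "continuous_on (insert 0 (op_ivl D)) f" "\<And>x. x \<in> op_ivl D \<Longrightarrow> 0 < f x"
    and df: "\<And>x. x \<in> op_ivl D \<Longrightarrow> (f has_real_derivative f' x) (at x)"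
    and le: "\<And>x. x \<in> op_ivl D \<Longrightarrow> lam * (p x * J f x) \<le> - f' x"
  shows "lam \<le> Lam"
proof (rule Lam_ge_of_supersolution[OF f])
  fix x z assume x: "x \<in> op_ivl D" and z: "z \<in> op_ivl D" "x < z"
  have x0: "0 < x" using x by (simp add: op_ivl_def)
  have zc: "z \<in> cl_ivl D" using z op_cl by auto
  have sub: "{0..z} \<subseteq> insert 0 (op_ivl D)" by (rule atLeastAtMost_subset_insert_op_ivl[OF z(1)])
  have fc: "continuous_on {0..z} f" by (rule continuous_on_subset[OF f(1) sub])
  let ?\<psi> = "\<lambda>x. f x - lam * dbl f x z"
  have "?\<psi> z \<le> ?\<psi> x"
  proof (rule DERIV_nonpos_imp_decreasing_open[where f="?\<psi>" and a=x and b=z])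
    show "x \<le> z" using z by simp
    show "continuous_on {x..z} ?\<psi>"
      by (intro continuous_intros continuous_on_subset[OF fc] continuous_on_subset[OF dbl_cont_lower[OF zc fc]])
        (use x0 in auto)
    fix y assume y: "x < y" "y < z"
    then have yo: "y \<in> op_ivl D" using op_ivl_below[OF zc] x0 by auto
    have "(?\<psi> has_real_derivative f' y - lam * - (p y * J f y)) (at y)"
      by (intro DERIV_diff DERIV_cmult df dbl_deriv_lower[OF zc fc]) (use x0 y yo in auto)
    moreover have "f' y - lam * - (p y * J f y) \<le> 0" using le[OF yo] by simp
    ultimately show "\<exists>d. (?\<psi> has_real_derivative d) (at y) \<and> d \<le> 0" by blast
  qed
  then show "lam * dbl f x z \<le> f x" using f(2)[OF z(1)] by simp
qed

end

section \<open>Diffusion operators and their principal eigenvalue\<close>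

locale diffusion =
  fixes a b :: "real \<Rightarrow> real" and D :: ereal
  assumes D_positive: "0 < D"
    and a_meas: "set_borel_measurable borel (cl_ivl D) a"
    and a_pos: "\<And>x. x \<in> op_ivl D \<Longrightarrow> 0 < a x"
    and drift_int: "locally_integrable D (\<lambda>x. b x / a x)"
    and speed_int: "locally_integrable D (\<lambda>x. exp (Cfun a b x) / a x)"
begin

abbreviation sup_I where "sup_I f \<equiv> SUP x\<in>op_ivl D. inverse (I_op a b D f x)"
abbreviation inf_I where "inf_I f \<equiv> INF x\<in>op_ivl D. inverse (I_op a b D f x)"
abbreviation sup_II where "sup_II f \<equiv> SUP x\<in>supp D f. inverse (II_op a b D f x)"
abbreviation inf_II where "inf_II f \<equiv> INF x\<in>op_ivl D. inverse (II_op a b D f x)"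
abbreviation sup_R where "sup_R h \<equiv> SUP x\<in>op_ivl D. ereal (R_op a b h x)"
abbreviation inf_R where "inf_R h \<equiv> INF x\<in>op_ivl D. ereal (R_op a b h x)"

definition pC :: "real \<Rightarrow> real" where "pC x = exp (- Cfun a b x)"
definition mC :: "real \<Rightarrow> real" where "mC x = exp (Cfun a b x) / a x * indicator (op_ivl D) x"

lemma set_integrable_initial:
  assumes "locally_integrable D g" "x \<in> cl_ivl D"
  shows "set_integrable lborel {0..x} g"
  using assms atLeastAtMost_subset_cl_ivl[of x D] unfolding locally_integrable_def by auto

lemma Cfun_eq: "x \<in> cl_ivl D \<Longrightarrow> Cfun a b x = integral {0..x} (\<lambda>u. b u / a u)"
  unfolding Cfun_def by (rule set_borel_integral_eq_integral(2)[OF set_integrable_initial[OF drift_int]])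

lemma Cfun_cont: "continuous_on (cl_ivl D) (Cfun a b)"
proof (rule continuous_on_cl_ivl)
  fix x assume x: "x \<in> cl_ivl D"
  have "continuous_on {0..x} (\<lambda>x. integral {0..x} (\<lambda>u. b u / a u))"
    by (rule indefinite_integral_continuous_1, rule set_borel_integral_eq_integral(1)[OF set_integrable_initial[OF drift_int x]])
  then show "continuous_on {0..x} (Cfun a b)"
    by (rule continuous_on_eq) (use x Cfun_eq cl_ivl_downward in auto)
qed

lemma a_meas_op: "(\<lambda>x. indicator (op_ivl D) x *\<^sub>R a x) \<in> borel_measurable borel"
proof -
  have "(\<lambda>x. indicator (op_ivl D) x *\<^sub>R (indicator (cl_ivl D) x *\<^sub>R a x)) \<in> borel_measurable borel"
    by (rule borel_measurable_scaleR[OF _ a_meas[unfolded set_borel_measurable_def]]) simp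
  also have "(\<lambda>x. indicator (op_ivl D) x *\<^sub>R (indicator (cl_ivl D) x *\<^sub>R a x)) = (\<lambda>x. indicator (op_ivl D) x *\<^sub>R a x)"
    using op_cl by (auto simp: fun_eq_iff split: split_indicator)
  finally show ?thesis .
qed

sublocale string D pC mC
proof
  show "0 < D" by (rule D_positive)
  show "continuous_on (cl_ivl D) pC" unfolding pC_def by (intro continuous_intros Cfun_cont)
  show "0 < pC x" for x by (simp add: pC_def)
  have "(\<lambda>x. indicator (op_ivl D) x *\<^sub>R exp (Cfun a b x)) \<in> borel_measurable borel"
    by (rule borel_measurable_continuous_on_indicator)
      (auto intro!: continuous_intros continuous_on_subset[OF Cfun_cont op_ivl_subset_cl_ivl])
  then have "(\<lambda>x. (indicator (op_ivl D) x *\<^sub>R exp (Cfun a b x)) / (indicator (op_ivl D) x *\<^sub>R a x)) \<in> borel_measurable borel"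
    using a_meas_op by (rule borel_measurable_divide)
  also have "(\<lambda>x. (indicator (op_ivl D) x *\<^sub>R exp (Cfun a b x)) / (indicator (op_ivl D) x *\<^sub>R a x)) = mC"
    by (auto simp: fun_eq_iff mC_def split: split_indicator)
  finally show m: "mC \<in> borel_measurable borel" .
  show "0 < mC x" if "x \<in> op_ivl D" for x using a_pos[OF that] that by (simp add: mC_def)
  show "mC x = 0" if "x \<notin> op_ivl D" for x using that by (simp add: mC_def)
  show "mC absolutely_integrable_on {0..x}" if x: "x \<in> cl_ivl D" for x
  proof -
    have "set_integrable lborel ({0..x} \<inter> op_ivl D) (\<lambda>x. exp (Cfun a b x) / a x)"
      by (rule set_integrable_subset[OF set_integrable_initial[OF speed_int x]]) auto
    moreover have "(\<lambda>t. indicator ({0..x} \<inter> op_ivl D) t *\<^sub>R (exp (Cfun a b t) / a t)) = (\<lambda>t. indicator {0..x} t *\<^sub>R mC t)"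
      by (auto simp: fun_eq_iff mC_def split: split_indicator)
    ultimately have "integrable lborel (\<lambda>t. indicator {0..x} t *\<^sub>R mC t)" by (simp add: set_integrable_def)
    moreover have "(\<lambda>t. indicator {0..x} t *\<^sub>R mC t) \<in> borel_measurable lborel" using m by measurable
    ultimately show ?thesis unfolding set_integrable_def by (subst integrable_completion) auto
  qed
qed

lemma mu_eq: "mu a b D = density lborel (\<lambda>x. ennreal (mC x))"
  unfolding mu_def mC_def by (rule arg_cong[where f="density lborel"]) (auto simp: fun_eq_iff split: split_indicator)

lemma pC_meas: "(\<lambda>x. indicator (op_ivl D) x *\<^sub>R pC x) \<in> borel_measurable borel"
  by (rule borel_measurable_continuous_on_indicator)
    (auto intro: continuous_on_subset[OF p_cont op_ivl_subset_cl_ivl])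

lemma nu_eq: "nu a b D = density lborel (\<lambda>x. ennreal (indicator (op_ivl D) x *\<^sub>R pC x))"
  unfolding nu_def pC_def by (rule arg_cong[where f="density lborel"]) (auto simp: fun_eq_iff split: split_indicator)

lemma LINT_mu:
  assumes x: "x \<in> cl_ivl D" and f: "continuous_on {0..x} f"
  shows "(LINT t:{0..x}|mu a b D. f t) = J f x"
proof -
  have fm: "(\<lambda>t. indicator {0..x} t *\<^sub>R f t) \<in> borel_measurable lborel"
    using borel_measurable_continuous_on_indicator[OF _ f] by simp
  have "(LINT t:{0..x}|mu a b D. f t) = (LINT t|lborel. mC t *\<^sub>R (indicator {0..x} t *\<^sub>R f t))"
    unfolding mu_eq set_lebesgue_integral_def
    by (rule integral_density[OF fm]) (use m_nonneg in auto)
  also have "\<dots> = (LINT t:{0..x}|lborel. mC t * f t)"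
    unfolding set_lebesgue_integral_def by (rule Bochner_Integration.integral_cong) (auto simp: mult_ac)
  also have "\<dots> = integral {0..x} (\<lambda>t. mC t * f t)"
  proof (rule set_borel_integral_eq_integral(2))
    have "(\<lambda>t. mC t *\<^sub>R (indicator {0..x} t *\<^sub>R f t)) \<in> borel_measurable lborel"
      by (rule borel_measurable_scaleR[OF _ fm]) simp
    then have "(\<lambda>t. indicator {0..x} t *\<^sub>R (mC t * f t)) \<in> borel_measurable lborel"
      by (simp add: mult_ac)
    then show "set_integrable lborel {0..x} (\<lambda>t. mC t * f t)"
      using speed_mult_absolutely_integrable[OF x f] unfolding set_integrable_def by (subst (asm) integrable_completion) auto
  qed
  finally show ?thesis by (simp add: J_def)
qed

lemma nn_integral_mu:
  assumes "(\<lambda>x. indicator (op_ivl D) x *\<^sub>R h x) \<in> borel_measurable borel"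
  shows "(\<integral>\<^sup>+x\<in>op_ivl D. ennreal (h x) \<partial>mu a b D) = (\<integral>\<^sup>+x. ennreal (mC x * h x) * indicator (op_ivl D) x \<partial>lborel)"
proof -
  have "(\<lambda>x. ennreal (h x) * indicator (op_ivl D) x) \<in> borel_measurable lborel"
    by (rule ennreal_indicator_measurable[OF assms])
  then have "(\<integral>\<^sup>+x\<in>op_ivl D. ennreal (h x) \<partial>mu a b D) = (\<integral>\<^sup>+x. ennreal (mC x) * (ennreal (h x) * indicator (op_ivl D) x) \<partial>lborel)"
    unfolding mu_eq by (intro nn_integral_density) auto
  also have "\<dots> = (\<integral>\<^sup>+x. ennreal (mC x * h x) * indicator (op_ivl D) x \<partial>lborel)"
    using m_nonneg by (intro nn_integral_cong) (auto simp: ennreal_mult' split: split_indicator)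
  finally show ?thesis .
qed

lemma nn_integral_mu_sq:
  assumes "continuous_on (op_ivl D) g"
  shows "(\<integral>\<^sup>+x\<in>op_ivl D. ennreal ((g x)\<^sup>2) \<partial>mu a b D) = mass_sq g"
  by (rule nn_integral_mu, rule borel_measurable_continuous_on_indicator) (auto intro!: continuous_intros assms)

lemma Dform_eq:
  assumes "continuous_on (op_ivl D) (deriv g)"
  shows "Dform a b D g = energy (deriv g)"
proof -
  have "(\<lambda>x. indicator (op_ivl D) x *\<^sub>R (deriv g x)\<^sup>2) \<in> borel_measurable borel"
    by (rule borel_measurable_continuous_on_indicator) (auto intro!: continuous_intros assms)
  then have "(\<lambda>x. (indicator (op_ivl D) x *\<^sub>R a x) * (indicator (op_ivl D) x *\<^sub>R (deriv g x)\<^sup>2)) \<in> borel_measurable borel"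
    using a_meas_op by (intro borel_measurable_times)
  also have "(\<lambda>x. (indicator (op_ivl D) x *\<^sub>R a x) * (indicator (op_ivl D) x *\<^sub>R (deriv g x)\<^sup>2)) = (\<lambda>x. indicator (op_ivl D) x *\<^sub>R (a x * (deriv g x)\<^sup>2))"
    by (auto simp: fun_eq_iff split: split_indicator)
  finally have "Dform a b D g = (\<integral>\<^sup>+x. ennreal (mC x * (a x * (deriv g x)\<^sup>2)) * indicator (op_ivl D) x \<partial>lborel)"
    unfolding Dform_def by (rule nn_integral_mu)
  also have "\<dots> = energy (deriv g)"
  proof (rule nn_integral_cong)
    fix x
    show "ennreal (mC x * (a x * (deriv g x)\<^sup>2)) * indicator (op_ivl D) x = ennreal ((deriv g x)\<^sup>2 / pC x) * indicator (op_ivl D) x"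
      using a_pos[of x] by (auto simp: mC_def pC_def exp_minus field_simps split: split_indicator)
  qed
  finally show ?thesis .
qed

text \<open>
  The boundary condition of a test function in a form common to both kinds of endpoint: along some
  sequence that tends to \<open>D\<close> the function tends to \<open>0\<close>. For \<open>D = \<infinity>\<close> this is compactness of the
  support, for \<open>D < \<infinity>\<close> continuity at \<open>D\<close>.
\<close>

lemma exhausting_sequence:
  assumes g: "continuous_on (cl_ivl D) g" "compact (closure (supp D g))" "\<And>d. D = ereal d \<Longrightarrow> g d = 0"
  obtains Z where "\<And>n. Z n \<in> op_ivl D" "\<And>x. x \<in> op_ivl D \<Longrightarrow> \<forall>\<^sub>F n in sequentially. x < Z n"
    "(\<lambda>n. g (Z n)) \<longlonglongrightarrow> (0::real)"
proof (cases D)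
  case (real d)
  have d: "0 < d" using D_positive real by (simp add: zero_ereal_def)
  define Z where "Z n = d * (1 - inverse (real (Suc (Suc n))))" for n
  have Zop: "Z n \<in> op_ivl D" for n
    using d real by (auto simp: Z_def field_simps intro: add_pos_nonneg)
  have "(\<lambda>n. inverse (real (Suc (Suc n)))) \<longlonglongrightarrow> 0"
    using LIMSEQ_Suc[OF LIMSEQ_inverse_real_of_nat] by simp
  then have "Z \<longlonglongrightarrow> d * (1 - 0)" unfolding Z_def by (intro tendsto_intros)
  then have Zd: "Z \<longlonglongrightarrow> d" by simp
  have ev: "\<forall>\<^sub>F n in sequentially. x < Z n" if "x \<in> op_ivl D" for x
    using order_tendstoD(1)[OF Zd, of x] that real by simp
  have "(\<lambda>n. g (Z n)) \<longlonglongrightarrow> g d"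
    by (rule continuous_on_tendsto_compose[OF g(1) Zd])
      (use real d Zop op_cl in \<open>auto intro!: always_eventually less_imp_le\<close>)
  then show ?thesis using that[of Z] Zop ev g(3)[OF real] by simp
next
  case PInf
  have "bounded (supp D g)" using g(2) by (simp add: compact_closure)
  then obtain B where B: "\<And>x. x \<in> supp D g \<Longrightarrow> \<bar>x\<bar> \<le> B" by (auto simp: bounded_iff)
  have "g x = 0" if "B < x" "0 \<le> x" for x
    using B[of x] that PInf by (auto simp: supp_def)
  moreover have ev: "\<forall>\<^sub>F n in sequentially. x < real (Suc n)" for x
  proof -
    obtain N where "x < real N" using reals_Archimedean2 by blast
    then show ?thesis unfolding eventually_sequentially by (intro exI[of _ N]) auto
  qed
  ultimately have "\<forall>\<^sub>F n in sequentially. g (real (Suc n)) = 0"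
    by (intro eventually_mono[OF ev[of B]]) auto
  then have "(\<lambda>n. g (real (Suc n))) \<longlonglongrightarrow> 0" by (rule tendsto_eventually)
  then show ?thesis using that[of "\<lambda>n. real (Suc n)"] ev PInf by auto
next
  case MInf then show ?thesis using D_positive by simp
qed

text \<open>
  The lower bound is \<open>energy_ge_Lam\<close> along an exhausting sequence. For the upper bound the functions
  of \<open>test_function\<close> are normalized to \<open>\<mu>(g\<^sup>2) = 1\<close>.
\<close>

lemma lambda0_eq_Lam: "lambda0 a b D = ereal Lam"
proof (rule antisym)
  show "ereal Lam \<le> lambda0 a b D"
    unfolding lambda0_def
  proof (rule INF_greatest)
    fix g assume "g \<in> {f \<in> C_K D. (\<integral>\<^sup>+x\<in>op_ivl D. ennreal ((f x)\<^sup>2) \<partial>mu a b D) = 1 \<and>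
                        (\<forall>d. D = ereal d \<longrightarrow> f d = 0)}"
    then have g: "C1_on (op_ivl D) g" "continuous_on (cl_ivl D) g" "compact (closure (supp D g))"
       and one: "(\<integral>\<^sup>+x\<in>op_ivl D. ennreal ((g x)\<^sup>2) \<partial>mu a b D) = 1" and gd: "\<And>d. D = ereal d \<Longrightarrow> g d = 0"
      by (auto simp: C_K_def)
    obtain Z where Z: "\<And>n. Z n \<in> op_ivl D" "\<And>x. x \<in> op_ivl D \<Longrightarrow> \<forall>\<^sub>F n in sequentially. x < Z n"
        "(\<lambda>n. g (Z n)) \<longlonglongrightarrow> (0::real)"
      using exhausting_sequence[OF g(2,3) gd] by blast
    have dg: "(g has_real_derivative deriv g x) (at x)" if "x \<in> op_ivl D" for x
      using g(1) that by (simp add: C1_on_def DERIV_deriv_iff_real_differentiable)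
    have dc: "continuous_on (op_ivl D) (deriv g)" using g(1) by (simp add: C1_on_def)
    have "ennreal Lam \<le> Dform a b D g"
      using energy_ge_Lam[OF g(2) dg dc Z]
        nn_integral_mu_sq[OF continuous_on_subset[OF g(2) op_ivl_subset_cl_ivl]] one Dform_eq[OF dc]
      by simp
    then show "ereal Lam \<le> enn2ereal (Dform a b D g)"
      using Lam_nonneg by (simp add: less_eq_ennreal.rep_eq)
  qed
  show "lambda0 a b D \<le> ereal Lam"
  proof (rule ccontr)
    assume "\<not> lambda0 a b D \<le> ereal Lam"
    then obtain lam where lam: "Lam < lam" "ereal lam < lambda0 a b D"
      using ereal_dense2[of "ereal Lam" "lambda0 a b D"] by (auto simp: not_le)
    obtain g z where z: "z \<in> op_ivl D" and g: "C1_on (op_ivl D) g" "continuous_on (cl_ivl D) g"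
      "\<And>x. z \<le> x \<Longrightarrow> g x = 0" and Qpos: "0 < J (\<lambda>t. (g t)\<^sup>2) z"
      and Q: "mass_sq g = ennreal (J (\<lambda>t. (g t)\<^sup>2) z)"
      and E: "energy (deriv g) \<le> ennreal (lam * J (\<lambda>t. (g t)\<^sup>2) z)"
      using test_function[OF lam(1)] by blast
    define q where "q = J (\<lambda>t. (g t)\<^sup>2) z"
    define c where "c = 1 / sqrt q"
    have q: "0 < q" using Qpos by (simp add: q_def)
    have c2: "c\<^sup>2 = 1 / q" using q by (simp add: c_def power_divide)
    define h where "h x = c * g x" for x
    have gop: "continuous_on (op_ivl D) g" by (rule continuous_on_subset[OF g(2) op_ivl_subset_cl_ivl])
    have dc: "continuous_on (op_ivl D) (deriv g)" using g(1) by (simp add: C1_on_def)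
    have dh: "(h has_real_derivative c * deriv g x) (at x)" if "x \<in> op_ivl D" for x
      unfolding h_def using g(1) that
      by (intro DERIV_cmult) (simp add: C1_on_def DERIV_deriv_iff_real_differentiable)
    have deriv_h: "deriv h x = c * deriv g x" if "x \<in> op_ivl D" for x by (rule DERIV_imp_deriv[OF dh[OF that]])
    have dhc: "continuous_on (op_ivl D) (deriv h)"
      by (rule continuous_on_eq[of _ "\<lambda>x. c * deriv g x"]) (auto intro!: continuous_intros dc simp: deriv_h)
    have C1: "C1_on (op_ivl D) h"
      using dh dhc by (auto simp: C1_on_def real_differentiable_def)
    have "supp D h \<subseteq> {0..z}"
    proof
      fix x assume "x \<in> supp D h"
      then have "0 \<le> x" "h x \<noteq> 0" by (auto simp: supp_def cl_ivl_def)
      then show "x \<in> {0..z}" using g(3)[of x] by (cases "z \<le> x") (auto simp: h_def)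
    qed
    then have "bounded (supp D h)" using bounded_subset[OF bounded_closed_interval] by blast
    then have CK: "h \<in> C_K D"
      using C1 g(2) by (auto simp: C_K_def compact_closure h_def intro!: continuous_intros)
    have "mass_sq h = (\<integral>\<^sup>+x. ennreal (1 / q) * (ennreal (mC x * (g x)\<^sup>2) * indicator (op_ivl D) x) \<partial>lborel)"
      using q m_nonneg by (intro nn_integral_cong)
        (auto simp: h_def power_mult_distrib c2 ennreal_mult'[symmetric] split: split_indicator)
    also have "\<dots> = ennreal (1 / q) * mass_sq g"
    proof (rule nn_integral_cmult)
      have "(\<lambda>x. mC x * (indicator (op_ivl D) x *\<^sub>R (g x)\<^sup>2)) \<in> borel_measurable borel"
        by (intro borel_measurable_times m_meas borel_measurable_continuous_on_indicator continuous_intros gop) simp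
      then show "(\<lambda>x. ennreal (mC x * (g x)\<^sup>2) * indicator (op_ivl D) x) \<in> borel_measurable lborel"
        by (intro ennreal_indicator_measurable) (simp add: mult.left_commute)
    qed
    also have "\<dots> = 1" unfolding Q q_def[symmetric] using q by (simp add: ennreal_mult'[symmetric])
    finally have one: "(\<integral>\<^sup>+x\<in>op_ivl D. ennreal ((h x)\<^sup>2) \<partial>mu a b D) = 1"
      using nn_integral_mu_sq[of h] gop by (simp add: h_def continuous_on_mult_left)
    have "Dform a b D h = energy (deriv h)"
      by (rule Dform_eq[OF dhc])
    also have "\<dots> = (\<integral>\<^sup>+x. ennreal (1 / q) * (ennreal ((deriv g x)\<^sup>2 / pC x) * indicator (op_ivl D) x) \<partial>lborel)"
    proof (intro nn_integral_cong)
      fix x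
      show "ennreal ((deriv h x)\<^sup>2 / pC x) * indicator (op_ivl D) x = ennreal (1 / q) * (ennreal ((deriv g x)\<^sup>2 / pC x) * indicator (op_ivl D) x)"
        using q by (cases "x \<in> op_ivl D")
          (auto simp: deriv_h power_mult_distrib c2 pC_def ennreal_mult'[symmetric])
    qed
    also have "\<dots> = ennreal (1 / q) * energy (deriv g)"
    proof (rule nn_integral_cmult)
      show "(\<lambda>x. ennreal ((deriv g x)\<^sup>2 / pC x) * indicator (op_ivl D) x) \<in> borel_measurable lborel"
        by (intro ennreal_indicator_measurable_continuous continuous_intros dc
              continuous_on_subset[OF p_cont op_ivl_subset_cl_ivl]) (auto simp: pC_def)
    qed
    also have "\<dots> \<le> ennreal (1 / q) * ennreal (lam * q)"
      using E unfolding q_def[symmetric] by (rule mult_left_mono) simp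
    also have "\<dots> = ennreal lam" using q by (simp add: ennreal_mult'[symmetric])
    finally have "enn2ereal (Dform a b D h) \<le> enn2ereal (ennreal lam)" by (simp add: less_eq_ennreal.rep_eq)
    also have "\<dots> = ereal lam" using lam Lam_nonneg by simp
    finally have "enn2ereal (Dform a b D h) \<le> ereal lam" .
    moreover have "lambda0 a b D \<le> enn2ereal (Dform a b D h)"
      unfolding lambda0_def using CK one z g(3) by (intro INF_lower) (auto simp: h_def)
    ultimately show False using lam(2) by simp
  qed
qed

end

section \<open>The single integral form\<close>

text \<open>
  The extremal values are extended reals. Comparing them with \<open>Lam\<close> through the reals beyond them
  keeps the estimates themselves in the real numbers.
\<close>

lemma ereal_le_by_density:
  assumes "\<And>l. S < ereal l \<Longrightarrow> L \<le> l" shows "ereal L \<le> S"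
proof (rule ccontr)
  assume "\<not> ereal L \<le> S"
  then obtain l where "S < ereal l" "l < L"
    using ereal_dense2[of S "ereal L"] by (auto simp: not_le)
  with assms[of l] show False by simp
qed

lemma ereal_ge_by_density:
  assumes "\<And>l. ereal l < S \<Longrightarrow> l \<le> L" shows "S \<le> ereal L"
proof (rule ccontr)
  assume "\<not> S \<le> ereal L"
  then obtain l where "L < l" "ereal l < S"
    using ereal_dense2[of "ereal L" S] by (auto simp: not_le)
  with assms[of l] show False by simp
qed

lemma inverse_ereal_pos: "0 < v \<Longrightarrow> inverse (ereal v) = ereal (1 / v)"
  by (simp add: inverse_eq_divide)

context string
begin

lemma nn_integral_dbl:
  assumes "z \<in> cl_ivl D" "continuous_on {0..z} f" "0 \<le> x" "\<And>t. t \<in> {0<..<z} \<Longrightarrow> 0 \<le> f t"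
  shows "(\<integral>\<^sup>+s. ennreal (p s * J f s) * indicator {x<..<z} s \<partial>lborel) = ennreal (dbl f x z)"
proof -
  have "(\<integral>\<^sup>+s. ennreal (p s * J f s) * indicator {x<..<z} s \<partial>lborel) = (\<integral>\<^sup>+s. ennreal (p s * J f s) * indicator {x..z} s \<partial>lborel)"
    by (rule nn_integral_Ioo_eq_Icc)
  also have "\<dots> = ennreal (dbl f x z)"
    unfolding dbl_def
  proof (rule nn_integral_has_integral_lebesgue')
    fix s assume s: "s \<in> {x..z}"
    then have sc: "s \<in> cl_ivl D" using cl_ivl_downward assms by auto
    moreover have "0 \<le> J f s" by (rule J_nonneg[OF _ sc]) (use assms s in auto)
    ultimately show "0 \<le> p s * J f s" using p_pos by (simp add: less_imp_le)
  qed (intro integrable_integral pJ_int[OF assms(1,2)], use assms in auto)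
  finally show ?thesis .
qed

text \<open>
  The minimizing functions for the upper estimates: solutions for parameters beyond \<open>Lam\<close>, cut off
  at their first zero \<open>z\<close>.
\<close>

definition cut_sol :: "real \<Rightarrow> real \<Rightarrow> real \<Rightarrow> real" where
  "cut_sol lam z x = (if x < z then sol lam x else 0)"

lemma cut_cont:
  assumes "z \<in> cl_ivl D" "sol lam z = 0"
  shows "continuous_on {0..z} (cut_sol lam z)"
  by (rule continuous_on_eq[OF sol_cont[OF assms(1), of lam]]) (use assms in \<open>auto simp: cut_sol_def\<close>)

lemma J_cut: "x \<le> z \<Longrightarrow> sol lam z = 0 \<Longrightarrow> J (cut_sol lam z) x = J (sol lam) x"
  by (rule J_cong) (auto simp: cut_sol_def not_less dest: order_trans antisym)

lemma cut_deriv: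
  assumes "z \<in> cl_ivl D" "0 < x" "x < z"
  shows "(cut_sol lam z has_real_derivative - (lam * (p x * J (sol lam) x))) (at x)"
  by (rule has_field_derivative_transform_within_open[OF sol_deriv, where S="{0<..<z}"])
    (use assms op_ivl_below[OF assms(1)] in \<open>auto simp: cut_sol_def\<close>)

text \<open>
  At \<open>z\<close> itself the derivative from the right decides, so that the value of the single integral
  operator is \<open>\<infinity>\<close> there as well.
\<close>

lemma cut_deriv_beyond:
  assumes "z \<le> x" "(cut_sol lam z has_real_derivative l) (at x)"
  shows "l = 0"
proof (rule vector_derivative_unique_within)
  show "at x within {x..} \<noteq> bot" by (simp add: at_within_Ici_at_right)
  show "(cut_sol lam z has_vector_derivative l) (at x within {x..})"
    using assms(2) by (simp add: has_real_derivative_iff_has_vector_derivative has_vector_derivative_at_within)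
  show "(cut_sol lam z has_vector_derivative 0) (at x within {x..})"
    by (rule has_vector_derivative_transform[of x _ _ "\<lambda>_. 0"]) (use assms(1) in \<open>auto simp: cut_sol_def\<close>)
qed

end

context diffusion
begin

lemma I_op_eq:
  assumes "x \<in> op_ivl D" "(f has_real_derivative f') (at x)" "f' \<noteq> 0" "continuous_on {0..x} f"
  shows "I_op a b D f x = ereal (pC x * J f x / - f')"
  using assms LINT_mu[OF op_cl[OF assms(1)] assms(4)] DERIV_imp_deriv[OF assms(2)]
  by (auto simp: I_op_def pC_def real_differentiable_def)

lemma Lam_le_SUP_I:
  assumes "f \<in> Ft_I D"
  shows "ereal Lam \<le> sup_I f"
proof (rule ereal_le_by_density)
  fix lam assume lam: "sup_I f < ereal lam"
  obtain x0 x1 where x: "0 \<le> x0" "x0 < x1" "ereal x1 < D" and C1: "C1_on {x0<..<x1} f"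
    and c: "continuous_on {x0..x1} f" and neg: "\<And>x. x \<in> {x0<..<x1} \<Longrightarrow> deriv f x < 0"
    and eq: "\<And>x. x \<in> cl_ivl D \<Longrightarrow> f x = f (max x x0) * indicator {0..<x1} x"
    using assms unfolding Ft_I_def by blast
  have x1: "x1 \<in> op_ivl D" using x by (simp add: op_ivl_def)
  then have x1c: "x1 \<in> cl_ivl D" by (rule op_cl)
  have f1: "f x1 = 0" using eq[OF x1c] by simp
  have fmax: "f x = f (max x x0)" if "x \<in> {0..x1}" for x
    using eq[OF cl_ivl_downward[OF x1c, of x]] that f1 x by (cases "x = x1") auto
  have fc: "continuous_on {0..x1} f"
  proof (rule continuous_on_eq)
    show "continuous_on {0..x1} (\<lambda>x. f (max x x0))"
      by (rule continuous_on_compose2[OF c]) (use x in \<open>auto intro!: continuous_intros\<close>)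
  qed (use fmax in auto)
  have df: "(f has_real_derivative deriv f x) (at x)" if "x \<in> {x0<..<x1}" for x
    using C1 that by (simp add: C1_on_def DERIV_deriv_iff_real_differentiable)
  have pos': "0 < f x" if "x \<in> {x0..<x1}" for x
  proof -
    have "f x1 < f x"
      by (rule DERIV_neg_imp_decreasing_open[where f=f and a=x and b=x1])
        (use that df neg continuous_on_subset[OF c, of "{x..x1}"] in \<open>force+\<close>)
    with f1 show ?thesis by simp
  qed
  have pos: "0 < f x" if "x \<in> {0<..<x1}" for x
    using fmax[of x] pos'[of "max x x0"] that x by auto
  have le: "- deriv f x \<le> lam * (pC x * J f x) \<and> 0 < lam" if xx: "x \<in> {x0<..<x1}" for x
  proof -
    have xo: "x \<in> op_ivl D" using op_ivl_below[OF x1c, of x] xx x by auto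
    have Jx: "0 < J f x"
      by (rule J_pos[OF op_cl[OF xo]]) (use xx x pos continuous_on_subset[OF fc, of "{0..x}"] in auto)
    have I: "I_op a b D f x = ereal (pC x * J f x / - deriv f x)"
      by (rule I_op_eq[OF xo df[OF xx]]) (use neg[OF xx] xx x continuous_on_subset[OF fc, of "{0..x}"] in auto)
    have v: "0 < pC x * J f x / - deriv f x"
      using p_pos[OF op_cl[OF xo]] Jx neg[OF xx] by (intro divide_pos_pos mult_pos_pos) auto
    have "inverse (I_op a b D f x) \<le> sup_I f"
      by (rule SUP_upper[OF xo])
    then have "inverse (I_op a b D f x) < ereal lam" using lam by (rule le_less_trans)
    then have *: "1 / (pC x * J f x / - deriv f x) < lam" unfolding I inverse_ereal_pos[OF v] by simp
    have "0 < 1 / (pC x * J f x / - deriv f x)" using v by (rule divide_pos_pos[OF zero_less_one])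
    with * have "0 < lam" by linarith
    moreover have "- deriv f x \<le> lam * (pC x * J f x)"
      using * p_pos[OF op_cl[OF xo]] Jx neg[OF xx] by (simp add: field_simps)
    ultimately show ?thesis by simp
  qed
  have "0 \<le> lam" using le[of "(x0 + x1) / 2"] x by auto
  show "Lam \<le> lam"
  proof (rule Lam_le_of_deriv[OF x(1,2) x1 fc pos f1 _ df])
    show "f x = f x0" if "x \<in> {0..x0}" for x using fmax[of x] that x by (auto simp: max_def)
  qed (use le \<open>0 \<le> lam\<close> in auto)
qed

text \<open>
  For \<open>cut_sol lam z\<close> the single integral operator is constantly \<open>1 / lam\<close> on \<open>(0,z)\<close>.
\<close>

lemma SUP_I_le:
  assumes "Lam < lam"
  shows "\<exists>f\<in>Ft_I D. sup_I f \<le> ereal lam"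
proof -
  have lam: "0 < lam" using assms Lam_nonneg by simp
  obtain z where z: "z \<in> op_ivl D" "sol lam z = 0" "\<And>t. t \<in> {0..<z} \<Longrightarrow> 0 < sol lam t"
    using sol_above_Lam[OF assms] by blast
  have zc: "z \<in> cl_ivl D" and z0: "0 < z" using z op_cl by (auto simp: op_ivl_def)
  let ?f = "cut_sol lam z"
  have fc: "continuous_on {0..z} ?f" by (rule cut_cont[OF zc z(2)])
  have df: "(?f has_real_derivative - (lam * (pC x * J (sol lam) x))) (at x)" if "x \<in> {0<..<z}" for x
    using cut_deriv[OF zc] that by auto
  have Jp: "0 < J (sol lam) x" if "x \<in> {0<..<z}" for x
    using that cl_ivl_downward[OF zc, of x] z(3) by (intro J_pos sol_cont) auto
  have neg: "- (lam * (pC x * J (sol lam) x)) < 0" if "x \<in> {0<..<z}" for x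
    using lam Jp[OF that] p_pos[OF cl_ivl_downward[OF zc, of x]] that by auto
  have dc: "continuous_on {0<..<z} (deriv ?f)"
  proof (rule continuous_on_eq)
    show "continuous_on {0<..<z} (\<lambda>x. - (lam * (pC x * J (sol lam) x)))"
      by (intro continuous_intros continuous_on_subset[OF pJ_cont[OF zc sol_cont[OF zc]]]) auto
  qed (use DERIV_imp_deriv[OF df] in auto)
  have "?f \<in> Ft_I D"
    unfolding Ft_I_def
  proof (intro CollectI exI conjI ballI)
    show "ereal z < D" using z by (simp add: op_ivl_def)
    show "C1_on {0<..<z} ?f" using df dc unfolding C1_on_def real_differentiable_def by blast
    show "deriv ?f x < 0" if "x \<in> {0<..<z}" for x using DERIV_imp_deriv[OF df[OF that]] neg[OF that] by simp
    show "?f x = ?f (max x 0) * indicator {0..<z} x" if "x \<in> cl_ivl D" for x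
      using that by (auto simp: cut_sol_def cl_ivl_def max_def split: split_indicator)
  qed (use z0 fc in auto)
  moreover have "(SUP x\<in>op_ivl D. inverse (I_op a b D ?f x)) \<le> ereal lam"
  proof (rule SUP_least)
    fix x assume x: "x \<in> op_ivl D"
    show "inverse (I_op a b D ?f x) \<le> ereal lam"
    proof (cases "x < z")
      case True
      then have xz: "x \<in> {0<..<z}" using x by (simp add: op_ivl_def)
      have "I_op a b D ?f x = ereal (pC x * J ?f x / - (- (lam * (pC x * J (sol lam) x))))"
        by (rule I_op_eq[OF x df[OF xz]]) (use neg[OF xz] True continuous_on_subset[OF fc, of "{0..x}"] in auto)
      also have "\<dots> = ereal (1 / lam)"
        using Jp[OF xz] p_pos[OF op_cl[OF x]] True z by (simp add: J_cut)
      finally show ?thesis using lam by simp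
    next
      case False
      have "\<not> (?f differentiable (at x) \<and> deriv ?f x \<noteq> 0)"
        using cut_deriv_beyond[of z x lam] False DERIV_deriv_iff_real_differentiable[of ?f x] by auto
      then have "I_op a b D ?f x = \<infinity>" by (simp add: I_op_def)
      then show ?thesis using lam by simp
    qed
  qed
  ultimately show ?thesis by blast
qed

lemma F_I_facts:
  assumes "f \<in> F_I D" "x \<in> op_ivl D"
  shows "(f has_real_derivative deriv f x) (at x)" "deriv f x < 0" "0 < J f x" "0 < pC x"
    "I_op a b D f x = ereal (pC x * J f x / - deriv f x)" "0 < pC x * J f x / - deriv f x"
proof -
  show df: "(f has_real_derivative deriv f x) (at x)"
    using assms by (simp add: F_I_def C1_on_def DERIV_deriv_iff_real_differentiable)
  show neg: "deriv f x < 0" using assms by (simp add: F_I_def)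
  have c: "continuous_on {0..x} f"
    using assms atLeastAtMost_subset_cl_ivl[OF op_cl[OF assms(2)]]
    by (auto simp: F_I_def intro: continuous_on_subset)
  show J: "0 < J f x"
    by (rule J_pos[OF op_cl[OF assms(2)] _ c])
      (use assms op_ivl_below[OF op_cl[OF assms(2)]] in \<open>auto simp: F_I_def op_ivl_def\<close>)
  show p: "0 < pC x" using p_pos op_cl assms by auto
  show "I_op a b D f x = ereal (pC x * J f x / - deriv f x)"
    by (rule I_op_eq[OF assms(2) df _ c]) (use neg in simp)
  show "0 < pC x * J f x / - deriv f x"
    using p J neg by (intro divide_pos_pos mult_pos_pos) auto
qed

lemma INF_I_le_Lam:
  assumes f: "f \<in> F_I D"
  shows "inf_I f \<le> ereal Lam"
proof (rule ereal_ge_by_density)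
  fix lam assume lam: "ereal lam < inf_I f"
  show "lam \<le> Lam"
  proof (rule Lam_ge_of_deriv)
    show "continuous_on (insert 0 (op_ivl D)) f"
      using f cl_ivl_zero[OF D_positive] op_ivl_subset_cl_ivl[of D] by (auto simp: F_I_def intro: continuous_on_subset)
    show "0 < f x" if "x \<in> op_ivl D" for x using f that by (simp add: F_I_def)
    show "(f has_real_derivative deriv f x) (at x)" if "x \<in> op_ivl D" for x by (rule F_I_facts(1)[OF f that])
    show "lam * (pC x * J f x) \<le> - deriv f x" if x: "x \<in> op_ivl D" for x
    proof -
      note F = F_I_facts[OF f x]
      have "inf_I f \<le> inverse (I_op a b D f x)"
        by (rule INF_lower[OF x])
      with lam have "ereal lam < inverse (I_op a b D f x)" by (rule less_le_trans)
      then have "lam < 1 / (pC x * J f x / - deriv f x)" unfolding F(5) inverse_ereal_pos[OF F(6)] by simp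
      then show ?thesis using F(2,3,4) by (simp add: field_simps)
    qed
  qed
qed

lemma sol_in_C1:
  "C1_on (op_ivl D) (sol lam)" "x \<in> op_ivl D \<Longrightarrow> deriv (sol lam) x = - (lam * (pC x * J (sol lam) x))"
proof -
  have d: "deriv (sol lam) x = - (lam * (pC x * J (sol lam) x))" if "x \<in> op_ivl D" for x
    by (rule DERIV_imp_deriv[OF sol_deriv[OF that]])
  then show "x \<in> op_ivl D \<Longrightarrow> deriv (sol lam) x = - (lam * (pC x * J (sol lam) x))" .
  have "continuous_on (op_ivl D) (deriv (sol lam))"
  proof (rule continuous_on_eq)
    show "continuous_on (op_ivl D) (\<lambda>x. - (lam * (pC x * J (sol lam) x)))"
      by (intro continuous_intros continuous_on_subset[OF p_cont op_ivl_subset_cl_ivl]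
         continuous_on_subset[OF continuous_on_cl_ivl op_ivl_subset_cl_ivl] J_cont sol_cont)
  qed (use d in auto)
  then show "C1_on (op_ivl D) (sol lam)"
    using sol_deriv by (auto simp: C1_on_def real_differentiable_def)
qed

lemma J_sol_Lam_pos: "x \<in> op_ivl D \<Longrightarrow> 0 < J (sol Lam) x"
  using op_cl[of x] op_ivl_below[of x D] sol_Lam_pos by (intro J_pos sol_cont) (auto simp: op_ivl_def)

text \<open>
  For \<open>Lam > 0\<close> the eigenfunction is a maximizer, with constant value \<open>I = 1 / Lam\<close>. For \<open>Lam = 0\<close> it
  is constant and hence not in the class, but then every element of the class is a maximizer, since
  \<open>I > 0\<close> always.
\<close>

lemma INF_I_attained: "\<exists>f\<in>F_I D. ereal Lam \<le> inf_I f"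
proof (cases "Lam = 0")
  case True
  define f :: "real \<Rightarrow> real" where "f x = exp (- x)" for x
  have df: "(f has_real_derivative - exp (- x)) (at x)" for x
    unfolding f_def by (auto intro!: derivative_eq_intros)
  have "deriv f = (\<lambda>x. - exp (- x))" using DERIV_imp_deriv[OF df] by auto
  then have f: "f \<in> F_I D"
    using df by (auto simp: F_I_def C1_on_def real_differentiable_def f_def intro!: continuous_intros)
  have "ereal Lam \<le> inverse (I_op a b D f x)" if x: "x \<in> op_ivl D" for x
    unfolding F_I_facts(5)[OF f x] inverse_ereal_pos[OF F_I_facts(6)[OF f x]]
    using divide_pos_pos[OF zero_less_one F_I_facts(6)[OF f x]] True
    unfolding ereal_less_eq by linarith
  then show ?thesis using f by (intro bexI[of _ f] INF_greatest) auto
next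
  case False
  then have L: "0 < Lam" using Lam_nonneg by simp
  have f: "sol Lam \<in> F_I D"
    using sol_in_C1(1)[of Lam] sol_in_C1(2)[where lam=Lam] sol_cont_cl[of Lam] sol_Lam_pos J_sol_Lam_pos L p_pos[OF op_cl]
    by (auto simp: F_I_def)
  have "ereal Lam \<le> inverse (I_op a b D (sol Lam) x)" if x: "x \<in> op_ivl D" for x
    using F_I_facts[OF f x] sol_in_C1(2)[OF x, of Lam] L by simp
  then show ?thesis using f by (intro bexI[of _ "sol Lam"] INF_greatest) auto
qed

section \<open>The double integral form\<close>

lemma nu_integral:
  assumes S: "S \<subseteq> op_ivl D" "S \<in> sets borel" and f: "\<And>s. s \<in> S \<Longrightarrow> continuous_on {0..s} f"
    and Jc: "continuous_on S (J f)"
  shows "(\<integral>\<^sup>+s\<in>S. ennreal (LINT t:{0..s}|mu a b D. f t) \<partial>nu a b D) = (\<integral>\<^sup>+s. ennreal (pC s * J f s) * indicator S s \<partial>lborel)"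
proof -
  have eq: "(\<lambda>s. ennreal (LINT t:{0..s}|mu a b D. f t) * indicator S s) = (\<lambda>s. ennreal (indicator S s *\<^sub>R J f s))"
    using S f LINT_mu op_cl by (auto simp: fun_eq_iff split: split_indicator)
  have "(\<lambda>s. ennreal (indicator S s *\<^sub>R J f s)) \<in> borel_measurable borel"
    by (rule measurable_compose[OF borel_measurable_continuous_on_indicator[OF S(2) Jc] measurable_ennreal])
  then have "(\<integral>\<^sup>+s\<in>S. ennreal (LINT t:{0..s}|mu a b D. f t) \<partial>nu a b D) = 
      (\<integral>\<^sup>+s. ennreal (indicator (op_ivl D) s *\<^sub>R pC s) * ennreal (indicator S s *\<^sub>R J f s) \<partial>lborel)"
    unfolding eq nu_eq
    using measurable_compose[OF pC_meas measurable_ennreal]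
    by (intro nn_integral_density) (simp_all only: measurable_lborel2)
  also have "\<dots> = (\<integral>\<^sup>+s. ennreal (pC s * J f s) * indicator S s \<partial>lborel)"
    using S by (intro nn_integral_cong) (auto simp: pC_def ennreal_mult' split: split_indicator)
  finally show ?thesis .
qed

lemma II_op_F_II:
  assumes f: "f \<in> F_II D" and x: "x \<in> op_ivl D"
  shows "II_op a b D f x = enn2ereal (\<integral>\<^sup>+s. ennreal (pC s * J f s) * indicator ({x<..} \<inter> op_ivl D) s \<partial>lborel) / ereal (f x)"
proof -
  have S: "{x<..} \<inter> op_ivl D \<inter> supp D f = {x<..} \<inter> op_ivl D"
    using f op_ivl_subset_cl_ivl[of D] by (auto simp: F_II_def supp_def)
  have fc: "continuous_on {0..s} f" if "s \<in> cl_ivl D" for s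
    using f atLeastAtMost_subset_cl_ivl[OF that] by (auto simp: F_II_def intro: continuous_on_subset)
  have "continuous_on ({x<..} \<inter> op_ivl D) (J f)"
    by (rule continuous_on_subset[OF continuous_on_cl_ivl[OF J_cont[OF _ fc]]])
      (use op_ivl_subset_cl_ivl[of D] in auto)
  then show ?thesis
    unfolding II_op_def S using fc op_cl by (subst nu_integral) auto
qed

lemma INF_II_le_Lam:
  assumes f: "f \<in> F_II D"
  shows "inf_II f \<le> ereal Lam"
proof (rule ereal_ge_by_density)
  fix lam assume lam: "ereal lam < inf_II f"
  have fpos: "0 < f x" if "x \<in> op_ivl D" for x using f that by (simp add: F_II_def)
  show "lam \<le> Lam"
  proof (rule Lam_ge_of_supersolution)
    show "continuous_on (insert 0 (op_ivl D)) f"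
      using f cl_ivl_zero[OF D_positive] op_ivl_subset_cl_ivl[of D] by (auto simp: F_II_def intro: continuous_on_subset)
    show "0 < f x" if "x \<in> op_ivl D" for x by (rule fpos[OF that])
    fix x z assume x: "x \<in> op_ivl D" and z: "z \<in> op_ivl D" "x < z"
    have zc: "z \<in> cl_ivl D" by (rule op_cl[OF z(1)])
    have x0: "0 < x" using x by (simp add: op_ivl_def)
    have fc: "continuous_on {0..z} f"
      using f atLeastAtMost_subset_cl_ivl[OF zc] by (auto simp: F_II_def intro: continuous_on_subset)
    have fnn: "0 \<le> f t" if "t \<in> {0<..<z}" for t using fpos[OF op_ivl_below[OF zc, of t]] that by auto
    have v0: "0 \<le> dbl f x z" by (rule dbl_nonneg[OF zc fnn]) (use x0 in auto)
    show "lam * dbl f x z \<le> f x"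
    proof (cases "dbl f x z = 0")
      case False
      with v0 have v: "0 < dbl f x z" by simp
      have "ennreal (dbl f x z) = (\<integral>\<^sup>+s. ennreal (pC s * J f s) * indicator {x<..<z} s \<partial>lborel)"
        by (rule nn_integral_dbl[symmetric, OF zc fc _ fnn]) (use x0 in auto)
      also have "\<dots> \<le> (\<integral>\<^sup>+s. ennreal (pC s * J f s) * indicator ({x<..} \<inter> op_ivl D) s \<partial>lborel)"
        using op_ivl_below[OF zc] x0 by (intro nn_integral_mono) (auto split: split_indicator)
      finally have "ereal (dbl f x z) \<le> enn2ereal (\<integral>\<^sup>+s. ennreal (pC s * J f s) * indicator ({x<..} \<inter> op_ivl D) s \<partial>lborel)"
        using v0 by (simp add: less_eq_ennreal.rep_eq)
      then have "ereal (dbl f x z) / ereal (f x) \<le> II_op a b D f x"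
        unfolding II_op_F_II[OF f x] using fpos[OF x] by (intro ereal_divide_right_mono) auto
      then have "ereal (dbl f x z / f x) \<le> II_op a b D f x" using fpos[OF x] by simp
      then have "inverse (II_op a b D f x) \<le> inverse (ereal (dbl f x z / f x))"
        using v fpos[OF x] by (intro ereal_inverse_antimono) auto
      also have "\<dots> = ereal (f x / dbl f x z)" using v fpos[OF x] by simp
      finally have "inverse (II_op a b D f x) \<le> ereal (f x / dbl f x z)" .
      moreover have "inf_II f \<le> inverse (II_op a b D f x)"
        by (rule INF_lower[OF x])
      ultimately have "ereal lam < ereal (f x / dbl f x z)" using lam by (meson le_less_trans less_le_trans)
      then show ?thesis using v by (simp add: field_simps)
    qed (use fpos[OF x] in simp)
  qed
qed

text \<open>
  From \<open>Lam * dbl f x z = f x - f z \<le> f x\<close> for \<open>f = sol Lam\<close> and all \<open>z\<close> one obtains \<open>II f \<le> 1 / Lam\<close>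
  in the limit \<open>z \<rightarrow> D\<close>, which Fatou's lemma justifies. For \<open>Lam = 0\<close> there is nothing to show but
  \<open>II \<ge> 0\<close>.
\<close>

lemma INF_II_attained: "\<exists>f\<in>F_II D. ereal Lam \<le> inf_II f"
proof -
  have f: "sol Lam \<in> F_II D" using sol_cont_cl sol_Lam_pos by (auto simp: F_II_def)
  have "ereal Lam \<le> inverse (II_op a b D (sol Lam) x)" if x: "x \<in> op_ivl D" for x
  proof -
    let ?E = "\<integral>\<^sup>+s. ennreal (pC s * J (sol Lam) s) * indicator ({x<..} \<inter> op_ivl D) s \<partial>lborel"
    have fx: "0 < sol Lam x" by (rule sol_Lam_pos[OF x])
    have x0: "0 < x" using x by (simp add: op_ivl_def)
    have II: "II_op a b D (sol Lam) x = enn2ereal ?E / ereal (sol Lam x)"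
      by (rule II_op_F_II[OF f x])
    have nn: "0 \<le> II_op a b D (sol Lam) x" unfolding II using fx by (intro zero_le_divide_ereal) auto
    show ?thesis
    proof (cases "Lam = 0")
      case True
      then show ?thesis using nn by (simp add: ereal_inverse_nonneg_iff zero_ereal_def[symmetric])
    next
      case False
      then have L: "0 < Lam" using Lam_nonneg by simp
      obtain Z where Z: "\<And>n. Z n \<in> op_ivl D" "\<And>x. x \<in> op_ivl D \<Longrightarrow> \<forall>\<^sub>F n in sequentially. x < Z n"
        using exhausting_sequence[of "\<lambda>_. 0"] by (auto simp: supp_def)
      let ?u = "\<lambda>n s. ennreal (pC s * J (sol Lam) s) * indicator ({x<..<Z n} \<inter> op_ivl D) s"
      have "?E \<le> (\<integral>\<^sup>+s. liminf (\<lambda>n. ?u n s) \<partial>lborel)"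
      proof (rule nn_integral_mono)
        fix s
        show "ennreal (pC s * J (sol Lam) s) * indicator ({x<..} \<inter> op_ivl D) s \<le>
          liminf (\<lambda>n. ?u n s)"
        proof (cases "s \<in> op_ivl D \<and> x < s")
          case True
          then have "\<forall>\<^sub>F n in sequentially. s < Z n" using Z(2) by auto
          then have "\<forall>\<^sub>F n in sequentially. ennreal (pC s * J (sol Lam) s) \<le> ?u n s"
            by (rule eventually_mono) (use True in simp)
          then have "ennreal (pC s * J (sol Lam) s) \<le> liminf (\<lambda>n. ?u n s)"
            by (rule Liminf_bounded)
          then show ?thesis using True by simp
        qed auto
      qed
      also have "\<dots> \<le> liminf (\<lambda>n. \<integral>\<^sup>+s. ?u n s \<partial>lborel)"
      proof (rule nn_integral_liminf)
        fix n
        show "(\<lambda>s. ?u n s) \<in> borel_measurable lborel"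
          by (rule ennreal_indicator_measurable_continuous)
            (use op_cl in \<open>auto intro!: continuous_intros continuous_on_subset[OF p_cont]
              continuous_on_subset[OF continuous_on_cl_ivl[OF J_cont[OF _ sol_cont]]]\<close>)
      qed
      also have "\<dots> \<le> liminf (\<lambda>n::nat. ennreal (sol Lam x / Lam))"
      proof (rule Liminf_mono, rule always_eventually, rule allI)
        fix n
        have zc: "Z n \<in> cl_ivl D" by (rule op_cl[OF Z(1)])
        have nn: "0 \<le> sol Lam t" if "t \<in> {0<..<Z n}" for t
          using sol_Lam_pos[OF op_ivl_below[OF zc, of t]] that by auto
        have "(\<integral>\<^sup>+s. ?u n s \<partial>lborel) \<le>
          (\<integral>\<^sup>+s. ennreal (pC s * J (sol Lam) s) * indicator {x<..<Z n} s \<partial>lborel)"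
          by (intro nn_integral_mono) (auto split: split_indicator)
        also have "\<dots> = ennreal (dbl (sol Lam) x (Z n))"
          by (rule nn_integral_dbl[OF zc sol_cont[OF zc] _ nn]) (use x0 in auto)
        also have "\<dots> \<le> ennreal (sol Lam x / Lam)"
        proof (cases "x < Z n")
          case True
          then show ?thesis using sol_diff[OF zc, of x Lam] sol_Lam_pos[OF Z(1), of n] x0 L
            by (intro ennreal_leI) (simp add: field_simps)
        next
          case False
          then have "dbl (sol Lam) x (Z n) = 0" by (cases "x = Z n") (auto simp: dbl_def)
          then show ?thesis by simp
        qed
        finally show "(\<integral>\<^sup>+s. ?u n s \<partial>lborel) \<le> ennreal (sol Lam x / Lam)" .
      qed
      also have "\<dots> = ennreal (sol Lam x / Lam)" by (simp add: Liminf_const)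
      finally have "enn2ereal ?E \<le> enn2ereal (ennreal (sol Lam x / Lam))" by (simp add: less_eq_ennreal.rep_eq)
      also have "\<dots> = ereal (sol Lam x / Lam)" using fx L by simp
      finally have "II_op a b D (sol Lam) x \<le> ereal (sol Lam x / Lam) / ereal (sol Lam x)"
        unfolding II using fx by (intro ereal_divide_right_mono) auto
      also have "\<dots> = ereal (1 / Lam)" using fx by simp
      finally have "inverse (ereal (1 / Lam)) \<le> inverse (II_op a b D (sol Lam) x)"
        using nn by (intro ereal_inverse_antimono)
      then show ?thesis using L by simp
    qed
  qed
  then show ?thesis using f by (intro bexI[of _ "sol Lam"] INF_greatest) auto
qed

lemma II_op_cutoff:
  assumes z: "z \<in> op_ivl D" and f: "continuous_on {0..z} f" "\<And>x. x \<in> {0<..<z} \<Longrightarrow> 0 < f x"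
    and f0: "\<And>x. x \<in> cl_ivl D \<Longrightarrow> z \<le> x \<Longrightarrow> f x = 0" and x: "0 \<le> x" "x < z" "0 < f x"
  shows "II_op a b D f x = ereal (dbl f x z / f x)"
proof -
  have zc: "z \<in> cl_ivl D" by (rule op_cl[OF z])
  have S: "{x<..} \<inter> op_ivl D \<inter> supp D f = {x<..<z}"
  proof (intro equalityI subsetI)
    fix s assume s: "s \<in> {x<..} \<inter> op_ivl D \<inter> supp D f"
    then show "s \<in> {x<..<z}" using f0[of s] by (cases "z \<le> s") (auto simp: supp_def)
  next
    fix s assume s: "s \<in> {x<..<z}"
    then show "s \<in> {x<..} \<inter> op_ivl D \<inter> supp D f"
      using f(2)[of s] op_ivl_below[OF zc, of s] cl_ivl_downward[OF zc, of s] x by (auto simp: supp_def)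
  qed
  have nn: "0 \<le> f t" if "t \<in> {0<..<z}" for t using f(2)[OF that] by simp
  have "(\<integral>\<^sup>+s\<in>{x<..<z}. ennreal (LINT t:{0..s}|mu a b D. f t) \<partial>nu a b D) = ennreal (dbl f x z)"
  proof (subst nu_integral)
    show "{x<..<z} \<subseteq> op_ivl D" using op_ivl_below[OF zc] x by auto
    show "continuous_on {0..s} f" if "s \<in> {x<..<z}" for s
      using that continuous_on_subset[OF f(1), of "{0..s}"] by auto
    show "continuous_on {x<..<z} (J f)"
      by (rule continuous_on_subset[OF J_cont[OF zc f(1)]]) (use x in auto)
    show "(\<integral>\<^sup>+s. ennreal (pC s * J f s) * indicator {x<..<z} s \<partial>lborel) = ennreal (dbl f x z)"
      by (rule nn_integral_dbl[OF zc f(1) _ nn]) (use x in auto)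
  qed simp
  then show ?thesis
    unfolding II_op_def S using x dbl_nonneg[OF zc nn x(1)] by simp
qed

lemma Lam_le_SUP_II:
  assumes "f \<in> Ft_II D"
  shows "ereal Lam \<le> sup_II f"
proof (rule ereal_le_by_density)
  fix lam assume lam: "sup_II f < ereal lam"
  obtain z where z: "z \<in> op_ivl D" and eq: "\<And>x. x \<in> cl_ivl D \<Longrightarrow> f x = f x * indicator {0..<z} x"
    and fc: "continuous_on {0..z} f" and pos: "\<And>x. x \<in> {0<..<z} \<Longrightarrow> 0 < f x"
    using assms unfolding Ft_II_def by blast
  have zc: "z \<in> cl_ivl D" by (rule op_cl[OF z])
  have f0: "f x = 0" if "x \<in> cl_ivl D" "z \<le> x" for x using eq[OF that(1)] that by simp
  show "Lam \<le> lam"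
  proof (rule Lam_le_of_subsolution[OF z fc pos])
    fix x assume x: "x \<in> {0<..<z}"
    have fx: "0 < f x" by (rule pos[OF x])
    have II: "II_op a b D f x = ereal (dbl f x z / f x)"
      by (rule II_op_cutoff[OF z fc pos f0]) (use x fx in auto)
    have v0: "0 \<le> dbl f x z" using dbl_nonneg[OF zc, of f x] pos x by (auto intro: less_imp_le)
    have "x \<in> supp D f" using fx x cl_ivl_downward[OF zc, of x] by (auto simp: supp_def)
    then have "inverse (II_op a b D f x) \<le> sup_II f"
      by (rule SUP_upper)
    then have "inverse (II_op a b D f x) < ereal lam" using lam by (rule le_less_trans)
    then show "f x \<le> lam * dbl f x z"
      unfolding II using v0 fx by (cases "dbl f x z = 0") (auto simp: field_simps)
  qed auto
qed

text \<open>
  For \<open>cut_sol lam z\<close> the double integral operator is constantly \<open>1 / lam\<close> on \<open>[0,z)\<close>.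
\<close>

lemma SUP_II_le:
  assumes "Lam < lam"
  shows "\<exists>f\<in>Ft_II D. sup_II f \<le> ereal lam"
proof -
  have lam: "0 < lam" using assms Lam_nonneg by simp
  obtain z where z: "z \<in> op_ivl D" "sol lam z = 0" "\<And>t. t \<in> {0..<z} \<Longrightarrow> 0 < sol lam t"
    using sol_above_Lam[OF assms] by blast
  have zc: "z \<in> cl_ivl D" and z0: "0 < z" using z op_cl by (auto simp: op_ivl_def)
  let ?f = "cut_sol lam z"
  have fc: "continuous_on {0..z} ?f" by (rule cut_cont[OF zc z(2)])
  have f0: "?f x = 0" if "z \<le> x" for x using that by (simp add: cut_sol_def)
  have pos: "0 < ?f x" if "x \<in> {0..<z}" for x using z(3)[OF that] that by (simp add: cut_sol_def)
  have "?f \<in> Ft_II D"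
    unfolding Ft_II_def
  proof (intro CollectI bexI[of _ z] conjI ballI)
    show "?f x = ?f x * indicator {0..<z} x" if "x \<in> cl_ivl D" for x
      using that f0[of x] by (auto simp: cl_ivl_def split: split_indicator)
  qed (use fc pos z in auto)
  moreover have "(SUP x\<in>supp D ?f. inverse (II_op a b D ?f x)) \<le> ereal lam"
  proof (rule SUP_least)
    fix x assume "x \<in> supp D ?f"
    then have x: "0 \<le> x" "x < z" using f0[of x] by (auto simp: supp_def cl_ivl_def cut_sol_def split: if_splits)
    have fx: "0 < ?f x" using pos x by auto
    have "II_op a b D ?f x = ereal (dbl ?f x z / ?f x)"
      by (rule II_op_cutoff[OF z(1) fc]) (use pos f0 x fx in auto)
    also have "dbl ?f x z = dbl (sol lam) x z" by (rule dbl_cong) (use x in \<open>auto simp: cut_sol_def\<close>)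
    also have "\<dots> = ?f x / lam"
      using sol_diff[OF zc, of x lam] z(2) x lam by (simp add: cut_sol_def field_simps)
    finally show "inverse (II_op a b D ?f x) \<le> ereal lam" using fx lam by simp
  qed
  ultimately show ?thesis by blast
qed

end

section \<open>The differential form\<close>

context string
begin

lemma sol_tendsto_left:
  assumes "z \<in> cl_ivl D" "0 < z"
  shows "(sol lam \<longlongrightarrow> sol lam z) (at_left z)" "((\<lambda>x. p x * J (sol lam) x) \<longlongrightarrow> p z * J (sol lam) z) (at_left z)"
proof -
  have "continuous (at z within {0..z}) (sol lam)" "continuous (at z within {0..z}) (\<lambda>x. p x * J (sol lam) x)"
    using sol_cont[OF assms(1), of lam] pJ_cont[OF assms(1) sol_cont[OF assms(1)], of lam] assms(2)
    by (auto simp: continuous_on_eq_continuous_within)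
  then show "(sol lam \<longlongrightarrow> sol lam z) (at_left z)" "((\<lambda>x. p x * J (sol lam) x) \<longlongrightarrow> p z * J (sol lam) z) (at_left z)"
    using assms(2) by (simp_all add: continuous_within at_within_Icc_at_left)
qed

text \<open>
  The logarithmic derivative of \<open>sol lam\<close>. Its differential operator \<open>R\<close> is constantly \<open>lam\<close>.
\<close>

definition logd :: "real \<Rightarrow> real \<Rightarrow> real" where
  "logd lam x = - (p x * (lam * J (sol lam) x)) / sol lam x"

text \<open>
  At a first zero the numerator tends to a negative limit, the denominator to \<open>0\<close> from above.
\<close>

lemma logd_at_bot:
  assumes z: "z \<in> cl_ivl D" "0 < z" and lam: "0 < lam" and sz: "sol lam z = 0"
    and pos: "\<And>t. t \<in> {0..<z} \<Longrightarrow> 0 < sol lam t"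
  shows "filterlim (logd lam) at_bot (at_left z)"
proof -
  have ev: "\<forall>\<^sub>F x in at_left z. x \<in> {0<..<z}"
    using eventually_at_left_real[OF z(2)] by (simp add: eventually_mono)
  have "LIM x at_left z. - (lam * (p x * J (sol lam) x)) * inverse (sol lam x) :> at_bot"
  proof (rule filterlim_tendsto_neg_mult_at_bot)
    show "((\<lambda>x. - (lam * (p x * J (sol lam) x))) \<longlongrightarrow> - (lam * (p z * J (sol lam) z))) (at_left z)"
      by (intro tendsto_intros sol_tendsto_left z)
    have "0 < J (sol lam) z" by (rule J_pos[OF z sol_cont[OF z(1)]]) (use pos in auto)
    then show "- (lam * (p z * J (sol lam) z)) < 0" using lam p_pos[OF z(1)] by simp
    show "filterlim (\<lambda>x. inverse (sol lam x)) at_top (at_left z)"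
      by (rule filterlim_inverse_at_top)
        (use sol_tendsto_left(1)[OF z, of lam] sz eventually_mono[OF ev, of "\<lambda>x. 0 < sol lam x"] pos in auto)
  qed
  then show ?thesis by (simp add: logd_def[abs_def] divide_inverse mult_ac)
qed

end

text \<open>
  With continuous coefficients \<open>p\<close>, \<open>m\<close> and hence \<open>J f\<close> become differentiable on \<open>(0,D)\<close>, so that the
  eigenvalue equation holds in differential form.
\<close>

locale continuous_diffusion = diffusion +
  assumes a_cont: "continuous_on (cl_ivl D) a" and b_cont: "continuous_on (cl_ivl D) b"
begin

lemma a_cont_op: "continuous_on (op_ivl D) a" and b_cont_op: "continuous_on (op_ivl D) b"
  using a_cont b_cont op_ivl_subset_cl_ivl by (auto intro: continuous_on_subset)

lemma drift_cont_op: "continuous_on (op_ivl D) (\<lambda>x. b x / a x)"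
  using a_pos by (intro continuous_intros a_cont_op b_cont_op) (auto simp: less_le)

lemma mC_cont_op: "continuous_on (op_ivl D) mC"
proof (rule continuous_on_eq)
  show "continuous_on (op_ivl D) (\<lambda>x. exp (Cfun a b x) / a x)"
    using a_pos by (intro continuous_intros a_cont_op continuous_on_subset[OF Cfun_cont op_ivl_subset_cl_ivl]) (auto simp: less_le)
qed (auto simp: mC_def)

lemma isCont_op: "continuous_on (op_ivl D) g \<Longrightarrow> x \<in> op_ivl D \<Longrightarrow> isCont g x"
  by (simp add: continuous_on_eq_continuous_at)

lemma pC_mC: "x \<in> op_ivl D \<Longrightarrow> a x * pC x * mC x = 1"
  using a_pos[of x] by (simp add: pC_def mC_def exp_minus)

lemma integral_deriv_at:
  fixes g :: "real \<Rightarrow> real"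
  assumes "g integrable_on {0..z}" "0 < x" "x < z" "isCont g x"
  shows "((\<lambda>x. integral {0..x} g) has_real_derivative g x) (at x)"
  using integral_has_vector_derivative_continuous_at[OF assms(1), of x "{}"] assms
  by (simp add: at_within_Icc_at continuous_at_imp_continuous_at_within has_real_derivative_iff_has_vector_derivative)

lemma Cfun_deriv:
  assumes x: "x \<in> op_ivl D"
  shows "(Cfun a b has_real_derivative b x / a x) (at x)"
proof -
  obtain z where z: "z \<in> op_ivl D" "x < z" using op_ivl_above[OF x] .
  have zc: "z \<in> cl_ivl D" by (rule op_cl[OF z(1)])
  have "((\<lambda>x. integral {0..x} (\<lambda>u. b u / a u)) has_real_derivative b x / a x) (at x)"
    by (rule integral_deriv_at[OF _ _ z(2) isCont_op[OF drift_cont_op x]])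
      (use x set_borel_integral_eq_integral(1)[OF set_integrable_initial[OF drift_int zc]] in \<open>auto simp: op_ivl_def\<close>)
  then show ?thesis
    by (rule has_field_derivative_transform_within_open[where S="op_ivl D"])
      (use x Cfun_eq op_cl in auto)
qed

lemma pC_deriv:
  assumes x: "x \<in> op_ivl D"
  shows "(pC has_real_derivative - (b x / a x * pC x)) (at x)"
  unfolding pC_def by (auto intro!: derivative_eq_intros Cfun_deriv[OF x])

lemma J_deriv:
  assumes z: "z \<in> cl_ivl D" "continuous_on {0..z} f" and x: "0 < x" "x < z"
  shows "(J f has_real_derivative mC x * f x) (at x)"
proof -
  have xo: "x \<in> op_ivl D" by (rule op_ivl_below[OF z(1) x])
  have "isCont f x" using z(2) x by (simp add: continuous_on_interior[of "{0..z}"])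
  then have "isCont (\<lambda>t. mC t * f t) x" by (intro continuous_intros isCont_op[OF mC_cont_op xo])
  then show ?thesis unfolding J_def by (intro integral_deriv_at[OF speed_mult_integrable[OF z] x])
qed

text \<open>
  If \<open>f' = - p \<phi>\<close> and \<open>\<phi>' = k\<close>, then \<open>L f = a f'' + b f' = - a p k\<close>, and \<open>h = f' / f\<close> satisfies
  \<open>R h = - L f / f = a p k / f\<close>. The general \<open>\<phi>\<close> is used for the eigenfunctions, where \<open>\<phi> = \<lambda> J f\<close>,
  and for the degenerate case \<open>Lam = 0\<close>.
\<close>

lemma log_deriv:
  assumes S: "open S" "S \<subseteq> op_ivl D"
    and f: "\<And>x. x \<in> S \<Longrightarrow> (f has_real_derivative - (pC x * \<phi> x)) (at x)" "\<And>x. x \<in> S \<Longrightarrow> 0 < f x"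
    and \<phi>: "\<And>x. x \<in> S \<Longrightarrow> (\<phi> has_real_derivative k x) (at x)" and k: "continuous_on S k"
    and h: "\<And>x. x \<in> S \<Longrightarrow> h x = - (pC x * \<phi> x) / f x"
  shows "C1_on S h"
    and "\<And>x. x \<in> S \<Longrightarrow> a x * (h x)\<^sup>2 + b x * h x + a x * deriv h x = - (a x * pC x * k x / f x)"
    and "\<And>x. x \<in> S \<Longrightarrow> R_op a b h x = a x * pC x * k x / f x"
proof -
  let ?h' = "\<lambda>x. - (pC x * k x / f x) - (h x)\<^sup>2 - b x / a x * h x"
  have dh: "(h has_real_derivative ?h' x) (at x)" if x: "x \<in> S" for x
  proof -
    have xo: "x \<in> op_ivl D" using S x by auto
    have "((\<lambda>x. - (pC x * \<phi> x)) has_real_derivative - (- (b x / a x * pC x) * \<phi> x + k x * pC x)) (at x)"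
      by (intro DERIV_minus DERIV_mult pC_deriv \<phi> x xo)
    from DERIV_divide[OF this f(1)[OF x]] f(2)[OF x]
    have "((\<lambda>x. - (pC x * \<phi> x) / f x) has_real_derivative ?h' x) (at x)"
      by (simp add: h[OF x] power2_eq_square field_simps)
    then show ?thesis
      by (rule has_field_derivative_transform_within_open[OF _ S(1) x]) (simp add: h)
  qed
  have d: "deriv h x = ?h' x" if "x \<in> S" for x by (rule DERIV_imp_deriv[OF dh[OF that]])
  have fc: "continuous_on S f"
    by (rule DERIV_continuous_on[OF has_field_derivative_at_within[OF f(1)]])
  have hc: "continuous_on S h"
    by (rule DERIV_continuous_on[OF has_field_derivative_at_within[OF dh]])
  have pS: "continuous_on S pC"
    by (rule continuous_on_subset[OF p_cont]) (use S op_ivl_subset_cl_ivl[of D] in auto)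
  have fne: "\<forall>x\<in>S. f x \<noteq> 0" using f(2) by force
  have "continuous_on S (deriv h)"
  proof (rule continuous_on_eq)
    show "continuous_on S ?h'"
      by (intro continuous_intros k fc hc pS fne continuous_on_subset[OF drift_cont_op S(2)])
  qed (use d in auto)
  then show "C1_on S h" using dh unfolding C1_on_def real_differentiable_def by blast
  show *: "a x * (h x)\<^sup>2 + b x * h x + a x * deriv h x = - (a x * pC x * k x / f x)" if x: "x \<in> S" for x
  proof -
    have "a x \<noteq> 0" using a_pos[of x] S x by auto
    then show ?thesis unfolding d[OF x] by (simp add: field_simps)
  qed
  show "R_op a b h x = a x * pC x * k x / f x" if x: "x \<in> S" for x
    using *[OF x] dh[OF x] by (auto simp: R_op_def real_differentiable_def)
qed

lemma logd_facts:
  assumes S: "open S" "S \<subseteq> op_ivl D" and pos: "\<And>x. x \<in> S \<Longrightarrow> 0 < sol lam x"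
    and h: "\<And>x. x \<in> S \<Longrightarrow> h x = logd lam x"
  shows "C1_on S h" "\<And>x. x \<in> S \<Longrightarrow> a x * (h x)\<^sup>2 + b x * h x + a x * deriv h x = - lam"
    and "\<And>x. x \<in> S \<Longrightarrow> R_op a b h x = lam"
proof -
  let ?k = "\<lambda>x. lam * (mC x * sol lam x)"
  have f: "(sol lam has_real_derivative - (pC x * (lam * J (sol lam) x))) (at x)" if "x \<in> S" for x
    using sol_deriv[of x lam] that S by (auto simp: mult_ac)
  have \<phi>: "((\<lambda>x. lam * J (sol lam) x) has_real_derivative ?k x) (at x)" if x: "x \<in> S" for x
  proof (intro DERIV_cmult)
    have xo: "x \<in> op_ivl D" using S x by auto
    obtain z where z: "z \<in> op_ivl D" "x < z" using op_ivl_above[OF xo] .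
    show "(J (sol lam) has_real_derivative mC x * sol lam x) (at x)"
      by (rule J_deriv[OF op_cl[OF z(1)] sol_cont[OF op_cl[OF z(1)]] _ z(2)]) (use xo in \<open>simp add: op_ivl_def\<close>)
  qed
  have k: "continuous_on S ?k"
    by (intro continuous_intros continuous_on_subset[OF mC_cont_op S(2)] continuous_on_subset[OF sol_cont_cl])
      (use S op_ivl_subset_cl_ivl[of D] in auto)
  have h': "h x = - (pC x * (lam * J (sol lam) x)) / sol lam x" if "x \<in> S" for x
    using h[OF that] by (simp add: logd_def)
  have e: "a x * pC x * ?k x / sol lam x = lam" if x: "x \<in> S" for x
  proof -
    have "a x * pC x * ?k x = (a x * pC x * mC x) * lam * sol lam x" by (simp only: mult_ac)
    also have "a x * pC x * mC x = 1" using pC_mC x S by auto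
    finally show ?thesis using pos[OF x] by simp
  qed
  show "C1_on S h" by (rule log_deriv(1)[OF S f pos \<phi> k h'])
  have "a x * (h x)\<^sup>2 + b x * h x + a x * deriv h x = - (a x * pC x * ?k x / sol lam x)" if "x \<in> S" for x
    by (rule log_deriv(2)[OF S f pos \<phi> k h' that])
  then show "a x * (h x)\<^sup>2 + b x * h x + a x * deriv h x = - lam" if "x \<in> S" for x
    using that e[OF that] by simp
  have "R_op a b h x = a x * pC x * ?k x / sol lam x" if "x \<in> S" for x
    by (rule log_deriv(3)[OF S f pos \<phi> k h' that])
  then show "R_op a b h x = lam" if "x \<in> S" for x
    using that e[OF that] by simp
qed

text \<open>
  Conversely every \<open>h\<close> is a logarithmic derivative, of \<open>f = exp (\<integral>\<^sub>0\<^sup>x h)\<close>. Then \<open>\<phi> = - f' / p\<close> has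
  derivative \<open>m f R h\<close> and vanishes at \<open>0\<close>, so bounds on \<open>R h\<close> by a constant \<open>lam\<close> integrate to bounds
  on \<open>\<phi>\<close> by \<open>lam * J f\<close>, which are single integral conditions on \<open>f\<close>.
\<close>

lemma riccati_comparison:
  assumes z: "z \<in> cl_ivl D" "0 < z" and hc: "continuous_on {0..z} h" and C1: "C1_on {0<..<z} h" and h0: "h 0 = 0"
  defines "f \<equiv> \<lambda>x. exp (integral {0..x} h)"
  shows "continuous_on {0..z} f" "\<And>x. x \<in> {0<..<z} \<Longrightarrow> (f has_real_derivative h x * f x) (at x)"
    and "\<And>x lam. x \<in> {0<..<z} \<Longrightarrow> (\<And>t. t \<in> {0<..<z} \<Longrightarrow> lam \<le> R_op a b h t) \<Longrightarrow> lam * (pC x * J f x) \<le> - (h x * f x)"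
    and "\<And>x lam. x \<in> {0<..<z} \<Longrightarrow> (\<And>t. t \<in> {0<..<z} \<Longrightarrow> R_op a b h t \<le> lam) \<Longrightarrow> - (h x * f x) \<le> lam * (pC x * J f x)"
proof -
  show fc: "continuous_on {0..z} f"
    unfolding f_def by (intro continuous_intros indefinite_integral_continuous_1 integrable_continuous_interval hc)
  have sub: "{0<..<z} \<subseteq> op_ivl D" using op_ivl_below[OF z(1)] by auto
  show df: "(f has_real_derivative h x * f x) (at x)" if x: "x \<in> {0<..<z}" for x
  proof -
    have "((\<lambda>x. integral {0..x} h) has_real_derivative h x) (at x)"
      using integral_has_real_derivative[OF hc, of x] x by (simp add: at_within_Icc_at)
    then show ?thesis unfolding f_def by (auto intro!: derivative_eq_intros)
  qed
  have dh: "(h has_real_derivative deriv h x) (at x)" if "x \<in> {0<..<z}" for x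
    using C1 that by (simp add: C1_on_def DERIV_deriv_iff_real_differentiable)
  have R: "R_op a b h x = - (a x * (h x)\<^sup>2 + b x * h x + a x * deriv h x)" if "x \<in> {0<..<z}" for x
    using C1 that by (simp add: C1_on_def R_op_def)
  define \<phi> where "\<phi> x = - (h x * f x) * exp (Cfun a b x)" for x
  have \<phi>c: "continuous_on {0..z} \<phi>"
    unfolding \<phi>_def by (intro continuous_intros hc fc continuous_on_subset[OF Cfun_cont] atLeastAtMost_subset_cl_ivl z)
  have d\<phi>: "(\<phi> has_real_derivative mC x * f x * R_op a b h x) (at x)" if x: "x \<in> {0<..<z}" for x
  proof -
    have xo: "x \<in> op_ivl D" using sub x by auto
    have "((\<lambda>x. exp (Cfun a b x)) has_real_derivative exp (Cfun a b x) * (b x / a x)) (at x)"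
      by (auto intro!: derivative_eq_intros Cfun_deriv[OF xo])
    from DERIV_mult[OF DERIV_minus[OF DERIV_mult[OF dh[OF x] df[OF x]]] this]
    have "(\<phi> has_real_derivative - (deriv h x * f x + h x * f x * h x) * exp (Cfun a b x) 
       + exp (Cfun a b x) * (b x / a x) * - (h x * f x)) (at x)"
      unfolding \<phi>_def .
    also have "- (deriv h x * f x + h x * f x * h x) * exp (Cfun a b x) 
       + exp (Cfun a b x) * (b x / a x) * - (h x * f x) = mC x * f x * R_op a b h x"
      using a_pos[OF xo] xo by (simp add: R[OF x] mC_def field_simps power2_eq_square)
    finally show ?thesis .
  qed
  have \<phi>p: "- (h x * f x) = pC x * \<phi> x" for x
    by (simp add: \<phi>_def pC_def exp_minus)
  have Jd: "(J f has_real_derivative mC x * f x) (at x)" if "x \<in> {0<..<z}" for x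
    using J_deriv[OF z(1) fc] that by auto
  have fpos: "0 < f x" for x by (simp add: f_def)
  have c: "continuous_on {0..x} (\<lambda>x. \<phi> x - lam * J f x)" if "x \<le> z" for x lam
    using that by (intro continuous_intros continuous_on_subset[OF \<phi>c] continuous_on_subset[OF J_cont[OF z(1) fc]]) auto
  have d: "((\<lambda>x. \<phi> x - lam * J f x) has_real_derivative mC x * f x * R_op a b h x - lam * (mC x * f x)) (at x)"
    if "x \<in> {0<..<z}" for x lam
    using d\<phi>[OF that] Jd[OF that] by (intro DERIV_diff DERIV_cmult)
  have factored: "mC x * f x * R_op a b h x - lam * (mC x * f x) = mC x * f x * (R_op a b h x - lam)" for x lam
    by (simp add: algebra_simps)
  have mf: "0 \<le> mC x * f x" for x using m_nonneg fpos by (simp add: less_imp_le)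
  have \<phi>0: "\<phi> 0 = 0" by (simp add: \<phi>_def h0)
  show "lam * (pC x * J f x) \<le> - (h x * f x)"
    if x: "x \<in> {0<..<z}" and le: "\<And>t. t \<in> {0<..<z} \<Longrightarrow> lam \<le> R_op a b h t" for x lam
  proof -
    have "\<phi> 0 - lam * J f 0 \<le> \<phi> x - lam * J f x"
    proof (rule DERIV_nonneg_imp_increasing_open[where f="\<lambda>x. \<phi> x - lam * J f x"])
      fix y assume y: "0 < y" "y < x"
      have "0 \<le> mC y * f y * R_op a b h y - lam * (mC y * f y)"
        unfolding factored using le[of y] x y by (intro mult_nonneg_nonneg[OF mf]) auto
      then show "\<exists>d. ((\<lambda>x. \<phi> x - lam * J f x) has_real_derivative d) (at y) \<and> 0 \<le> d"
        using d[of y lam] x y by auto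
    qed (use x c in auto)
    then have "lam * J f x \<le> \<phi> x" using \<phi>0 by simp
    then have "pC x * (lam * J f x) \<le> pC x * \<phi> x" by (rule mult_left_mono) (simp add: pC_def)
    then show ?thesis unfolding \<phi>p by (simp add: mult_ac)
  qed
  show "- (h x * f x) \<le> lam * (pC x * J f x)"
    if x: "x \<in> {0<..<z}" and le: "\<And>t. t \<in> {0<..<z} \<Longrightarrow> R_op a b h t \<le> lam" for x lam
  proof -
    have "\<phi> x - lam * J f x \<le> \<phi> 0 - lam * J f 0"
    proof (rule DERIV_nonpos_imp_decreasing_open[where f="\<lambda>x. \<phi> x - lam * J f x"])
      fix y assume y: "0 < y" "y < x"
      have "mC y * f y * R_op a b h y - lam * (mC y * f y) \<le> 0"
        unfolding factored using le[of y] x y by (intro mult_nonneg_nonpos[OF mf]) auto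
      then show "\<exists>d. ((\<lambda>x. \<phi> x - lam * J f x) has_real_derivative d) (at y) \<and> d \<le> 0"
        using d[of y lam] x y by auto
    qed (use x c in auto)
    then have "\<phi> x \<le> lam * J f x" using \<phi>0 by simp
    then have "pC x * \<phi> x \<le> pC x * (lam * J f x)" by (rule mult_left_mono) (simp add: pC_def)
    then show ?thesis unfolding \<phi>p by (simp add: mult_ac)
  qed
qed

lemma INF_R_le_Lam:
  assumes h: "h \<in> H_ext a b D"
  shows "inf_R h \<le> ereal Lam"
proof (rule ereal_ge_by_density)
  fix lam assume lam: "ereal lam < inf_R h"
  have R: "lam \<le> R_op a b h x" if x: "x \<in> op_ivl D" for x
  proof -
    have "inf_R h \<le> ereal (R_op a b h x)" by (rule INF_lower[OF x])
    with lam have "ereal lam < ereal (R_op a b h x)" by (rule less_le_trans)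
    then show ?thesis by simp
  qed
  have hC: "C1_on (op_ivl D) h" "continuous_on (insert 0 (op_ivl D)) h" "h 0 = 0" using h by (auto simp: H_ext_def)
  define f where "f x = exp (integral {0..x} h)" for x
  have r: "(f has_real_derivative h x * f x) (at x)" "lam * (pC x * J f x) \<le> - (h x * f x)"
    if x: "x \<in> op_ivl D" for x
  proof -
    obtain z where z: "z \<in> op_ivl D" "x < z" using op_ivl_above[OF x] .
    have zc: "z \<in> cl_ivl D" and z0: "0 < z" using z op_cl by (auto simp: op_ivl_def)
    have sub: "{0<..<z} \<subseteq> op_ivl D" using op_ivl_below[OF zc] by auto
    have C1: "C1_on {0<..<z} h" using hC(1) sub by (auto simp: C1_on_def intro: continuous_on_subset)
    have hc: "continuous_on {0..z} h" by (rule continuous_on_subset[OF hC(2) atLeastAtMost_subset_insert_op_ivl[OF z(1)]])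
    have xz: "x \<in> {0<..<z}" using x z by (simp add: op_ivl_def)
    note ric = riccati_comparison[OF zc z0 hc C1 hC(3), folded f_def]
    show "(f has_real_derivative h x * f x) (at x)" by (rule ric(2)[OF xz])
    show "lam * (pC x * J f x) \<le> - (h x * f x)" by (rule ric(3)[OF xz]) (use R sub in auto)
  qed
  show "lam \<le> Lam"
  proof (rule Lam_ge_of_deriv)
    show "continuous_on (insert 0 (op_ivl D)) f"
    proof -
      have "continuous (at x within insert 0 (op_ivl D)) f" if x: "x \<in> insert 0 (op_ivl D)" for x
      proof (cases "x = 0")
        case False
        then have "isCont f x" using r(1) x DERIV_isCont by blast
        then show ?thesis by (rule continuous_at_imp_continuous_at_within)
      next
        case True
        obtain z where z: "z \<in> op_ivl D" using op_ivl_nonempty[OF D_positive] .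
        have z0: "0 < z" using z by (simp add: op_ivl_def)
        have hc: "continuous_on {0..z} h" by (rule continuous_on_subset[OF hC(2) atLeastAtMost_subset_insert_op_ivl[OF z(1)]])
        have "continuous_on {0..z} f" unfolding f_def
          by (intro continuous_intros indefinite_integral_continuous_1 integrable_continuous_interval hc)
        then have "continuous (at 0 within {0..z}) f" using z0 by (simp add: continuous_on_eq_continuous_within)
        moreover have "at 0 within insert 0 (op_ivl D) = at 0 within {0..z}"
          by (rule at_within_nhd[of 0 "{..<z}"])
            (use z0 op_ivl_below[OF op_cl[OF z]] in \<open>auto simp: op_ivl_def\<close>)
        ultimately show ?thesis using True by (simp add: continuous_within)
      qed
      then show ?thesis by (simp add: continuous_on_eq_continuous_within)
    qed
    show "0 < f x" for x by (simp add: f_def)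
  qed (use r in auto)
qed

lemma H_subset_H_ext: "H a b D \<subseteq> H_ext a b D"
proof
  fix h assume h: "h \<in> H a b D"
  have c: "continuous_on (cl_ivl D) h" using h by (simp add: H_def)
  have "\<exists>l. ((\<lambda>x. ereal (h x)) \<longlongrightarrow> l) (at_left d)" if d: "D = ereal d" for d
  proof -
    have d0: "0 < d" using D_positive d by (simp add: zero_ereal_def)
    have "continuous (at d within {0..d}) h" using c d d0 by (simp add: continuous_on_eq_continuous_within)
    then have "(h \<longlongrightarrow> h d) (at_left d)" using d0 by (simp add: continuous_within at_within_Icc_at_left)
    then show ?thesis by (intro exI[of _ "ereal (h d)"]) (rule tendsto_ereal)
  qed
  moreover have "continuous_on (insert 0 (op_ivl D)) h"
    by (rule continuous_on_subset[OF c]) (use op_cl cl_ivl_zero[OF D_positive] in auto)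
  ultimately show "h \<in> H_ext a b D" using h by (auto simp: H_def H_ext_def)
qed

lemma logd_props:
  assumes lam: "0 < lam" and S: "S \<subseteq> cl_ivl D" "\<And>x. x \<in> S \<Longrightarrow> 0 < sol lam x"
  shows "continuous_on S (logd lam)" "logd lam 0 = 0" "x \<in> S \<Longrightarrow> 0 < x \<Longrightarrow> (\<And>t. t \<in> {0<..<x} \<Longrightarrow> 0 < sol lam t) \<Longrightarrow> logd lam x < 0"
proof -
  show "continuous_on S (logd lam)"
    unfolding logd_def
    by (intro continuous_intros continuous_on_subset[OF p_cont S(1)] continuous_on_subset[OF sol_cont_cl S(1)]
       continuous_on_subset[OF continuous_on_cl_ivl S(1)] J_cont sol_cont) (use S(2) in force)+
  show "logd lam 0 = 0" by (simp add: logd_def)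
  assume x: "x \<in> S" "0 < x" and pos: "\<And>t. t \<in> {0<..<x} \<Longrightarrow> 0 < sol lam t"
  have xc: "x \<in> cl_ivl D" using x S by auto
  have "0 < J (sol lam) x" using J_pos[OF xc x(2) sol_cont[OF xc] pos] .
  then show "logd lam x < 0" using S(2)[OF x(1)] lam p_pos[OF xc] by (simp add: logd_def)
qed

lemma logd_in_H:
  assumes lam: "0 < lam" and pos: "\<And>x. x \<in> cl_ivl D \<Longrightarrow> 0 < sol lam x"
  shows "logd lam \<in> H a b D" "ereal lam \<le> inf_R (logd lam)"
proof -
  have pos': "0 < sol lam x" if "x \<in> op_ivl D" for x using pos op_cl that by auto
  have sgn: "logd lam x < 0" if "x \<in> op_ivl D" for x
    using logd_props(3)[OF lam op_ivl_subset_cl_ivl pos' that] pos' op_ivl_below[OF op_cl[OF that]] that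
    by (auto simp: op_ivl_def)
  show "logd lam \<in> H a b D"
    unfolding H_def H_sign_def
    using logd_facts(1)[OF open_op_ivl order_refl pos' refl] logd_props(1)[OF lam order_refl pos] logd_props(2)[OF lam order_refl pos] sgn
    by (auto intro: less_imp_le)
  show "ereal lam \<le> inf_R (logd lam)"
    using logd_facts(3)[OF open_op_ivl order_refl pos' refl] by (intro INF_greatest) auto
qed

lemma logd_Lam_in_H_ext:
  assumes L: "0 < Lam"
  shows "logd Lam \<in> H_ext a b D" "ereal Lam \<le> inf_R (logd Lam)"
proof -
  have S: "insert 0 (op_ivl D) \<subseteq> cl_ivl D" using op_cl cl_ivl_zero[OF D_positive] by auto
  have pos0: "0 < sol Lam x" if "x \<in> insert 0 (op_ivl D)" for x using that sol_Lam_pos by auto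
  have sgn: "logd Lam x < 0" if "x \<in> op_ivl D" for x
    using logd_props(3)[OF L S pos0, of x] op_ivl_below[OF op_cl[OF that]] that sol_Lam_pos by (auto simp: op_ivl_def)
  have "\<exists>l. ((\<lambda>x. ereal (logd Lam x)) \<longlongrightarrow> l) (at_left d)" if d: "D = ereal d" for d
  proof -
    have d0: "0 < d" using D_positive d by (simp add: zero_ereal_def)
    have dc: "d \<in> cl_ivl D" using d d0 by simp
    show ?thesis
    proof (cases "sol Lam d = 0")
      case True
      have "filterlim (logd Lam) at_bot (at_left d)"
      proof (rule logd_at_bot[OF dc d0 L True])
        fix t assume "t \<in> {0..<d}"
        then have "t \<in> insert 0 (op_ivl D)" using d by auto
        then show "0 < sol Lam t" by (rule pos0)
      qed
      then have "((\<lambda>x. ereal (logd Lam x)) \<longlongrightarrow> - \<infinity>) (at_left d)"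
        by (simp add: tendsto_MInfty filterlim_at_bot_dense)
      then show ?thesis by blast
    next
      case False
      have "(logd Lam \<longlongrightarrow> - (pC d * J (sol Lam) d * Lam) / sol Lam d) (at_left d)"
      proof -
        have "((\<lambda>x. - (pC x * J (sol Lam) x * Lam) / sol Lam x) \<longlongrightarrow> - (pC d * J (sol Lam) d * Lam) / sol Lam d) (at_left d)"
          by (intro tendsto_intros sol_tendsto_left[OF dc d0] False)
        then show ?thesis by (simp add: logd_def[abs_def] mult_ac)
      qed
      then show ?thesis by (blast intro: tendsto_ereal)
    qed
  qed
  then show "logd Lam \<in> H_ext a b D"
    unfolding H_ext_def H_sign_def
    using logd_facts(1)[OF open_op_ivl order_refl sol_Lam_pos refl] logd_props(1)[OF L S pos0] logd_props(2)[OF L S pos0] sgn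
    by (auto intro: less_imp_le)
  show "ereal Lam \<le> inf_R (logd Lam)"
    using logd_facts(3)[OF open_op_ivl order_refl sol_Lam_pos refl] by (intro INF_greatest) auto
qed

text \<open>
  A competitor with \<open>R \<ge> 0\<close>, for the case \<open>Lam = 0\<close>, in which the eigenfunction is constant. If \<open>\<nu>\<close> is
  infinite, then \<open>h = 0\<close> is admitted. If \<open>\<nu>\<close> is finite, then a strictly decreasing positive function
  with \<open>L f \<le> 0\<close> is needed: \<open>f = 1 - \<integral> \<phi> d\<nu>\<close> for some increasing \<open>\<phi>\<close> with \<open>\<phi> 0 = 0\<close> and so small that
  \<open>f\<close> stays positive.
\<close>

lemma zero_R_in_H:
  assumes D: "D = \<infinity>"
  shows "\<exists>h\<in>H a b D. 0 \<le> inf_R h"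
proof (cases "emeasure (nu a b D) (op_ivl D) = \<infinity>")
  case True
  have "(\<lambda>x. 0) \<in> H a b D"
    using True by (auto simp: H_def H_sign_def C1_on_def)
  moreover have "R_op a b (\<lambda>x. 0) x = 0" for x by (simp add: R_op_def)
  ultimately show ?thesis by (intro bexI[of _ "\<lambda>x. 0"] INF_greatest) auto
next
  case False
  define B where "B = enn2real (emeasure (nu a b D) (op_ivl D))"
  have pc: "continuous_on {0..x} pC" for x
    by (rule continuous_on_subset[OF p_cont]) (simp add: D)
  have B: "integral {0..x} pC \<le> B" if x: "0 \<le> x" for x
  proof -
    have "ennreal (integral {0..x} pC) = (\<integral>\<^sup>+s. ennreal (pC s) * indicator {0..x} s \<partial>lborel)"
      by (rule nn_integral_has_integral_lebesgue'[symmetric, OF _ integrable_integral[OF integrable_continuous_interval[OF pc]]])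
        (simp add: pC_def)
    also have "\<dots> = (\<integral>\<^sup>+s. ennreal (pC s) * indicator {0<..x} s \<partial>lborel)"
      by (rule nn_integral_cong_AE, rule AE_mp[OF AE_lborel_singleton[of 0]]) (auto split: split_indicator)
    also have "\<dots> \<le> (\<integral>\<^sup>+s. ennreal (indicator (op_ivl D) s *\<^sub>R pC s) * indicator (op_ivl D) s \<partial>lborel)"
      using D by (intro nn_integral_mono) (auto split: split_indicator)
    also have "\<dots> = emeasure (nu a b D) (op_ivl D)"
      unfolding nu_eq using measurable_compose[OF pC_meas measurable_ennreal]
      by (intro emeasure_density[symmetric]) (simp_all only: measurable_lborel2 sets_lborel borel_op_ivl)
    also have "\<dots> = ennreal B" unfolding B_def using False by (simp add: ennreal_enn2real_if)
    finally show ?thesis by (simp add: ennreal_le_iff B_def)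
  qed
  have B0: "0 \<le> B" by (simp add: B_def)
  \<comment> \<open>As \<open>\<phi> \<le> e\<close>, this keeps \<open>\<integral> \<phi> d\<nu> \<le> e B < 1\<close>.\<close>
  define e where "e = 1 / (B + 1)"
  have e: "0 < e" "e * B < 1" using B0 by (auto simp: e_def)
  define \<phi> where "\<phi> x = e * (x / (1 + x))" for x
  define k where "k x = e * (1 / (1 + x)\<^sup>2)" for x
  have \<phi>c: "continuous_on {0..} \<phi>" unfolding \<phi>_def by (intro continuous_intros) auto
  have d\<phi>: "(\<phi> has_real_derivative k x) (at x)" if "0 < x" for x
    unfolding \<phi>_def k_def
    by (intro DERIV_cmult) (use that in \<open>auto intro!: derivative_eq_intros simp: power2_eq_square field_simps\<close>)
  have kc: "continuous_on (op_ivl D) k" unfolding k_def by (intro continuous_intros) (auto simp: D)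
  have pc': "continuous_on {0..x} (\<lambda>x. pC x * \<phi> x)" for x
    by (intro continuous_intros pc continuous_on_subset[OF \<phi>c]) auto
  define f where "f x = 1 - integral {0..x} (\<lambda>x. pC x * \<phi> x)" for x
  have fpos: "0 < f x" if x: "0 \<le> x" for x
  proof -
    have "integral {0..x} (\<lambda>x. pC x * \<phi> x) \<le> integral {0..x} (\<lambda>x. e * pC x)"
    proof (rule integral_le)
      fix s assume s: "s \<in> {0..x}"
      have "\<phi> s \<le> e" using e s by (simp add: \<phi>_def field_simps)
      then show "pC s * \<phi> s \<le> e * pC s" by (simp add: pC_def)
    qed (auto intro!: integrable_continuous_interval pc' continuous_intros pc)
    also have "\<dots> = e * integral {0..x} pC" by simp
    also have "\<dots> \<le> e * B" using B[OF x] e by (intro mult_left_mono) auto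
    finally show ?thesis using e by (simp add: f_def)
  qed
  have df: "(f has_real_derivative - (pC x * \<phi> x)) (at x)" if "0 < x" for x
  proof -
    have "((\<lambda>x. integral {0..x} (\<lambda>x. pC x * \<phi> x)) has_real_derivative pC x * \<phi> x) (at x)"
      using integral_has_real_derivative[OF pc', of x "x + 1"] that by (simp add: at_within_Icc_at)
    from DERIV_diff[OF DERIV_const this, of 1] show ?thesis by (simp add: f_def[abs_def])
  qed
  define h where "h x = - (pC x * \<phi> x) / f x" for x
  note L = log_deriv[OF open_op_ivl order_refl, of f \<phi> k h]
  have fc: "continuous_on {0..x} f" for x
    unfolding f_def by (intro continuous_intros indefinite_integral_continuous_1 integrable_continuous_interval pc')
  have hc: "continuous_on (cl_ivl D) h"
  proof (rule continuous_on_cl_ivl)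
    fix x
    have "f s \<noteq> 0" if "s \<in> {0..x}" for s using fpos[of s] that by auto
    then show "continuous_on {0..x} h"
      unfolding h_def by (intro continuous_intros pc continuous_on_subset[OF \<phi>c] fc) auto
  qed
  have "h x < 0" if "0 < x" for x
    using that fpos[of x] e by (simp add: h_def \<phi>_def pC_def)
  then have "h \<in> H a b D"
    using L(1) df fpos d\<phi> kc hc by (auto simp: H_def H_sign_def h_def \<phi>_def D less_imp_le)
  moreover have "0 \<le> R_op a b h x" if x: "x \<in> op_ivl D" for x
  proof -
    have "R_op a b h x = a x * pC x * k x / f x"
      by (rule L(3)) (use df fpos d\<phi> kc x D in \<open>auto simp: h_def\<close>)
    also have "\<dots> \<ge> 0"
      using a_pos[OF x] fpos[of x] x D e by (auto simp: k_def pC_def intro!: divide_nonneg_pos mult_nonneg_nonneg)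
    finally show ?thesis .
  qed
  ultimately show ?thesis by (intro bexI[of _ h] INF_greatest) (auto simp: zero_ereal_def)
qed

text \<open>
  For \<open>D = \<infinity>\<close> the two classes of lower test functions agree and the supremum is attained. For
  \<open>D < \<infinity>\<close> the logarithmic derivative of \<open>sol Lam\<close> may be infinite at \<open>D\<close>; those of \<open>sol l\<close> with
  \<open>l < Lam\<close> are finite there.
\<close>

lemma INF_R_approx:
  assumes "lam < Lam \<or> D = \<infinity> \<and> lam \<le> Lam"
  shows "\<exists>h\<in>H a b D. ereal lam \<le> inf_R h"
proof (cases "D = \<infinity>")
  case True
  show ?thesis
  proof (cases "Lam = 0")
    case L: True
    obtain h where h: "h \<in> H a b D" "0 \<le> inf_R h" using zero_R_in_H[OF True] by blast
    have "ereal lam \<le> 0" using assms L by (auto simp: zero_ereal_def)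
    then have "ereal lam \<le> inf_R h" using h(2) by (rule order_trans)
    then show ?thesis using h(1) by blast
  next
    case False
    then have L: "0 < Lam" using Lam_nonneg by simp
    have "x \<in> op_ivl D \<or> x = 0" if "x \<in> cl_ivl D" for x
      using that True by auto
    then have pos: "0 < sol Lam x" if "x \<in> cl_ivl D" for x
      using that sol_Lam_pos[of x] sol_at_0[of Lam] by (metis zero_less_one)
    have "ereal lam \<le> ereal Lam" using assms by auto
    then have "ereal lam \<le> inf_R (logd Lam)"
      using logd_in_H(2)[OF L pos] by (rule order_trans)
    then show ?thesis using logd_in_H(1)[OF L pos] by blast
  qed
next
  case False
  then obtain d where d: "D = ereal d" using D_positive by (cases D) auto
  have L: "0 < Lam" by (rule Lam_pos_if_finite[OF d])
  define l where "l = max lam (Lam / 2)"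
  have l: "0 < l" "l < Lam" "lam \<le> l" using assms False L by (auto simp: l_def)
  note pos = sol_pos_below_Lam[OF _ L l(2)]
  have "ereal lam \<le> ereal l" using l by simp
  then have "ereal lam \<le> inf_R (logd l)"
    using logd_in_H(2)[OF l(1) pos] by (rule order_trans)
  then show ?thesis using logd_in_H(1)[OF l(1) pos] by blast
qed

lemma INF_R_attained: "\<exists>h\<in>H_ext a b D. ereal Lam \<le> inf_R h"
proof (cases "Lam = 0")
  case False
  then show ?thesis using logd_Lam_in_H_ext Lam_nonneg by (intro bexI[of _ "logd Lam"]) auto
next
  case True
  then have "D = \<infinity>" using Lam_pos_if_finite D_positive by (cases D) auto
  then show ?thesis using INF_R_approx[of Lam] H_subset_H_ext by blast
qed

text \<open>
  Let \<open>f = exp (\<integral> h)\<close>, and let \<open>R h \<le> lam\<close>. Then \<open>- h f \<le> lam p J f\<close> is bounded on \<open>(0,z)\<close>, and since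
  \<open>h \<rightarrow> - \<infinity>\<close> at \<open>z\<close>, necessarily \<open>f \<rightarrow> 0\<close> there. So \<open>f\<close>, extended by \<open>0\<close>, meets the condition for upper
  estimates. The bound \<open>sup (a h\<^sup>2 + b h + a h') < 0\<close> is what makes \<open>lam\<close> positive.
\<close>

lemma Lam_le_SUP_R:
  assumes h: "h \<in> Ht a b D"
  shows "ereal Lam \<le> sup_R h"
proof (rule ereal_le_by_density)
  fix lam assume lam: "sup_R h < ereal lam"
  obtain z where z: "z \<in> op_ivl D" and C1: "C1_on {0<..<z} h" and hc: "continuous_on {0..<z} h"
    and lim: "filterlim h at_bot (at_left z)" and neg: "\<And>x. x \<in> {0<..<z} \<Longrightarrow> h x < 0" and h0: "h 0 = 0"
    and sup: "(SUP x\<in>{0<..<z}. ereal (a x * (h x)\<^sup>2 + b x * h x + a x * deriv h x)) < 0"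
    using h unfolding Ht_def by blast
  have zc: "z \<in> cl_ivl D" and z0: "0 < z" using z op_cl by (auto simp: op_ivl_def)
  have R: "R_op a b h x \<le> lam" if "x \<in> {0<..<z}" for x
  proof -
    have "ereal (R_op a b h x) \<le> sup_R h"
      by (rule SUP_upper) (use that op_ivl_below[OF zc] in auto)
    then have "ereal (R_op a b h x) < ereal lam" using lam by (rule le_less_trans)
    then show ?thesis by simp
  qed
  have lam0: "0 < lam"
  proof -
    have w: "z / 2 \<in> {0<..<z}" using z0 by simp
    have "ereal (a (z/2) * (h (z/2))\<^sup>2 + b (z/2) * h (z/2) + a (z/2) * deriv h (z/2)) \<le> (SUP x\<in>{0<..<z}. ereal (a x * (h x)\<^sup>2 + b x * h x + a x * deriv h x))"
      by (rule SUP_upper[OF w])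
    then have "ereal (a (z/2) * (h (z/2))\<^sup>2 + b (z/2) * h (z/2) + a (z/2) * deriv h (z/2)) < 0" using sup by (rule le_less_trans)
    then have "0 < R_op a b h (z/2)" using C1 w by (simp add: C1_on_def R_op_def)
    with R[OF w] show ?thesis by simp
  qed
  define f where "f x = exp (integral {0..x} h)" for x
  define g where "g x = (if x < z then f x else 0)" for x
  have r: "continuous_on {0..w} f" "x \<in> {0<..<w} \<Longrightarrow> (f has_real_derivative h x * f x) (at x)"
    "x \<in> {0<..<w} \<Longrightarrow> - (h x * f x) \<le> lam * (pC x * J f x)" if w: "w \<in> {0<..<z}" for w x
  proof -
    have wc: "w \<in> cl_ivl D" and w0: "0 < w" using cl_ivl_downward[OF zc, of w] w by auto
    have C1': "C1_on {0<..<w} h" using C1 w by (auto simp: C1_on_def intro: continuous_on_subset)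
    have hc': "continuous_on {0..w} h" by (rule continuous_on_subset[OF hc]) (use w in auto)
    note ric = riccati_comparison[OF wc w0 hc' C1' h0, folded f_def]
    show "continuous_on {0..w} f" by (rule ric(1))
    show "x \<in> {0<..<w} \<Longrightarrow> (f has_real_derivative h x * f x) (at x)" by (rule ric(2))
    show "x \<in> {0<..<w} \<Longrightarrow> - (h x * f x) \<le> lam * (pC x * J f x)" by (rule ric(4)) (use R w in auto)
  qed
  have df: "(f has_real_derivative h x * f x) (at x)" and ub: "- (h x * f x) \<le> lam * (pC x * J f x)"
    and fc: "continuous_on {0..x} f" if x: "x \<in> {0<..<z}" for x
    using r(2)[of "(x + z) / 2" x] r(3)[of "(x + z) / 2" x] r(1)[of x] x by auto
  have fle1: "f x \<le> 1" if x: "x \<in> {0..<z}" for x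
  proof -
    have "integral {0..x} h \<le> integral {0..x} (\<lambda>_. 0)"
    proof (rule integral_le)
      show "h integrable_on {0..x}" by (intro integrable_continuous_interval continuous_on_subset[OF hc]) (use x in auto)
      show "h s \<le> 0" if "s \<in> {0..x}" for s using neg[of s] h0 that x by (cases "s = 0") auto
    qed auto
    then show ?thesis by (simp add: f_def)
  qed
  have fpos: "0 < f x" for x by (simp add: f_def)
  have dg: "(g has_real_derivative h x * f x) (at x)" if x: "x \<in> {0<..<z}" for x
    by (rule has_field_derivative_transform_within_open[OF df[OF x], where S="{0<..<z}"]) (use x in \<open>auto simp: g_def\<close>)
  have Jg: "J g x = J f x" if "x < z" for x by (rule J_cong) (use that in \<open>auto simp: g_def\<close>)
  have gz: "(g \<longlongrightarrow> 0) (at_left z)"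
  proof -
    have "compact (pC ` {0..z})"
      by (intro compact_continuous_image continuous_on_subset[OF p_cont] atLeastAtMost_subset_cl_ivl zc) auto
    then have "bdd_above (pC ` {0..z})" by (intro bounded_imp_bdd_above compact_imp_bounded)
    then obtain B where "\<forall>y\<in>pC ` {0..z}. y \<le> B" unfolding bdd_above_def by blast
    then have B: "pC x \<le> B" if "x \<in> {0..z}" for x using that by auto
    define K where "K = lam * (B * J (\<lambda>_. 1) z)"
    have ev: "\<forall>\<^sub>F x in at_left z. x \<in> {0<..<z}" using eventually_at_left_real[OF z0] by simp
    have le: "g x \<le> - K / h x" if x: "x \<in> {0<..<z}" for x
    proof -
      have xc: "x \<in> cl_ivl D" using cl_ivl_downward[OF zc, of x] x by auto
      have "J f x \<le> J (\<lambda>_. 1) x" by (rule J_mono[OF xc fc[OF x]]) (use x fle1 in auto)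
      also have "\<dots> \<le> J (\<lambda>_. 1) z" by (rule J_incr[OF zc]) (use x in auto)
      finally have J1: "J f x \<le> J (\<lambda>_. 1) z" .
      have "0 \<le> J f x" by (rule J_nonneg[OF _ xc]) (use fpos in \<open>auto intro: less_imp_le\<close>)
      then have "pC x * J f x \<le> B * J (\<lambda>_. 1) z"
        using B[of x] x J1 p_pos[OF xc] by (intro mult_mono) auto
      then have "lam * (pC x * J f x) \<le> K" unfolding K_def using lam0 by (intro mult_left_mono) auto
      then have "- (h x * f x) \<le> K" using ub[OF x] by linarith
      then show ?thesis using neg[OF x] x by (simp add: g_def field_simps)
    qed
    have Kh: "((\<lambda>x. - K / h x) \<longlongrightarrow> 0) (at_left z)"
      by (rule tendsto_divide_0[OF tendsto_const filterlim_mono[OF lim at_bot_le_at_infinity order_refl]])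
    have g0: "\<forall>\<^sub>F x in at_left z. 0 \<le> g x" using fpos by (simp add: g_def less_imp_le)
    have "\<forall>\<^sub>F x in at_left z. g x \<le> - K / h x" by (rule eventually_mono[OF ev]) (rule le)
    then show ?thesis by (rule tendsto_sandwich[OF g0 _ tendsto_const Kh])
  qed
  have gc: "continuous_on {0..z} g"
  proof (rule continuous_on_IccI)
    have w: "z / 2 \<in> {0<..<z}" using z0 by simp
    have "continuous (at 0 within {0..z/2}) f" using fc[OF w] z0 by (simp add: continuous_on_eq_continuous_within)
    then have "(f \<longlongrightarrow> f 0) (at_right 0)" using z0 by (simp add: continuous_within at_within_Icc_at_right)
    moreover have "\<forall>\<^sub>F x in at_right 0. f x = g x"
      using eventually_at_right_real[OF z0] by (rule eventually_mono) (simp add: g_def)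
    ultimately show "(g \<longlongrightarrow> g 0) (at_right 0)"
      using z0 by (simp add: g_def[of 0] tendsto_cong)
    show "(g \<longlongrightarrow> g z) (at_left z)" using gz by (simp add: g_def[of z])
    show "g \<midarrow>x\<rightarrow> g x" if "0 < x" "x < z" for x
      using DERIV_isCont[OF dg[of x]] that by (simp add: isCont_def)
  qed (rule z0)
  show "Lam \<le> lam"
    by (rule Lam_le_of_deriv[OF order_refl z0 z gc _ _ _ dg])
      (use fpos ub Jg lam0 in \<open>auto simp: g_def\<close>)
qed

text \<open>
  For the logarithmic derivative of \<open>sol lam\<close>, cut off at its first zero \<open>z\<close>, the operator \<open>R\<close> is \<open>lam\<close>
  on \<open>(0,z)\<close>. At \<open>z\<close> the function is discontinuous, and \<open>R\<close> takes its default value \<open>0\<close>.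
\<close>

lemma SUP_R_le:
  assumes "Lam < lam"
  shows "\<exists>h\<in>Ht a b D. sup_R h \<le> ereal lam"
proof -
  have lam: "0 < lam" using assms Lam_nonneg by simp
  obtain z where z: "z \<in> op_ivl D" "sol lam z = 0" "\<And>t. t \<in> {0..<z} \<Longrightarrow> 0 < sol lam t"
    using sol_above_Lam[OF assms] by blast
  have zc: "z \<in> cl_ivl D" and z0: "0 < z" using z op_cl by (auto simp: op_ivl_def)
  define h where "h x = (if x < z then logd lam x else 0)" for x
  have sub: "{0<..<z} \<subseteq> op_ivl D" using op_ivl_below[OF zc] by auto
  have sub': "{0..<z} \<subseteq> cl_ivl D" using cl_ivl_downward[OF zc] by auto
  note F = logd_facts[OF open_greaterThanLessThan sub, of lam h]
  have pos: "0 < sol lam x" if "x \<in> {0<..<z}" for x using z(3) that by auto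
  have hl: "h x = logd lam x" if "x \<in> {0<..<z}" for x using that by (simp add: h_def)
  note P = logd_props[OF lam sub' z(3)]
  have lim: "filterlim h at_bot (at_left z)"
  proof -
    have "\<forall>\<^sub>F x in at_left z. logd lam x = h x"
      using eventually_at_left_real[OF z0] by (rule eventually_mono) (simp add: h_def)
    moreover have "filterlim (logd lam) at_bot (at_left z)" by (rule logd_at_bot[OF zc z0 lam z(2,3)])
    ultimately show ?thesis using filterlim_cong[OF refl refl, of "logd lam" h] by blast
  qed
  have "h \<in> Ht a b D"
    unfolding Ht_def
  proof (intro CollectI bexI[of _ z] conjI)
    show "C1_on {0<..<z} h" by (rule F(1)[OF pos hl])
    show "continuous_on {0..<z} h" by (rule continuous_on_eq[OF P(1)]) (auto simp: h_def)
    show "\<forall>x\<in>{0<..<z}. h x < 0" using P(3) pos by (auto simp: h_def)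
    show "h 0 = 0" using P(2) by (simp add: h_def)
    have "(SUP x\<in>{0<..<z}. ereal (a x * (h x)\<^sup>2 + b x * h x + a x * deriv h x)) \<le> ereal (- lam)"
      using F(2)[OF pos hl] by (intro SUP_least) auto
    also have "\<dots> < 0" using lam by simp
    finally show "(SUP x\<in>{0<..<z}. ereal (a x * (h x)\<^sup>2 + b x * h x + a x * deriv h x)) < 0" .
  qed (use lim z in \<open>auto simp: h_def\<close>)
  moreover have "sup_R h \<le> ereal lam"
  proof (rule SUP_least)
    fix x assume x: "x \<in> op_ivl D"
    consider "x \<in> {0<..<z}" | "x = z" | "z < x" using x by (fastforce simp: op_ivl_def)
    then show "ereal (R_op a b h x) \<le> ereal lam"
    proof cases
      case 1 then show ?thesis using F(3)[OF pos hl] by simp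
    next
      case 2
      have "\<not> h differentiable (at z)"
      proof
        assume "h differentiable (at z)"
        then have "isCont h z" by (rule differentiable_imp_continuous_within)
        then have "(h \<longlongrightarrow> h z) (at_left z)" unfolding isCont_def by (rule filterlim_mono) (auto simp: at_le)
        then have "\<forall>\<^sub>F x in at_left z. - 1 < h x" by (rule order_tendstoD(1)) (simp add: h_def)
        moreover have "\<forall>\<^sub>F x in at_left z. h x < - 1" using lim by (simp add: filterlim_at_bot_dense)
        ultimately have "\<forall>\<^sub>F x in at_left z. False" by eventually_elim simp
        then show False by simp
      qed
      then show ?thesis using 2 lam by (simp add: R_op_def)
    next
      case 3
      have "((\<lambda>x. 0) has_real_derivative 0) (at x)" by simp
      then have "(h has_real_derivative 0) (at x)"
        by (rule has_field_derivative_transform_within_open[where S="{z<..}"]) (use 3 in \<open>auto simp: h_def\<close>)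
      then have "deriv h x = 0" by (rule DERIV_imp_deriv)
      then show ?thesis using 3 lam by (simp add: R_op_def h_def)
    qed
  qed
  ultimately show ?thesis by blast
qed

end

section \<open>The variational formulas\<close>

lemma INF_eqI_real:
  fixes S :: "'a \<Rightarrow> ereal"
  assumes "\<And>f. f \<in> A \<Longrightarrow> ereal L \<le> S f" "\<And>l. L < l \<Longrightarrow> \<exists>f\<in>A. S f \<le> ereal l"
  shows "(INF f\<in>A. S f) = ereal L"
proof (rule antisym)
  show "(INF f\<in>A. S f) \<le> ereal L"
  proof (rule ereal_ge_by_density, rule ccontr)
    fix l assume l: "ereal l < (INF f\<in>A. S f)" "\<not> l \<le> L"
    then obtain f where "f \<in> A" "S f \<le> ereal l" using assms(2)[of l] by auto
    then have "(INF f\<in>A. S f) \<le> ereal l" by (rule INF_lower2)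
    with l(1) show False by simp
  qed
qed (use assms(1) in \<open>auto intro: INF_greatest\<close>)

lemma SUP_eqI_real:
  fixes S :: "'a \<Rightarrow> ereal"
  assumes "\<And>f. f \<in> A \<Longrightarrow> S f \<le> ereal L" "\<And>l. l < L \<Longrightarrow> \<exists>f\<in>A. ereal l \<le> S f"
  shows "(SUP f\<in>A. S f) = ereal L"
proof (rule antisym)
  show "ereal L \<le> (SUP f\<in>A. S f)"
  proof (rule ereal_le_by_density, rule ccontr)
    fix l assume l: "(SUP f\<in>A. S f) < ereal l" "\<not> L \<le> l"
    then obtain f where "f \<in> A" "ereal l \<le> S f" using assms(2)[of l] by auto
    then have "ereal l \<le> (SUP f\<in>A. S f)" by (rule SUP_upper2)
    with l(1) show False by simp
  qed
qed (use assms(1) in \<open>auto intro: SUP_least\<close>)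

lemma SUP_eq_attained:
  fixes S :: "'a \<Rightarrow> ereal"
  assumes "\<And>f. f \<in> A \<Longrightarrow> S f \<le> L" "\<exists>f\<in>A. L \<le> S f"
  shows "L = (SUP f\<in>A. S f) \<and> (\<exists>f\<in>A. S f = L)"
  using assms by (metis SUP_eqI antisym)

theorem theorem1:
  fixes a b :: "real \<Rightarrow> real" and D :: ereal
  assumes "0 < D"
    and "set_borel_measurable borel (cl_ivl D) a"
    and "set_borel_measurable borel (cl_ivl D) b"
    and "\<forall>x\<in>op_ivl D. 0 < a x"
    and "locally_integrable D (\<lambda>x. b x / a x)"
    and "locally_integrable D (\<lambda>x. exp (Cfun a b x) / a x)"
  shows
    "((INF f\<in>Ft_I D. SUP x\<in>op_ivl D. inverse (I_op a b D f x)) = lambda0 a b D \<and>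
      lambda0 a b D = (SUP f\<in>F_I D. INF x\<in>op_ivl D. inverse (I_op a b D f x)) \<and>
      (\<exists>f\<in>F_I D. (INF x\<in>op_ivl D. inverse (I_op a b D f x)) = lambda0 a b D)) \<and>
     ((INF f\<in>Ft_II D. SUP x\<in>supp D f. inverse (II_op a b D f x)) = lambda0 a b D \<and>
      lambda0 a b D = (SUP f\<in>F_II D. INF x\<in>op_ivl D. inverse (II_op a b D f x)) \<and>
      (\<exists>f\<in>F_II D. (INF x\<in>op_ivl D. inverse (II_op a b D f x)) = lambda0 a b D)) \<and>
     (continuous_on (cl_ivl D) a \<and> continuous_on (cl_ivl D) b \<longrightarrow>
      (INF h\<in>Ht a b D. SUP x\<in>op_ivl D. ereal (R_op a b h x)) = lambda0 a b D \<and>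
      lambda0 a b D = (SUP h\<in>H a b D. INF x\<in>op_ivl D. ereal (R_op a b h x)) \<and>
      lambda0 a b D = (SUP h\<in>H_ext a b D. INF x\<in>op_ivl D. ereal (R_op a b h x)) \<and>
      (\<exists>h\<in>H_ext a b D. (INF x\<in>op_ivl D. ereal (R_op a b h x)) = lambda0 a b D))"
proof -
  interpret diffusion a b D using assms by unfold_locales auto
  note L = lambda0_eq_Lam
  have I: "(INF f\<in>Ft_I D. SUP x\<in>op_ivl D. inverse (I_op a b D f x)) = lambda0 a b D"
    unfolding L by (rule INF_eqI_real[OF Lam_le_SUP_I SUP_I_le])
  have I': "lambda0 a b D = (SUP f\<in>F_I D. INF x\<in>op_ivl D. inverse (I_op a b D f x)) \<and>
      (\<exists>f\<in>F_I D. (INF x\<in>op_ivl D. inverse (I_op a b D f x)) = lambda0 a b D)"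
    unfolding L by (rule SUP_eq_attained[OF INF_I_le_Lam INF_I_attained])
  have II: "(INF f\<in>Ft_II D. SUP x\<in>supp D f. inverse (II_op a b D f x)) = lambda0 a b D"
    unfolding L by (rule INF_eqI_real[OF Lam_le_SUP_II SUP_II_le])
  have II': "lambda0 a b D = (SUP f\<in>F_II D. INF x\<in>op_ivl D. inverse (II_op a b D f x)) \<and>
      (\<exists>f\<in>F_II D. (INF x\<in>op_ivl D. inverse (II_op a b D f x)) = lambda0 a b D)"
    unfolding L by (rule SUP_eq_attained[OF INF_II_le_Lam INF_II_attained])
  have R: "(INF h\<in>Ht a b D. SUP x\<in>op_ivl D. ereal (R_op a b h x)) = lambda0 a b D \<and>
      lambda0 a b D = (SUP h\<in>H a b D. INF x\<in>op_ivl D. ereal (R_op a b h x)) \<and>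
      lambda0 a b D = (SUP h\<in>H_ext a b D. INF x\<in>op_ivl D. ereal (R_op a b h x)) \<and>
      (\<exists>h\<in>H_ext a b D. (INF x\<in>op_ivl D. ereal (R_op a b h x)) = lambda0 a b D)"
    if c: "continuous_on (cl_ivl D) a \<and> continuous_on (cl_ivl D) b"
  proof -
    interpret continuous_diffusion a b D using c by unfold_locales auto
    have "(INF h\<in>Ht a b D. SUP x\<in>op_ivl D. ereal (R_op a b h x)) = lambda0 a b D"
      unfolding L by (rule INF_eqI_real[OF Lam_le_SUP_R SUP_R_le])
    moreover have "(SUP h\<in>H a b D. INF x\<in>op_ivl D. ereal (R_op a b h x)) = lambda0 a b D"
      unfolding L by (rule SUP_eqI_real) (use INF_R_le_Lam H_subset_H_ext INF_R_approx in blast)+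
    moreover have "lambda0 a b D = (SUP h\<in>H_ext a b D. INF x\<in>op_ivl D. ereal (R_op a b h x)) \<and>
      (\<exists>h\<in>H_ext a b D. (INF x\<in>op_ivl D. ereal (R_op a b h x)) = lambda0 a b D)"
      unfolding L by (rule SUP_eq_attained[OF INF_R_le_Lam INF_R_attained])
    ultimately show ?thesis by (intro conjI) auto
  qed
  show ?thesis using I I' II II' R by blast
qed

end
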